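(* Let $A$ be a discrete valuation ring with maximal ideal $\mathfrak m=tA$ and completion $\hat A$, let $z\in\hat A$ be an element, with leading coefficient $a_0$, satisfying the hypotheses of Akizuki's construction (stated in the context), and let $C_M$ be the resulting Akizuki local domain. Then the completion $\widehat{C_M}$ of the local ring $C_M$ satisfies $$\widehat{C_M}\simeq \hat A[X]/\bigl(X+t(z-a_0)\bigr)^2$$ as rings.
   Context: Akizuki's construction. $A$ is a discrete valuation ring with maximal ideal $\mathfrak m=tA$, and $\hat A$ is its completion. Assume there is an element $z=a_0+a_1t^{n_1}+a_2t^{n_2}+\cdots\in\hat A$ with all $a_i\in A\setminus\mathfrak m$, transcendental over $A$, where $n_0=0$ and $n_r\ge 2n_{r-1}+2$ for all $r\ge 1$. For $r\ge 0$ put $z_r=a_r+a_{r+1}t^{n_{r+1}-n_r}+a_{r+2}t^{n_{r+2}-n_r}+\cdots\in\hat A$ (so $z_0=z$). Let $C=A[t(z_0-a_0),\{(z_i-a_i)^2\}_{i=0}^\infty]\subset\hat A$, let $M$ be the maximal ideal of $C$ generated by $t$ and $t(z_0-a_0)$, and let $C_M$ be the localization of $C$ at $M$. By Akizuki, $C_M$ is a one-dimensional Noetherian local domain. $\widehat{C_M}$ is its completion with respect to its maximal ideal $MC_M$. $\hat A[X]$ is the polynomial ring in one variable, and the quotient is by the ideal generated by $(X+t(z-a_0))^2$. *)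

theory Defs
  imports "HOL-Algebra.Algebra"
begin

locale discrete_valuation_ring = principal_domain +
  assumes ex1_nonzero_prime: "\<exists>!P. primeideal P R \<and> P \<noteq> {\<zero>}"


section \<open>Adic completion\<close>

(* Ideal powers are powers in the library's semiring of ideals; the zeroth power is carrier R. *)
abbreviation ideal_pow :: "('a, 'b) ring_scheme \<Rightarrow> 'a set \<Rightarrow> nat \<Rightarrow> 'a set" where
  "ideal_pow R I k \<equiv> I [^]\<^bsub>ideals_set R\<^esub> k"

(* The inverse limit of the rings R / I^k.  The transition map R / I^(k+1) -> R / I^k sends a
   coset to the unique coset of I^k containing it, so compatibility of a family f of cosets
   is the inclusion f (k+1) <= f k. *)
definition adic_completion :: "('a, 'b) ring_scheme \<Rightarrow> 'a set \<Rightarrow> (nat \<Rightarrow> 'a set) ring" where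
  "adic_completion R I =
    \<lparr>carrier = {f. \<forall>k. f k \<in> carrier (R Quot ideal_pow R I k) \<and> f (Suc k) \<subseteq> f k},
     monoid.mult = (\<lambda>f g k. f k \<otimes>\<^bsub>R Quot ideal_pow R I k\<^esub> g k),
     monoid.one = (\<lambda>k. \<one>\<^bsub>R Quot ideal_pow R I k\<^esub>),
     ring.zero = (\<lambda>k. \<zero>\<^bsub>R Quot ideal_pow R I k\<^esub>),
     ring.add = (\<lambda>f g k. f k \<oplus>\<^bsub>R Quot ideal_pow R I k\<^esub> g k)\<rparr>"

definition to_completion :: "('a, 'b) ring_scheme \<Rightarrow> 'a set \<Rightarrow> 'a \<Rightarrow> nat \<Rightarrow> 'a set" where
  "to_completion R I x = (\<lambda>k. ideal_pow R I k +>\<^bsub>R\<^esub> x)"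

(* Convergence of series in the inverse limit topology: the partial sums are eventually
   constant modulo every I^k. *)
definition adic_sums ::
  "('a, 'b) ring_scheme \<Rightarrow> 'a set \<Rightarrow> (nat \<Rightarrow> nat \<Rightarrow> 'a set) \<Rightarrow> (nat \<Rightarrow> 'a set) \<Rightarrow> bool" where
  "adic_sums R I f s \<longleftrightarrow>
     s \<in> carrier (adic_completion R I) \<and>
     (\<forall>k. \<exists>N. \<forall>n\<ge>N. (\<Oplus>\<^bsub>adic_completion R I\<^esub>i\<in>{..<n}. f i) k = s k)"

definition adic_suminf ::
  "('a, 'b) ring_scheme \<Rightarrow> 'a set \<Rightarrow> (nat \<Rightarrow> nat \<Rightarrow> 'a set) \<Rightarrow> nat \<Rightarrow> 'a set" where
  "adic_suminf R I f = (THE s. adic_sums R I f s)"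


section \<open>Localization\<close>

definition frac_rel :: "('a, 'b) ring_scheme \<Rightarrow> 'a set \<Rightarrow> (('a \<times> 'a) \<times> ('a \<times> 'a)) set" where
  "frac_rel R S = {((a, s), (b, u)). a \<in> carrier R \<and> b \<in> carrier R \<and> s \<in> S \<and> u \<in> S \<and>
     (\<exists>v\<in>S. v \<otimes>\<^bsub>R\<^esub> (u \<otimes>\<^bsub>R\<^esub> a) = v \<otimes>\<^bsub>R\<^esub> (s \<otimes>\<^bsub>R\<^esub> b))}"

definition loc_frac :: "('a, 'b) ring_scheme \<Rightarrow> 'a set \<Rightarrow> 'a \<Rightarrow> 'a \<Rightarrow> ('a \<times> 'a) set" where
  "loc_frac R S a s = frac_rel R S `` {(a, s)}"

(* Operations on classes are unions over representatives, as for rcoset_mult. *)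
definition localization :: "('a, 'b) ring_scheme \<Rightarrow> 'a set \<Rightarrow> ('a \<times> 'a) set ring" where
  "localization R S =
    \<lparr>carrier = (carrier R \<times> S) // frac_rel R S,
     monoid.mult = (\<lambda>P Q. \<Union>(a, s)\<in>P. \<Union>(b, u)\<in>Q. loc_frac R S (a \<otimes>\<^bsub>R\<^esub> b) (s \<otimes>\<^bsub>R\<^esub> u)),
     monoid.one = loc_frac R S \<one>\<^bsub>R\<^esub> \<one>\<^bsub>R\<^esub>,
     ring.zero = loc_frac R S \<zero>\<^bsub>R\<^esub> \<one>\<^bsub>R\<^esub>,
     ring.add = (\<lambda>P Q. \<Union>(a, s)\<in>P. \<Union>(b, u)\<in>Q.
              loc_frac R S ((u \<otimes>\<^bsub>R\<^esub> a) \<oplus>\<^bsub>R\<^esub> (s \<otimes>\<^bsub>R\<^esub> b)) (s \<otimes>\<^bsub>R\<^esub> u))\<rparr>"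


section \<open>Akizuki's construction\<close>

abbreviation completion_at :: "('a, 'b) ring_scheme \<Rightarrow> 'a \<Rightarrow> (nat \<Rightarrow> 'a set) ring" where
  "completion_at A t \<equiv> adic_completion A (PIdl\<^bsub>A\<^esub> t)"

abbreviation to_completion_at :: "('a, 'b) ring_scheme \<Rightarrow> 'a \<Rightarrow> 'a \<Rightarrow> nat \<Rightarrow> 'a set" where
  "to_completion_at A t \<equiv> to_completion A (PIdl\<^bsub>A\<^esub> t)"

(* The tail z_r = a_r + a_(r+1) t^(n_(r+1) - n_r) + a_(r+2) t^(n_(r+2) - n_r) + ... *)
definition akizuki_z ::
  "('a, 'b) ring_scheme \<Rightarrow> 'a \<Rightarrow> (nat \<Rightarrow> 'a) \<Rightarrow> (nat \<Rightarrow> nat) \<Rightarrow> nat \<Rightarrow> nat \<Rightarrow> 'a set" where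
  "akizuki_z A t a n r = adic_suminf A (PIdl\<^bsub>A\<^esub> t)
     (\<lambda>i. to_completion_at A t (a (r + i) \<otimes>\<^bsub>A\<^esub> t [^]\<^bsub>A\<^esub> (n (r + i) - n r)))"

(* t (z_0 - a_0) *)
definition akizuki_w ::
  "('a, 'b) ring_scheme \<Rightarrow> 'a \<Rightarrow> (nat \<Rightarrow> 'a) \<Rightarrow> (nat \<Rightarrow> nat) \<Rightarrow> nat \<Rightarrow> 'a set" where
  "akizuki_w A t a n =
     to_completion_at A t t \<otimes>\<^bsub>completion_at A t\<^esub>
       (akizuki_z A t a n 0 \<ominus>\<^bsub>completion_at A t\<^esub> to_completion_at A t (a 0))"

definition akizuki_ring ::
  "('a, 'b) ring_scheme \<Rightarrow> 'a \<Rightarrow> (nat \<Rightarrow> 'a) \<Rightarrow> (nat \<Rightarrow> nat) \<Rightarrow> (nat \<Rightarrow> 'a set) ring" where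
  "akizuki_ring A t a n = (completion_at A t)\<lparr>carrier :=
     generate_ring (completion_at A t)
       (to_completion_at A t ` carrier A \<union> {akizuki_w A t a n} \<union>
        range (\<lambda>i. (akizuki_z A t a n i \<ominus>\<^bsub>completion_at A t\<^esub> to_completion_at A t (a i))
                     [^]\<^bsub>completion_at A t\<^esub> (2::nat)))\<rparr>"

definition akizuki_ideal ::
  "('a, 'b) ring_scheme \<Rightarrow> 'a \<Rightarrow> (nat \<Rightarrow> 'a) \<Rightarrow> (nat \<Rightarrow> nat) \<Rightarrow> (nat \<Rightarrow> 'a set) set" where
  "akizuki_ideal A t a n =
     Idl\<^bsub>akizuki_ring A t a n\<^esub> {to_completion_at A t t, akizuki_w A t a n}"

definition akizuki_local_ring ::
  "('a, 'b) ring_scheme \<Rightarrow> 'a \<Rightarrow> (nat \<Rightarrow> 'a) \<Rightarrow> (nat \<Rightarrow> nat) \<Rightarrow>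
    ((nat \<Rightarrow> 'a set) \<times> (nat \<Rightarrow> 'a set)) set ring" where
  "akizuki_local_ring A t a n =
     localization (akizuki_ring A t a n)
       (carrier (akizuki_ring A t a n) - akizuki_ideal A t a n)"

(* The extension of the ideal M of C to the localization C_M. *)
definition akizuki_max_ideal ::
  "('a, 'b) ring_scheme \<Rightarrow> 'a \<Rightarrow> (nat \<Rightarrow> 'a) \<Rightarrow> (nat \<Rightarrow> nat) \<Rightarrow>
    ((nat \<Rightarrow> 'a set) \<times> (nat \<Rightarrow> 'a set)) set set" where
  "akizuki_max_ideal A t a n = Idl\<^bsub>akizuki_local_ring A t a n\<^esub>
     ((\<lambda>x. loc_frac (akizuki_ring A t a n)
              (carrier (akizuki_ring A t a n) - akizuki_ideal A t a n)
              x \<one>\<^bsub>akizuki_ring A t a n\<^esub>) ` akizuki_ideal A t a n)"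

end

theory Submission
  imports Defs
begin

text \<open>
Let $A^*$ be the completion of $A$, $w = t(z_0 - a_0)$ and $\<epsilon>^2 = 0$.  Every element of
$C$ is a polynomial in $w$ over $A$ divided by a power of $t$, and $w$ is transcendental over $A$, so
$f \<mapsto> f + f'(w)\<epsilon>$ is well defined and injective on $C$.  Since
$(z_i - a_i)^2 = (w - s_i)^2 / t^{2 n_i + 2}$ with $s_i \<in> A$, the growth condition on the $n_i$
makes the derivative integral, and $C$ embeds into $A^*[\<epsilon>]$.  The relations
$(z_i - a_i)^2 \<in> tC$ and $w^2 \<in> tC$ give $C = A + Aw + tC$, so the image of $C$ is dense and
the filtration of $C_M$ by the powers of its maximal ideal is induced by that of
$A^*[\<epsilon>]$; hence $A^*[\<epsilon>]$ is the completion.  Finally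
$X \<mapsto> -t(z - a_0) + \<epsilon>$ identifies $A^*[X]/(X + t(z - a_0))^2$ with
$A^*[\<epsilon>]$.
\<close>

section \<open>Dual numbers\<close>

text \<open>Seen only inside \<open>H\<close>, the completion of \<open>A\<close>, the ring C has
  closure \<open>H\<close>, which is too small. The topology of the powers of M is finer than the
  one induced from \<open>H\<close>: w is a multiple of t in \<open>H\<close> but not in C. The
  second coordinate detects this, because the derivative of w is the unit 1.

  No derivation is defined on C. The generators are lifted to pairs (value, derivative), and
  \<open>E\<close> is the subring of the dual numbers that these pairs generate. That the derivative
  is single-valued then means that \<open>fst\<close> is injective on \<open>E\<close>;
  transcendence of z enters only there. Everything else about C is read off from identities between
  the lifted generators.

  The bound n_(i+1) >= 2 n_i + 1 would already make the derivatives of the generators (z_i - a_i)^2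
  integral. The bound 2 n_i + 2 leaves one more factor t, so that each of these squares, together
  with its derivative, is t times an element of the ring. This leads to M^2 = t M, hence M^(k+1) =
  t^k M, which is what makes the two filtrations comparable.\<close>

definition dual_numbers :: "('a, 'b) ring_scheme \<Rightarrow> ('a \<times> 'a) ring" where
  "dual_numbers R =
    \<lparr>carrier = carrier R \<times> carrier R,
     monoid.mult = (\<lambda>x y. (fst x \<otimes>\<^bsub>R\<^esub> fst y, fst x \<otimes>\<^bsub>R\<^esub> snd y \<oplus>\<^bsub>R\<^esub> snd x \<otimes>\<^bsub>R\<^esub> fst y)),
     monoid.one = (\<one>\<^bsub>R\<^esub>, \<zero>\<^bsub>R\<^esub>),
     ring.zero = (\<zero>\<^bsub>R\<^esub>, \<zero>\<^bsub>R\<^esub>),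
     ring.add = (\<lambda>x y. (fst x \<oplus>\<^bsub>R\<^esub> fst y, snd x \<oplus>\<^bsub>R\<^esub> snd y))\<rparr>"

lemma dual_numbers_simps:
  "carrier (dual_numbers R) = carrier R \<times> carrier R"
  "(a, b) \<otimes>\<^bsub>dual_numbers R\<^esub> (c, d) = (a \<otimes>\<^bsub>R\<^esub> c, a \<otimes>\<^bsub>R\<^esub> d \<oplus>\<^bsub>R\<^esub> b \<otimes>\<^bsub>R\<^esub> c)"
  "(a, b) \<oplus>\<^bsub>dual_numbers R\<^esub> (c, d) = (a \<oplus>\<^bsub>R\<^esub> c, b \<oplus>\<^bsub>R\<^esub> d)"
  "\<one>\<^bsub>dual_numbers R\<^esub> = (\<one>\<^bsub>R\<^esub>, \<zero>\<^bsub>R\<^esub>)"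
  "\<zero>\<^bsub>dual_numbers R\<^esub> = (\<zero>\<^bsub>R\<^esub>, \<zero>\<^bsub>R\<^esub>)"
  by (simp_all add: dual_numbers_def)

context cring
begin

lemma dual_numbers_cring: "cring (dual_numbers R)"
proof (rule cringI)
  show "abelian_group (dual_numbers R)"
  proof (rule abelian_groupI)
    fix x assume "x \<in> carrier (dual_numbers R)"
    then show "\<exists>y\<in>carrier (dual_numbers R). y \<oplus>\<^bsub>dual_numbers R\<^esub> x = \<zero>\<^bsub>dual_numbers R\<^esub>"
      by (intro bexI[of _ "(\<ominus> fst x, \<ominus> snd x)"]) (auto simp: dual_numbers_simps l_neg)
  qed (auto simp: dual_numbers_simps a_ac)
  show "Group.comm_monoid (dual_numbers R)"
  proof (rule comm_monoidI)
    fix x y z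
    assume "x \<in> carrier (dual_numbers R)" "y \<in> carrier (dual_numbers R)"
      "z \<in> carrier (dual_numbers R)"
    then obtain a b c d e f where "x = (a, b)" "y = (c, d)" "z = (e, f)"
      and car: "a \<in> carrier R" "b \<in> carrier R" "c \<in> carrier R" "d \<in> carrier R"
        "e \<in> carrier R" "f \<in> carrier R"
      by (auto simp: dual_numbers_simps)
    moreover have "a \<otimes> c \<otimes> f \<oplus> (a \<otimes> d \<oplus> b \<otimes> c) \<otimes> e = a \<otimes> (c \<otimes> f \<oplus> d \<otimes> e) \<oplus> b \<otimes> (c \<otimes> e)"
      using car by (simp add: l_distr r_distr m_ac a_ac)
    ultimately show "x \<otimes>\<^bsub>dual_numbers R\<^esub> y \<otimes>\<^bsub>dual_numbers R\<^esub> z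
        = x \<otimes>\<^bsub>dual_numbers R\<^esub> (y \<otimes>\<^bsub>dual_numbers R\<^esub> z)"
      using car by (simp add: dual_numbers_simps m_assoc)
  qed (auto simp: dual_numbers_simps m_comm a_comm)
qed (auto simp: dual_numbers_simps l_distr a_ac)

lemma dual_numbers_a_inv:
  assumes "a \<in> carrier R" "b \<in> carrier R"
  shows "\<ominus>\<^bsub>dual_numbers R\<^esub> (a, b) = (\<ominus> a, \<ominus> b)"
proof -
  interpret D: cring "dual_numbers R" by (rule dual_numbers_cring)
  show ?thesis
    by (rule D.minus_equality) (use assms in \<open>auto simp: dual_numbers_simps l_neg\<close>)
qed

lemma dual_numbers_minus:
  assumes "a \<in> carrier R" "b \<in> carrier R" "c \<in> carrier R" "d \<in> carrier R"
  shows "(a, b) \<ominus>\<^bsub>dual_numbers R\<^esub> (c, d) = (a \<ominus> c, b \<ominus> d)"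
  using assms by (simp add: a_minus_def dual_numbers_a_inv dual_numbers_simps)

lemma dual_numbers_pow_const:
  "a \<in> carrier R \<Longrightarrow> (a, \<zero>) [^]\<^bsub>dual_numbers R\<^esub> (k::nat) = (a [^] k, \<zero>)"
  by (induction k) (simp_all add: dual_numbers_simps)

text \<open>Since \<epsilon>^2 = 0, the inverse of a + b \<epsilon> is a^(-1) - b a^(-2) \<epsilon>.
  This later inverts the images of the elements of C outside M.\<close>

lemma dual_numbers_Units:
  assumes "a \<in> Units R" "b \<in> carrier R"
  shows "(a, b) \<in> Units (dual_numbers R)"
proof -
  interpret D: cring "dual_numbers R" by (rule dual_numbers_cring)
  have a: "a \<in> carrier R" "inv a \<in> carrier R" using assms by auto
  have "a \<otimes> (\<ominus> (b \<otimes> (inv a \<otimes> inv a))) \<oplus> b \<otimes> inv a = \<ominus> (b \<otimes> inv a) \<otimes> (a \<otimes> inv a) \<oplus> b \<otimes> inv a"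
    using a assms(2) by (simp add: m_ac l_minus r_minus)
  also have "\<dots> = \<zero>" using a assms by (simp add: l_neg)
  finally have "(a, b) \<otimes>\<^bsub>dual_numbers R\<^esub> (inv a, \<ominus> (b \<otimes> (inv a \<otimes> inv a))) = \<one>\<^bsub>dual_numbers R\<^esub>"
    using assms by (simp add: dual_numbers_simps)
  moreover have "(a, b) \<in> carrier (dual_numbers R)"
    and "(inv a, \<ominus> (b \<otimes> (inv a \<otimes> inv a))) \<in> carrier (dual_numbers R)"
    using a assms by (auto simp: dual_numbers_simps)
  ultimately show ?thesis
    using D.m_comm[of "(a, b)" "(inv a, \<ominus> (b \<otimes> (inv a \<otimes> inv a)))"]
    unfolding Units_def by (auto intro!: bexI[of _ "(inv a, \<ominus> (b \<otimes> (inv a \<otimes> inv a)))"])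
qed

lemma dual_numbers_const_hom: "ring_hom_cring R (dual_numbers R) (\<lambda>a. (a, \<zero>))"
  by (intro ring_hom_cring.intro ring_hom_cring_axioms.intro is_cring dual_numbers_cring
      ring_hom_memI) (auto simp: dual_numbers_simps)

lemma dual_numbers_fst_hom: "fst \<in> ring_hom (dual_numbers R) R"
  by (auto intro!: ring_hom_memI simp: dual_numbers_simps)

end

text \<open>The isomorphism is evaluation at $X = -s + \<epsilon>$ with $\<epsilon> = (0, 1)$; the remainder
  theorem, applied twice, computes the kernel.\<close>
lemma UP_Quot_square_iso_dual_numbers:
  fixes R :: "('a, 'b) ring_scheme" (structure)
  assumes "cring R" and s: "s \<in> carrier R" and nontriv: "carrier R \<noteq> {\<zero>}"
  shows "UP R Quot (PIdl\<^bsub>UP R\<^esub> ((up_ring.monom (UP R) \<one> 1 \<oplus>\<^bsub>UP R\<^esub> up_ring.monom (UP R) s 0) [^]\<^bsub>UP R\<^esub> (2::nat)))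
    \<simeq> dual_numbers R"
proof -
  let ?D = "dual_numbers R"
  define h :: "'a \<Rightarrow> 'a \<times> 'a" where "h = (\<lambda>a. (a, \<zero>))"
  let ?x = "(\<ominus> s, \<one>)"
  interpret UP_cring R "UP R"
    by (intro UP_cring.intro \<open>cring R\<close>)
  interpret D: cring ?D by (rule R.dual_numbers_cring)
  interpret E: UP_pre_univ_prop R ?D h "UP R"
    by (intro UP_pre_univ_prop.intro R.dual_numbers_const_hom[folded h_def] UP_cring_axioms)
  let ?ev = "UnivPoly.eval R ?D h ?x"
  define g where "g = up_ring.monom (UP R) \<one> 1 \<oplus>\<^bsub>UP R\<^esub> up_ring.monom (UP R) s 0"
  have x: "?x \<in> carrier ?D" using s by (simp add: dual_numbers_simps)
  interpret ev: ring_hom_cring "UP R" ?D ?ev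
    by unfold_locales (rule E.eval_ring_hom[OF x])
  have g: "g \<in> carrier (UP R)" using s by (simp add: g_def)
  have g2: "g [^]\<^bsub>UP R\<^esub> (2::nat) = g \<otimes>\<^bsub>UP R\<^esub> g"
    using g by (simp add: numeral_2_eq_2)
  \<comment> \<open>The remainder theorem divides by X minus a root, so \<open>g\<close> is
    rewritten with root -s.\<close>
  have g_minus: "g = up_ring.monom (UP R) \<one> 1 \<ominus>\<^bsub>UP R\<^esub> up_ring.monom (UP R) (\<ominus> s) 0"
    using s by (simp add: g_def P.minus_eq)
  have ev_const: "?ev (up_ring.monom (UP R) c 0) = (c, \<zero>)" if "c \<in> carrier R" for c
    using E.eval_const[OF x that] by (simp add: h_def)
  have ev_g: "?ev g = (\<zero>, \<one>)"
    using s E.eval_monom1[OF x] ev_const[OF s] by (simp add: g_def dual_numbers_simps R.l_neg)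
  have div: "\<exists>q c. q \<in> carrier (UP R) \<and> c \<in> carrier R \<and> f = g \<otimes>\<^bsub>UP R\<^esub> q \<oplus>\<^bsub>UP R\<^esub> up_ring.monom (UP R) c 0"
    if f: "f \<in> carrier (UP R)" for f
  proof -
    interpret I: UP_pre_univ_prop R R id "UP R" by standard simp
    have "UnivPoly.eval R R id (\<ominus> s) f \<in> carrier R"
      using I.eval_ring_hom[of "\<ominus> s"] f s by (auto simp: ring_hom_def)
    then show ?thesis
      using remainder_theorem[OF f R.a_inv_closed[OF s] nontriv] unfolding g_minus by blast
  qed
  have ker: "a_kernel (UP R) ?D ?ev = PIdl\<^bsub>UP R\<^esub> (g [^]\<^bsub>UP R\<^esub> (2::nat))"
  proof
    show "PIdl\<^bsub>UP R\<^esub> (g [^]\<^bsub>UP R\<^esub> (2::nat)) \<subseteq> a_kernel (UP R) ?D ?ev"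
    proof (rule P.cgenideal_minimal[OF ev.ring.kernel_is_ideal])
      have "?ev (g [^]\<^bsub>UP R\<^esub> (2::nat)) = \<zero>\<^bsub>?D\<^esub>"
        unfolding g2 ev.hom_mult[OF g g] ev_g by (simp add: dual_numbers_simps)
      then show "g [^]\<^bsub>UP R\<^esub> (2::nat) \<in> a_kernel (UP R) ?D ?ev"
        unfolding a_kernel_def' using P.nat_pow_closed[OF g] by blast
    qed
  next
    show "a_kernel (UP R) ?D ?ev \<subseteq> PIdl\<^bsub>UP R\<^esub> (g [^]\<^bsub>UP R\<^esub> (2::nat))"
    proof
      fix f assume "f \<in> a_kernel (UP R) ?D ?ev"
      then have f: "f \<in> carrier (UP R)" "?ev f = (\<zero>, \<zero>)"
        unfolding a_kernel_def' dual_numbers_simps by blast+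
      \<comment> \<open>Dividing twice gives f = g^2 p + d g + c. As \<open>g\<close> evaluates to
        \<epsilon>, the value of f is (c, d), so both remainders vanish on the kernel.\<close>
      from div[OF f(1)] obtain q c where q: "q \<in> carrier (UP R)" and c: "c \<in> carrier R"
        and fq: "f = g \<otimes>\<^bsub>UP R\<^esub> q \<oplus>\<^bsub>UP R\<^esub> up_ring.monom (UP R) c 0" by blast
      from div[OF q] obtain p d where p: "p \<in> carrier (UP R)" and d: "d \<in> carrier R"
        and qp: "q = g \<otimes>\<^bsub>UP R\<^esub> p \<oplus>\<^bsub>UP R\<^esub> up_ring.monom (UP R) d 0" by blast
      obtain p1 p2 where evp: "?ev p = (p1, p2)" "p1 \<in> carrier R" "p2 \<in> carrier R"
        using ev.hom_closed[OF p] unfolding dual_numbers_simps by blast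
      have "?ev q = ?ev g \<otimes>\<^bsub>?D\<^esub> ?ev p \<oplus>\<^bsub>?D\<^esub> ?ev (up_ring.monom (UP R) d 0)"
        unfolding qp using g p d by (simp only: ev.hom_add ev.hom_mult P.m_closed monom_closed)
      also have "\<dots> = (d, p1)"
        unfolding ev_g evp ev_const[OF d] using d evp by (simp add: dual_numbers_simps)
      finally have evq: "?ev q = (d, p1)" .
      have "?ev f = ?ev g \<otimes>\<^bsub>?D\<^esub> ?ev q \<oplus>\<^bsub>?D\<^esub> ?ev (up_ring.monom (UP R) c 0)"
        unfolding fq using g q c by (simp only: ev.hom_add ev.hom_mult P.m_closed monom_closed)
      also have "\<dots> = (c, d)"
        unfolding ev_g evq ev_const[OF c] using c d evp by (simp add: dual_numbers_simps)
      finally have cd: "c = \<zero>" "d = \<zero>" unfolding f(2) by blast+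
      have "g \<otimes>\<^bsub>UP R\<^esub> (g \<otimes>\<^bsub>UP R\<^esub> p) = p \<otimes>\<^bsub>UP R\<^esub> (g \<otimes>\<^bsub>UP R\<^esub> g)"
        using g p by (simp add: P.m_ac)
      then have "f = p \<otimes>\<^bsub>UP R\<^esub> (g [^]\<^bsub>UP R\<^esub> (2::nat))"
        using g p unfolding fq qp cd g2 by simp
      then show "f \<in> PIdl\<^bsub>UP R\<^esub> (g [^]\<^bsub>UP R\<^esub> (2::nat))"
        using p unfolding cgenideal_def by (intro CollectI exI conjI)
    qed
  qed
  have "?ev ` carrier (UP R) = carrier ?D"
  proof
    show "?ev ` carrier (UP R) \<subseteq> carrier ?D" by auto
    show "carrier ?D \<subseteq> ?ev ` carrier (UP R)"
    proof
      fix u assume "u \<in> carrier ?D"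
      then obtain c d where u: "u = (c, d)" "c \<in> carrier R" "d \<in> carrier R"
        by (auto simp: dual_numbers_simps)
      \<comment> \<open>The same computation read backwards: d g + c is a preimage of (c,
        d).\<close>
      have "?ev (g \<otimes>\<^bsub>UP R\<^esub> up_ring.monom (UP R) d 0 \<oplus>\<^bsub>UP R\<^esub> up_ring.monom (UP R) c 0) = u"
        using u g by (simp add: ev_g ev_const dual_numbers_simps)
      moreover have "g \<otimes>\<^bsub>UP R\<^esub> up_ring.monom (UP R) d 0 \<oplus>\<^bsub>UP R\<^esub> up_ring.monom (UP R) c 0 \<in> carrier (UP R)"
        using u g by simp
      ultimately show "u \<in> ?ev ` carrier (UP R)" by blast
    qed
  qed
  from ev.ring.FactRing_iso[OF this] show ?thesis unfolding ker g_def .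
qed

section \<open>Adic completions\<close>

lemma (in ring) a_r_coset_eq:
  assumes "ideal I R" "x \<in> carrier R"
  shows "I +> x = {y \<in> carrier R. y \<ominus> x \<in> I}"
proof -
  interpret ideal I R by fact
  show ?thesis
    using a_rcos_module_minus[OF ring_axioms assms(2)] a_r_coset_subset_G[OF a_subset assms(2)]
    by blast
qed

lemma (in ring) minus_add_minus:
  assumes "x \<in> carrier R" "y \<in> carrier R" "z \<in> carrier R"
  shows "(x \<ominus> y) \<oplus> (y \<ominus> z) = x \<ominus> z"
  using assms by (simp add: a_minus_def a_assoc r_neg1)

lemma ideals_set_simps [simp]:
  "\<one>\<^bsub>ideals_set R\<^esub> = carrier R" "I \<otimes>\<^bsub>ideals_set R\<^esub> J = ideal_prod R I J"
  by (simp_all add: ideals_set_def)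

context cring
begin

lemma ideal_pow_ideal:
  assumes "ideal I R" shows "ideal (ideal_pow R I k) R"
  by (induction k) (simp_all add: oneideal ideal_prod_is_ideal assms)

lemma ideal_pow_Suc_subset:
  assumes "ideal I R" shows "ideal_pow R I (Suc k) \<subseteq> ideal_pow R I k"
  using ideal_prod_inter[OF ideal_pow_ideal[OF assms] assms] by auto

text \<open>Nesting of cosets amounts to congruence of consecutive representatives modulo the
  smaller exponent. With the converse \<open>completion_elemE\<close>, computations in the inverse
  limit become computations with representing sequences.\<close>

lemma completion_elem_closed:
  assumes I: "ideal I R" and \<alpha>: "\<And>k. \<alpha> k \<in> carrier R"
    and cauchy: "\<And>k. \<alpha> (Suc k) \<ominus> \<alpha> k \<in> ideal_pow R I k"
  shows "(\<lambda>k. ideal_pow R I k +> \<alpha> k) \<in> carrier (adic_completion R I)"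
proof -
  have "ideal_pow R I (Suc k) +> \<alpha> (Suc k) \<subseteq> ideal_pow R I k +> \<alpha> k" for k
  proof -
    interpret K: ideal "ideal_pow R I k" R by (rule ideal_pow_ideal[OF I])
    show ?thesis
    proof
      fix y assume "y \<in> ideal_pow R I (Suc k) +> \<alpha> (Suc k)"
      then have y: "y \<in> carrier R" "y \<ominus> \<alpha> (Suc k) \<in> ideal_pow R I k"
        using ideal_pow_Suc_subset[OF I, of k]
        unfolding a_r_coset_eq[OF ideal_pow_ideal[OF I] \<alpha>] by blast+
      then have "y \<ominus> \<alpha> k \<in> ideal_pow R I k"
        using K.a_closed[OF y(2) cauchy] \<alpha> by (simp add: minus_add_minus)
      then show "y \<in> ideal_pow R I k +> \<alpha> k"
        using y by (simp add: a_r_coset_eq[OF ideal_pow_ideal[OF I] \<alpha>])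
    qed
  qed
  then show ?thesis
    using \<alpha> by (auto simp: adic_completion_def FactRing_def A_RCOSETS_defs a_r_coset_def)
qed

lemma completion_elemE:
  assumes I: "ideal I R" and f: "f \<in> carrier (adic_completion R I)"
  obtains \<alpha> where "\<And>k. \<alpha> k \<in> carrier R" "\<And>k. \<alpha> (Suc k) \<ominus> \<alpha> k \<in> ideal_pow R I k"
    "f = (\<lambda>k. ideal_pow R I k +> \<alpha> k)"
proof -
  have "\<forall>k. \<exists>x. x \<in> carrier R \<and> f k = ideal_pow R I k +> x"
    using f by (simp add: adic_completion_def FactRing_def A_RCOSETS_defs a_r_coset_def) blast
  then obtain \<alpha> where \<alpha>: "\<And>k. \<alpha> k \<in> carrier R" "\<And>k. f k = ideal_pow R I k +> \<alpha> k"
    by metis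
  have "\<alpha> (Suc k) \<ominus> \<alpha> k \<in> ideal_pow R I k" for k
  proof -
    interpret K: ideal "ideal_pow R I (Suc k)" R by (rule ideal_pow_ideal[OF I])
    have "\<alpha> (Suc k) \<in> f (Suc k)" using \<alpha> K.a_rcos_self by simp
    moreover have "f (Suc k) \<subseteq> f k" using f by (simp add: adic_completion_def)
    ultimately have "\<alpha> (Suc k) \<in> ideal_pow R I k +> \<alpha> k" using \<alpha>(2) by blast
    then show ?thesis by (simp add: a_r_coset_eq[OF ideal_pow_ideal[OF I] \<alpha>(1)])
  qed
  moreover have "f = (\<lambda>k. ideal_pow R I k +> \<alpha> k)" using \<alpha>(2) by blast
  ultimately show ?thesis using that \<alpha>(1) by blast
qed

lemma completion_add:
  assumes "ideal I R" "\<And>k. \<alpha> k \<in> carrier R" "\<And>k. \<beta> k \<in> carrier R"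
  shows "(\<lambda>k. ideal_pow R I k +> \<alpha> k) \<oplus>\<^bsub>adic_completion R I\<^esub> (\<lambda>k. ideal_pow R I k +> \<beta> k)
    = (\<lambda>k. ideal_pow R I k +> (\<alpha> k \<oplus> \<beta> k))"
  using assms ideal.a_rcos_sum[OF ideal_pow_ideal[OF assms(1)]]
  by (simp add: adic_completion_def FactRing_def)

lemma completion_mult:
  assumes "ideal I R" "\<And>k. \<alpha> k \<in> carrier R" "\<And>k. \<beta> k \<in> carrier R"
  shows "(\<lambda>k. ideal_pow R I k +> \<alpha> k) \<otimes>\<^bsub>adic_completion R I\<^esub> (\<lambda>k. ideal_pow R I k +> \<beta> k)
    = (\<lambda>k. ideal_pow R I k +> (\<alpha> k \<otimes> \<beta> k))"
  using assms ideal.rcoset_mult_add[OF ideal_pow_ideal[OF assms(1)]]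
  by (simp add: adic_completion_def FactRing_def)

lemma completion_one: "\<one>\<^bsub>adic_completion R I\<^esub> = (\<lambda>k. ideal_pow R I k +> \<one>)"
  by (simp add: adic_completion_def FactRing_def)

lemma completion_zero:
  assumes "ideal I R"
  shows "\<zero>\<^bsub>adic_completion R I\<^esub> = (\<lambda>k. ideal_pow R I k +> \<zero>)"
  using ideal_pow_ideal[OF assms, THEN ideal.Icarr]
  by (auto simp: adic_completion_def FactRing_def a_minus_def a_r_coset_eq[OF ideal_pow_ideal[OF assms]])

lemma add_diff_add:
  assumes "x \<in> carrier R" "y \<in> carrier R" "x' \<in> carrier R" "y' \<in> carrier R"
  shows "(x \<oplus> y) \<ominus> (x' \<oplus> y') = (x \<ominus> x') \<oplus> (y \<ominus> y')"
  using assms by (simp add: a_minus_def minus_add a_ac)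

lemma mult_diff_mult:
  assumes "x \<in> carrier R" "y \<in> carrier R" "x' \<in> carrier R" "y' \<in> carrier R"
  shows "x \<otimes> y \<ominus> x' \<otimes> y' = x \<otimes> (y \<ominus> y') \<oplus> (x \<ominus> x') \<otimes> y'"
  using assms by (simp add: a_minus_def r_distr l_distr a_assoc r_minus l_minus r_neg1)

lemma ideal_add_diff:
  assumes "ideal J R" "x \<ominus> x' \<in> J" "y \<ominus> y' \<in> J"
    "x \<in> carrier R" "y \<in> carrier R" "x' \<in> carrier R" "y' \<in> carrier R"
  shows "(x \<oplus> y) \<ominus> (x' \<oplus> y') \<in> J"
proof -
  interpret J: ideal J R by fact
  show ?thesis using assms by (simp add: add_diff_add)
qed

lemma ideal_mult_diff:
  assumes "ideal J R" "x \<ominus> x' \<in> J" "y \<ominus> y' \<in> J"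
    "x \<in> carrier R" "y \<in> carrier R" "x' \<in> carrier R" "y' \<in> carrier R"
  shows "x \<otimes> y \<ominus> x' \<otimes> y' \<in> J"
proof -
  interpret J: ideal J R by fact
  show ?thesis using assms by (simp add: mult_diff_mult J.I_l_closed J.I_r_closed)
qed

text \<open>Each identity reduces levelwise to the same identity of representatives in
  \<open>R\<close>. Only membership in the carrier needs the congruences between consecutive
  representatives.\<close>

lemma completion_cring:
  assumes I: "ideal I R"
  shows "cring (adic_completion R I)"
proof (rule cringI)
  let ?H = "adic_completion R I"
  note ops = completion_add[OF I] completion_mult[OF I] completion_one completion_zero[OF I]
  note pow = ideal_pow_ideal[OF I]
  have add_closed: "f \<oplus>\<^bsub>?H\<^esub> g \<in> carrier ?H" if "f \<in> carrier ?H" "g \<in> carrier ?H" for f g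
    using that by (elim completion_elemE[OF I])
      (auto simp: ops intro!: completion_elem_closed I ideal_add_diff pow)
  have mult_closed: "f \<otimes>\<^bsub>?H\<^esub> g \<in> carrier ?H" if "f \<in> carrier ?H" "g \<in> carrier ?H" for f g
    using that by (elim completion_elemE[OF I])
      (auto simp: ops intro!: completion_elem_closed I ideal_mult_diff pow)
  have const: "(\<lambda>k. ideal_pow R I k +> c) \<in> carrier ?H" if "c \<in> carrier R" for c
    using that additive_subgroup.zero_closed[OF ideal.axioms(1)[OF pow]]
    by (intro completion_elem_closed I) (auto simp: r_neg a_minus_def)
  show "abelian_group ?H"
  proof (rule abelian_groupI)
    fix f assume "f \<in> carrier ?H"
    then obtain \<alpha> where \<alpha>: "\<And>k. \<alpha> k \<in> carrier R"
        "\<And>k. \<alpha> (Suc k) \<ominus> \<alpha> k \<in> ideal_pow R I k"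
        and f: "f = (\<lambda>k. ideal_pow R I k +> \<alpha> k)"
      by (rule completion_elemE[OF I]) (rule that)
    have "\<ominus> \<alpha> (Suc k) \<ominus> (\<ominus> \<alpha> k) \<in> ideal_pow R I k" for k
    proof -
      interpret K: ideal "ideal_pow R I k" R by (rule pow)
      have "\<ominus> \<alpha> (Suc k) \<ominus> (\<ominus> \<alpha> k) = \<ominus> (\<alpha> (Suc k) \<ominus> \<alpha> k)"
        using \<alpha>(1) by (simp add: a_minus_def minus_add)
      then show ?thesis using K.a_inv_closed[OF \<alpha>(2)] by simp
    qed
    then have "(\<lambda>k. ideal_pow R I k +> (\<ominus> \<alpha> k)) \<in> carrier ?H"
      using \<alpha>(1) by (intro completion_elem_closed I) auto
    then show "\<exists>g\<in>carrier ?H. g \<oplus>\<^bsub>?H\<^esub> f = \<zero>\<^bsub>?H\<^esub>"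
      by (rule bexI[rotated]) (simp add: f ops l_neg \<alpha>(1))
  next
    fix f g h assume "f \<in> carrier ?H" "g \<in> carrier ?H" "h \<in> carrier ?H"
    then show "f \<oplus>\<^bsub>?H\<^esub> g \<oplus>\<^bsub>?H\<^esub> h = f \<oplus>\<^bsub>?H\<^esub> (g \<oplus>\<^bsub>?H\<^esub> h)"
      by (elim completion_elemE[OF I]) (simp add: ops a_assoc)
  next
    fix f g assume "f \<in> carrier ?H" "g \<in> carrier ?H"
    then show "f \<oplus>\<^bsub>?H\<^esub> g = g \<oplus>\<^bsub>?H\<^esub> f"
      by (elim completion_elemE[OF I]) (simp add: ops a_comm)
  next
    fix f assume "f \<in> carrier ?H"
    then show "\<zero>\<^bsub>?H\<^esub> \<oplus>\<^bsub>?H\<^esub> f = f"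
      by (elim completion_elemE[OF I]) (simp add: ops)
  next
    show "\<zero>\<^bsub>?H\<^esub> \<in> carrier ?H" using const[OF zero_closed] by (simp add: ops)
  qed (rule add_closed)
  show "Group.comm_monoid ?H"
  proof (rule comm_monoidI)
    fix f g h assume "f \<in> carrier ?H" "g \<in> carrier ?H" "h \<in> carrier ?H"
    then show "f \<otimes>\<^bsub>?H\<^esub> g \<otimes>\<^bsub>?H\<^esub> h = f \<otimes>\<^bsub>?H\<^esub> (g \<otimes>\<^bsub>?H\<^esub> h)"
      by (elim completion_elemE[OF I]) (simp add: ops m_assoc)
  next
    fix f g assume "f \<in> carrier ?H" "g \<in> carrier ?H"
    then show "f \<otimes>\<^bsub>?H\<^esub> g = g \<otimes>\<^bsub>?H\<^esub> f"
      by (elim completion_elemE[OF I]) (simp add: ops m_comm)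
  next
    fix f assume "f \<in> carrier ?H"
    then show "\<one>\<^bsub>?H\<^esub> \<otimes>\<^bsub>?H\<^esub> f = f"
      by (elim completion_elemE[OF I]) (simp add: ops)
  next
    show "\<one>\<^bsub>?H\<^esub> \<in> carrier ?H" using const[OF one_closed] by (simp add: ops)
  qed (rule mult_closed)
  fix f g h assume "f \<in> carrier ?H" "g \<in> carrier ?H" "h \<in> carrier ?H"
  then show "(f \<oplus>\<^bsub>?H\<^esub> g) \<otimes>\<^bsub>?H\<^esub> h = f \<otimes>\<^bsub>?H\<^esub> h \<oplus>\<^bsub>?H\<^esub> g \<otimes>\<^bsub>?H\<^esub> h"
    by (elim completion_elemE[OF I]) (simp add: ops l_distr)
qed

lemma to_completion_hom:
  assumes I: "ideal I R"
  shows "to_completion R I \<in> ring_hom R (adic_completion R I)"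
proof (rule ring_hom_memI)
  fix x assume "x \<in> carrier R"
  then show "to_completion R I x \<in> carrier (adic_completion R I)"
    using additive_subgroup.zero_closed[OF ideal.axioms(1)[OF ideal_pow_ideal[OF I]]]
    unfolding to_completion_def
    by (intro completion_elem_closed I) (auto simp: r_neg a_minus_def)
qed (simp_all add: to_completion_def completion_add completion_mult completion_one I)

text \<open>Negation in a ring record is characterised only by its defining property, so the
  levelwise negative must first be shown to lie in the carrier and then be recognised as the
  inverse.\<close>

lemma completion_minus:
  assumes I: "ideal I R" and f: "(\<lambda>k. ideal_pow R I k +> \<alpha> k) \<in> carrier (adic_completion R I)"
    and g: "(\<lambda>k. ideal_pow R I k +> \<beta> k) \<in> carrier (adic_completion R I)"
    and \<alpha>: "\<And>k. \<alpha> k \<in> carrier R" and \<beta>: "\<And>k. \<beta> k \<in> carrier R"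
  shows "(\<lambda>k. ideal_pow R I k +> \<alpha> k) \<ominus>\<^bsub>adic_completion R I\<^esub> (\<lambda>k. ideal_pow R I k +> \<beta> k)
    = (\<lambda>k. ideal_pow R I k +> (\<alpha> k \<ominus> \<beta> k))"
proof -
  let ?H = "adic_completion R I"
  interpret H: cring ?H by (rule completion_cring[OF I])
  interpret K: ideal "ideal_pow R I k" R for k by (rule ideal_pow_ideal[OF I])
  let ?n = "\<lambda>k. ideal_pow R I k +> (\<ominus> \<beta> k)"
  have "\<beta> (Suc k) \<ominus> \<beta> k \<in> ideal_pow R I k" for k
  proof -
    have "ideal_pow R I (Suc k) +> \<beta> (Suc k) \<subseteq> ideal_pow R I k +> \<beta> k"
      using g by (simp add: adic_completion_def)
    then have "\<beta> (Suc k) \<in> ideal_pow R I k +> \<beta> k"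
      using K.a_rcos_self[OF \<beta>, of "Suc k" "Suc k"] by blast
    then show ?thesis by (simp add: a_r_coset_eq[OF ideal_pow_ideal[OF I] \<beta>])
  qed
  moreover have "\<ominus> \<beta> (Suc k) \<ominus> (\<ominus> \<beta> k) = \<ominus> (\<beta> (Suc k) \<ominus> \<beta> k)" for k
    using \<beta> by (simp add: a_minus_def minus_add)
  ultimately have n: "?n \<in> carrier ?H"
    using \<beta> K.a_inv_closed by (intro completion_elem_closed I) auto
  have "\<ominus>\<^bsub>?H\<^esub> (\<lambda>k. ideal_pow R I k +> \<beta> k) = ?n"
    by (rule H.minus_equality[OF _ g n]) (simp add: completion_add completion_zero I \<beta> l_neg)
  then show ?thesis
    using \<alpha> \<beta> by (simp add: a_minus_def completion_add I)
qed

end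

text \<open>Hypotheses \<open>pow\<close> and \<open>dense\<close> say that \<open>G\<close> induces
  isomorphisms from R / I^k onto B / J k; \<open>sep\<close> and \<open>complete\<close> say that
  \<open>B\<close> is the inverse limit of the latter. The ideals \<open>J k\<close> need not be
  given as powers, only as a decreasing filtration that pulls back to the powers of
  \<open>I\<close>.\<close>

theorem adic_completion_iso:
  fixes R :: "('a, 'b) ring_scheme" (structure) and B :: "('c, 'd) ring_scheme"
  assumes "cring R" and I: "ideal I R" and "cring B" and G: "G \<in> ring_hom R B"
    and J: "\<And>k. ideal (J k) B" and J_Suc: "\<And>k. J (Suc k) \<subseteq> J k"
    and pow: "\<And>k. ideal_pow R I k = {r \<in> carrier R. G r \<in> J k}"
    and dense: "\<And>b k. b \<in> carrier B \<Longrightarrow> \<exists>r\<in>carrier R. G r \<ominus>\<^bsub>B\<^esub> b \<in> J k"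
    and sep: "\<And>b. b \<in> carrier B \<Longrightarrow> (\<And>k. b \<in> J k) \<Longrightarrow> b = \<zero>\<^bsub>B\<^esub>"
    and complete: "\<And>x. (\<And>k. x k \<in> carrier B) \<Longrightarrow> (\<And>k. x (Suc k) \<ominus>\<^bsub>B\<^esub> x k \<in> J k) \<Longrightarrow>
      \<exists>b\<in>carrier B. \<forall>k. x k \<ominus>\<^bsub>B\<^esub> b \<in> J k"
  shows "adic_completion R I \<simeq> B"
proof -
  interpret R: cring R by fact
  interpret B: cring B by fact
  interpret G: ring_hom_cring R B G by unfold_locales (rule G)
  interpret J: ideal "J k" B for k by (rule J)
  let ?H = "adic_completion R I"
  \<comment> \<open>Mapping from \<open>B\<close> to the completion avoids choices: the coset at
    level k consists of all elements of \<open>R\<close> that approximate b modulo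
    \<open>J k\<close>.\<close>
  define \<theta> where "\<theta> b = (\<lambda>k. {r \<in> carrier R. G r \<ominus>\<^bsub>B\<^esub> b \<in> J k})" for b
  have J_sym: "y \<ominus>\<^bsub>B\<^esub> x \<in> J k" if "x \<ominus>\<^bsub>B\<^esub> y \<in> J k" "x \<in> carrier B" "y \<in> carrier B" for x y k
  proof -
    have "y \<ominus>\<^bsub>B\<^esub> x = \<ominus>\<^bsub>B\<^esub> (x \<ominus>\<^bsub>B\<^esub> y)"
      using that by (simp add: a_minus_def B.minus_add B.a_comm)
    then show ?thesis using J.a_inv_closed[OF that(1)] by simp
  qed
  have J_trans: "x \<ominus>\<^bsub>B\<^esub> z \<in> J k" if "x \<ominus>\<^bsub>B\<^esub> y \<in> J k" "y \<ominus>\<^bsub>B\<^esub> z \<in> J k"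
    "x \<in> carrier B" "y \<in> carrier B" "z \<in> carrier B" for x y z k
    using J.a_closed[OF that(1,2)] that(3-5) by (simp add: B.minus_add_minus)
  have G_minus: "G (x \<ominus> y) = G x \<ominus>\<^bsub>B\<^esub> G y" if "x \<in> carrier R" "y \<in> carrier R" for x y
    using that by (simp add: a_minus_def)
  \<comment> \<open>Any sequence of approximations computes \<open>\<theta> b\<close>, so
    compatibility with sums and products can be checked on approximations.\<close>
  have \<theta>_eq: "\<theta> b = (\<lambda>k. ideal_pow R I k +> \<rho> k)"
    if b: "b \<in> carrier B" and \<rho>: "\<And>k. \<rho> k \<in> carrier R" "\<And>k. G (\<rho> k) \<ominus>\<^bsub>B\<^esub> b \<in> J k" for b \<rho>
  proof
    fix k
    have "G r \<ominus>\<^bsub>B\<^esub> b \<in> J k \<longleftrightarrow> r \<ominus> \<rho> k \<in> ideal_pow R I k" if r: "r \<in> carrier R" for r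
    proof -
      have "G r \<ominus>\<^bsub>B\<^esub> b \<in> J k \<longleftrightarrow> G r \<ominus>\<^bsub>B\<^esub> G (\<rho> k) \<in> J k"
        using J_trans[of "G r" b k "G (\<rho> k)"] J_trans[of "G r" "G (\<rho> k)" k b]
          J_sym[OF \<rho>(2)] \<rho> r b by auto
      then show ?thesis using r \<rho>(1) by (simp add: pow G_minus)
    qed
    then show "\<theta> b k = ideal_pow R I k +> \<rho> k"
      by (auto simp: \<theta>_def R.a_r_coset_eq[OF R.ideal_pow_ideal[OF I] \<rho>(1)])
  qed
  have approx: "\<exists>\<rho>. (\<forall>k. \<rho> k \<in> carrier R) \<and> (\<forall>k. G (\<rho> k) \<ominus>\<^bsub>B\<^esub> b \<in> J k)"
    if "b \<in> carrier B" for b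
    using dense[OF that] by metis
  have \<theta>_closed: "\<theta> b \<in> carrier ?H" if b: "b \<in> carrier B" for b
  proof -
    from approx[OF b] obtain \<rho> where
      \<rho>: "\<And>k. \<rho> k \<in> carrier R" "\<And>k. G (\<rho> k) \<ominus>\<^bsub>B\<^esub> b \<in> J k" by blast
    have "\<rho> (Suc k) \<ominus> \<rho> k \<in> ideal_pow R I k" for k
    proof -
      have "G (\<rho> (Suc k)) \<ominus>\<^bsub>B\<^esub> G (\<rho> k) \<in> J k"
        using J_trans[of "G (\<rho> (Suc k))" b k "G (\<rho> k)"] J_sym[OF \<rho>(2)] \<rho> J_Suc b by blast
      then show ?thesis using \<rho>(1) by (simp add: pow G_minus)
    qed
    then show "\<theta> b \<in> carrier ?H"
      unfolding \<theta>_eq[OF b \<rho>] using \<rho>(1) by (intro R.completion_elem_closed I)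
  qed
  have "\<theta> \<in> ring_iso B ?H"
  proof (rule ring_iso_memI)
    show "\<theta> b \<in> carrier ?H" if "b \<in> carrier B" for b by (rule \<theta>_closed[OF that])
  next
    fix b c assume b: "b \<in> carrier B" and c: "c \<in> carrier B"
    from approx[OF b] obtain \<rho> where
      \<rho>: "\<And>k. \<rho> k \<in> carrier R" "\<And>k. G (\<rho> k) \<ominus>\<^bsub>B\<^esub> b \<in> J k" by blast
    from approx[OF c] obtain \<sigma> where
      \<sigma>: "\<And>k. \<sigma> k \<in> carrier R" "\<And>k. G (\<sigma> k) \<ominus>\<^bsub>B\<^esub> c \<in> J k" by blast
    have "\<theta> (b \<otimes>\<^bsub>B\<^esub> c) = (\<lambda>k. ideal_pow R I k +> (\<rho> k \<otimes> \<sigma> k))"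
      by (rule \<theta>_eq) (use b c \<rho> \<sigma> in \<open>simp_all add: B.ideal_mult_diff[OF J]\<close>)
    then show "\<theta> (b \<otimes>\<^bsub>B\<^esub> c) = \<theta> b \<otimes>\<^bsub>?H\<^esub> \<theta> c"
      using \<rho>(1) \<sigma>(1) by (simp add: \<theta>_eq[OF b \<rho>] \<theta>_eq[OF c \<sigma>] R.completion_mult[OF I])
    have "\<theta> (b \<oplus>\<^bsub>B\<^esub> c) = (\<lambda>k. ideal_pow R I k +> (\<rho> k \<oplus> \<sigma> k))"
      by (rule \<theta>_eq) (use b c \<rho> \<sigma> in \<open>simp_all add: B.ideal_add_diff[OF J]\<close>)
    then show "\<theta> (b \<oplus>\<^bsub>B\<^esub> c) = \<theta> b \<oplus>\<^bsub>?H\<^esub> \<theta> c"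
      using \<rho>(1) \<sigma>(1) by (simp add: \<theta>_eq[OF b \<rho>] \<theta>_eq[OF c \<sigma>] R.completion_add[OF I])
  next
    show "\<theta> \<one>\<^bsub>B\<^esub> = \<one>\<^bsub>?H\<^esub>"
      unfolding R.completion_one by (rule \<theta>_eq) (simp_all add: a_minus_def B.r_neg)
  next
    have "inj_on \<theta> (carrier B)"
    proof (rule inj_onI)
      fix b c assume b: "b \<in> carrier B" and c: "c \<in> carrier B" and eq: "\<theta> b = \<theta> c"
      have "b \<ominus>\<^bsub>B\<^esub> c \<in> J k" for k
      proof -
        obtain r where r: "r \<in> carrier R" "G r \<ominus>\<^bsub>B\<^esub> b \<in> J k" using dense[OF b] by blast
        then have "r \<in> \<theta> c k" unfolding eq[symmetric] by (simp add: \<theta>_def)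
        then show ?thesis
          using J_trans[of b "G r" k c] J_sym[of "G r" b k] r b c by (simp add: \<theta>_def)
      qed
      then have "b \<ominus>\<^bsub>B\<^esub> c = \<zero>\<^bsub>B\<^esub>" using sep b c by simp
      then show "b = c" using b c by simp
    qed
    moreover have "carrier ?H \<subseteq> \<theta> ` carrier B"
    proof
      fix f assume "f \<in> carrier ?H"
      then obtain \<alpha> where \<alpha>: "\<And>k. \<alpha> k \<in> carrier R"
        "\<And>k. \<alpha> (Suc k) \<ominus> \<alpha> k \<in> ideal_pow R I k"
        and f: "f = (\<lambda>k. ideal_pow R I k +> \<alpha> k)"
        by (rule R.completion_elemE[OF I]) (rule that)
      have "G (\<alpha> (Suc k)) \<ominus>\<^bsub>B\<^esub> G (\<alpha> k) \<in> J k" for k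
        using \<alpha>(2)[of k] \<alpha>(1) by (simp add: pow G_minus)
      \<comment> \<open>A preimage of f is the limit in \<open>B\<close> of the images of its
        representatives.\<close>
      with complete[of "\<lambda>k. G (\<alpha> k)"] \<alpha>(1) obtain b where
        b: "b \<in> carrier B" "\<And>k. G (\<alpha> k) \<ominus>\<^bsub>B\<^esub> b \<in> J k" by auto
      then have "\<theta> b = f" unfolding f by (intro \<theta>_eq \<alpha>(1))
      then show "f \<in> \<theta> ` carrier B" using b(1) by blast
    qed
    ultimately show "bij_betw \<theta> (carrier B) (carrier ?H)"
      using \<theta>_closed unfolding bij_betw_def by blast
  qed
  then have "B \<simeq> ?H" unfolding is_ring_iso_def by blast
  then show ?thesis by (rule ring_iso_sym[OF B.ring_axioms])
qed

section \<open>Simple extensions and localizations\<close>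

text \<open>\<open>simple_extension\<close> is generated by Horner steps u x + k. Two sums are
  merged step by step, whence the induction with the second summand generalised; products follow by
  Horner steps in the first factor, using closure under x and under scalars from
  \<open>K\<close>.\<close>

lemma (in cring) simple_extension_subring:
  assumes K: "subring K R" and x: "x \<in> carrier R"
  shows "subring (simple_extension K x) R"
proof -
  let ?S = "simple_extension K x"
  note K_closed = subringE[OF K]
  have KR: "k \<in> carrier R" if "k \<in> K" for k using that K_closed(1) by blast
  have SR: "u \<in> carrier R" if "u \<in> ?S" for u
    using that simple_extension_in_carrier[OF K_closed(1) x] by blast
  have mult_x: "u \<otimes> x \<in> ?S" if "u \<in> ?S" for u
    using simple_extension.lin[OF that K_closed(2)] SR[OF that] x by simp
  have add: "u \<oplus> v \<in> ?S" if "u \<in> ?S" "v \<in> ?S" for u v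
    using that
  proof (induction u arbitrary: v rule: simple_extension.induct)
    case zero
    then show ?case using SR by simp
  next
    case (lin k1 k2)
    from lin.prems show ?case
    proof (cases rule: simple_extension.cases)
      case zero
      then show ?thesis
        using simple_extension.lin[OF lin(1,2)] SR[OF lin(1)] KR[OF lin(2)] x by simp
    next
      case (lin l1 l2)
      have "k1 \<otimes> x \<oplus> k2 \<oplus> v = (k1 \<oplus> l1) \<otimes> x \<oplus> (k2 \<oplus> l2)"
        using SR[OF \<open>k1 \<in> ?S\<close>] SR[OF lin(2)] KR[OF \<open>k2 \<in> K\<close>] KR[OF lin(3)] x
        by (simp add: lin(1) l_distr a_ac)
      then show ?thesis
        using simple_extension.lin[OF \<open>\<And>v. v \<in> ?S \<Longrightarrow> k1 \<oplus> v \<in> ?S\<close>[OF lin(2)]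
          K_closed(7)[OF \<open>k2 \<in> K\<close> lin(3)]] by simp
    qed
  qed
  have scale: "c \<otimes> u \<in> ?S" if "u \<in> ?S" and c: "c \<in> K" for c u
    using that(1)
  proof (induction u rule: simple_extension.induct)
    case zero
    then show ?case using KR[OF c] by simp
  next
    case (lin k1 k2)
    have "c \<otimes> (k1 \<otimes> x \<oplus> k2) = (c \<otimes> k1) \<otimes> x \<oplus> c \<otimes> k2"
      using SR[OF lin(1)] KR[OF lin(2)] KR[OF c] x by (simp add: r_distr m_assoc)
    then show ?case
      using simple_extension.lin[OF lin(3) K_closed(6)[OF c lin(2)]] by simp
  qed
  have mult: "u \<otimes> v \<in> ?S" if "u \<in> ?S" and v: "v \<in> ?S" for u v
    using that(1)
  proof (induction u rule: simple_extension.induct)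
    case zero
    then show ?case using SR[OF v] by simp
  next
    case (lin k1 k2)
    have "(k1 \<otimes> x \<oplus> k2) \<otimes> v = (k1 \<otimes> v) \<otimes> x \<oplus> k2 \<otimes> v"
      using SR[OF lin(1)] SR[OF v] KR[OF lin(2)] x by (simp add: l_distr r_distr m_ac)
    then show ?case using add[OF mult_x[OF lin(3)] scale[OF v lin(2)]] by simp
  qed
  have one: "\<one> \<in> ?S" using simple_extension_incl[OF K_closed(1) x] K_closed(3) by blast
  show ?thesis
  proof (rule subringI)
    show "\<ominus> u \<in> ?S" if "u \<in> ?S" for u
      using scale[OF that K_closed(5)[OF K_closed(3)]] SR[OF that] by (simp add: l_minus)
  qed (use SR one add mult in auto)
qed

lemma (in cring) inv_mult_Units:
  assumes "s \<in> Units R" "u \<in> Units R"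
  shows "inv (s \<otimes> u) = inv s \<otimes> inv u"
proof (rule comm_inv_char)
  have "s \<otimes> u \<otimes> (inv s \<otimes> inv u) = (s \<otimes> inv s) \<otimes> (u \<otimes> inv u)"
    using assms[THEN Units_closed] assms[THEN Units_inv_closed] by (simp only: m_ac m_closed)
  then show "s \<otimes> u \<otimes> (inv s \<otimes> inv u) = \<one>" using assms by simp
qed (use assms in auto)

lemma (in cring) frac_add_Units:
  assumes "a \<in> carrier R" "b \<in> carrier R" "s \<in> Units R" "u \<in> Units R"
  shows "(u \<otimes> a \<oplus> s \<otimes> b) \<otimes> inv (s \<otimes> u) = a \<otimes> inv s \<oplus> b \<otimes> inv u"
proof -
  note [simp] = assms(1,2) assms(3)[THEN Units_closed] assms(3)[THEN Units_inv_closed]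
    assms(4)[THEN Units_closed] assms(4)[THEN Units_inv_closed]
  have "(u \<otimes> a \<oplus> s \<otimes> b) \<otimes> (inv s \<otimes> inv u)
      = (u \<otimes> inv u) \<otimes> (a \<otimes> inv s) \<oplus> (s \<otimes> inv s) \<otimes> (b \<otimes> inv u)"
    by (simp only: l_distr m_ac m_closed assms(1,2) assms(3)[THEN Units_closed]
        assms(3)[THEN Units_inv_closed] assms(4)[THEN Units_closed] assms(4)[THEN Units_inv_closed])
  then show ?thesis using assms by (simp add: inv_mult_Units)
qed

text \<open>If \<open>C\<close> embeds into \<open>B\<close> and \<open>S\<close> becomes invertible there, a fraction is determined by its
  value in \<open>B\<close>; the localization is then the ring of these values.\<close>
theorem localization_embedding:
  fixes C :: "('a, 'c) ring_scheme" (structure) and B :: "('b, 'd) ring_scheme"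
  assumes "cring C" and "cring B" and j: "j \<in> ring_hom C B" and inj: "inj_on j (carrier C)"
    and S: "S \<subseteq> carrier C" "\<one> \<in> S" "\<And>s u. s \<in> S \<Longrightarrow> u \<in> S \<Longrightarrow> s \<otimes> u \<in> S"
    and units: "\<And>s. s \<in> S \<Longrightarrow> j s \<in> Units B"
  obtains G where "cring (localization C S)" "G \<in> ring_hom (localization C S) B"
    "inj_on G (carrier (localization C S))"
    "carrier (localization C S) = {loc_frac C S a s | a s. a \<in> carrier C \<and> s \<in> S}"
    "\<And>a s. a \<in> carrier C \<Longrightarrow> s \<in> S \<Longrightarrow> G (loc_frac C S a s) = j a \<otimes>\<^bsub>B\<^esub> inv\<^bsub>B\<^esub> (j s)"
    "\<And>a b s u. a \<in> carrier C \<Longrightarrow> b \<in> carrier C \<Longrightarrow> s \<in> S \<Longrightarrow> u \<in> S \<Longrightarrow>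
      loc_frac C S a s \<otimes>\<^bsub>localization C S\<^esub> loc_frac C S b u = loc_frac C S (a \<otimes> b) (s \<otimes> u)"
proof -
  let ?Loc = "localization C S"
  interpret C: cring C by fact
  interpret B: cring B by fact
  interpret j: ring_hom_cring C B j by unfold_locales (rule j)
  define q where "q a s = j a \<otimes>\<^bsub>B\<^esub> inv\<^bsub>B\<^esub> (j s)" for a s
  \<comment> \<open>The class of a fraction turns out to be the full fibre of \<open>q\<close> over
    its value, so \<open>h\<close> is to be the inverse of taking values.\<close>
  define h where "h b = {(a, s). a \<in> carrier C \<and> s \<in> S \<and> q a s = b}" for b
  have SC: "s \<in> carrier C" if "s \<in> S" for s using that S(1) by blast
  have jU: "j s \<in> Units B" "inv\<^bsub>B\<^esub> (j s) \<in> carrier B" if "s \<in> S" for s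
    using units[OF that] by auto
  have q_closed: "q a s \<in> carrier B" if "a \<in> carrier C" "s \<in> S" for a s
    using that jU by (simp add: q_def)
  have q_eq_iff: "q a s = q b u \<longleftrightarrow> j u \<otimes>\<^bsub>B\<^esub> j a = j s \<otimes>\<^bsub>B\<^esub> j b"
    if "a \<in> carrier C" "b \<in> carrier C" "s \<in> S" "u \<in> S" for a b s u
  proof -
    let ?i = "inv\<^bsub>B\<^esub> (j s)" and ?k = "inv\<^bsub>B\<^esub> (j u)"
    note car = that(1,2)[THEN j.hom_closed] SC[OF that(3), THEN j.hom_closed]
      SC[OF that(4), THEN j.hom_closed] jU(2)[OF that(3)] jU(2)[OF that(4)]
    have "j u \<otimes>\<^bsub>B\<^esub> j a = (j s \<otimes>\<^bsub>B\<^esub> j u) \<otimes>\<^bsub>B\<^esub> q a s"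
    proof -
      have "(j s \<otimes>\<^bsub>B\<^esub> j u) \<otimes>\<^bsub>B\<^esub> (j a \<otimes>\<^bsub>B\<^esub> ?i) = (j s \<otimes>\<^bsub>B\<^esub> ?i) \<otimes>\<^bsub>B\<^esub> (j u \<otimes>\<^bsub>B\<^esub> j a)"
        by (simp only: B.m_ac B.m_closed car)
      then show ?thesis using jU[OF that(3)] car by (simp add: q_def)
    qed
    moreover have "j s \<otimes>\<^bsub>B\<^esub> j b = (j s \<otimes>\<^bsub>B\<^esub> j u) \<otimes>\<^bsub>B\<^esub> q b u"
    proof -
      have "(j s \<otimes>\<^bsub>B\<^esub> j u) \<otimes>\<^bsub>B\<^esub> (j b \<otimes>\<^bsub>B\<^esub> ?k) = (j u \<otimes>\<^bsub>B\<^esub> ?k) \<otimes>\<^bsub>B\<^esub> (j s \<otimes>\<^bsub>B\<^esub> j b)"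
        by (simp only: B.m_ac B.m_closed car)
      then show ?thesis using jU[OF that(4)] car by (simp add: q_def)
    qed
    ultimately show ?thesis
      using B.Units_l_cancel[of "j s \<otimes>\<^bsub>B\<^esub> j u" "q a s" "q b u"] jU that q_closed by auto
  qed
  have frac: "frac_rel C S = {((a, s), (b, u)). a \<in> carrier C \<and> b \<in> carrier C \<and> s \<in> S \<and> u \<in> S
      \<and> q a s = q b u}"
  proof -
    have "(\<exists>v\<in>S. v \<otimes> (u \<otimes> a) = v \<otimes> (s \<otimes> b)) \<longleftrightarrow> q a s = q b u"
      if car: "a \<in> carrier C" "b \<in> carrier C" "s \<in> S" "u \<in> S" for a b s u
    proof -
      \<comment> \<open>The multiplier v becomes a unit in \<open>B\<close> and cancels there;
        injectivity of \<open>j\<close> brings the equation back to \<open>C\<close>.\<close>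
      have "v \<otimes> (u \<otimes> a) = v \<otimes> (s \<otimes> b) \<longleftrightarrow> q a s = q b u" if v: "v \<in> S" for v
      proof -
        note c = car(1,2) SC[OF car(3)] SC[OF car(4)] SC[OF v]
        have "v \<otimes> (u \<otimes> a) = v \<otimes> (s \<otimes> b) \<longleftrightarrow> j (v \<otimes> (u \<otimes> a)) = j (v \<otimes> (s \<otimes> b))"
          using c by (simp add: inj_on_eq_iff[OF inj] del: j.hom_mult)
        also have "\<dots> \<longleftrightarrow> j u \<otimes>\<^bsub>B\<^esub> j a = j s \<otimes>\<^bsub>B\<^esub> j b"
          using c jU(1)[OF v] by simp
        finally show ?thesis using q_eq_iff[OF car] by simp
      qed
      then show ?thesis using S(2) by blast
    qed
    then show ?thesis unfolding frac_rel_def by blast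
  qed
  have loc_frac: "loc_frac C S a s = h (q a s)" if "a \<in> carrier C" "s \<in> S" for a s
    using that by (auto simp: loc_frac_def frac h_def)
  have one_B: "q \<one> \<one> = \<one>\<^bsub>B\<^esub>" by (simp add: q_def)
  have mult: "q (a \<otimes> b) (s \<otimes> u) = q a s \<otimes>\<^bsub>B\<^esub> q b u"
    if "a \<in> carrier C" "b \<in> carrier C" "s \<in> S" "u \<in> S" for a b s u
    using that SC jU by (simp add: q_def B.inv_mult_Units B.m_ac)
  have add: "q (u \<otimes> a \<oplus> s \<otimes> b) (s \<otimes> u) = q a s \<oplus>\<^bsub>B\<^esub> q b u"
    if "a \<in> carrier C" "b \<in> carrier C" "s \<in> S" "u \<in> S" for a b s u
    using that SC jU by (simp add: q_def B.frac_add_Units)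
  \<comment> \<open>The values form a subring of \<open>B\<close>; its ring structure is carried to
    the localization along \<open>h\<close>.\<close>
  define L where "L = {q a s | a s. a \<in> carrier C \<and> s \<in> S}"
  have LI: "q a s \<in> L" if "a \<in> carrier C" "s \<in> S" for a s using that by (auto simp: L_def)
  have L: "subring L B"
  proof (rule B.subringI)
    show "L \<subseteq> carrier B" using q_closed by (auto simp: L_def)
    show "\<one>\<^bsub>B\<^esub> \<in> L" using LI[OF C.one_closed S(2)] one_B by simp
    fix x y assume "x \<in> L" "y \<in> L"
    then obtain a s b u where x: "x = q a s" "a \<in> carrier C" "s \<in> S"
      and y: "y = q b u" "b \<in> carrier C" "u \<in> S" by (auto simp: L_def)
    have "\<ominus>\<^bsub>B\<^esub> x = q (\<ominus> a) s" using x jU by (simp add: q_def B.l_minus)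
    then show "\<ominus>\<^bsub>B\<^esub> x \<in> L" using x LI by simp
    show "x \<otimes>\<^bsub>B\<^esub> y \<in> L" using x y LI[of "a \<otimes> b" "s \<otimes> u"] S(3) mult by simp
    show "x \<oplus>\<^bsub>B\<^esub> y \<in> L"
      using x y SC LI[of "u \<otimes> a \<oplus> s \<otimes> b" "s \<otimes> u"] S(3) add by simp
  qed
  let ?L = "B\<lparr>carrier := L\<rparr>"
  have cring_L: "cring ?L" using B.subcringI'[OF L] B.subcring_iff[OF subringE(1)[OF L]] by simp
  have hI: "(a, s) \<in> h b \<longleftrightarrow> a \<in> carrier C \<and> s \<in> S \<and> q a s = b" for a s b
    by (simp add: h_def)
  have h_mult: "h x \<otimes>\<^bsub>?Loc\<^esub> h y = h (x \<otimes>\<^bsub>B\<^esub> y)" if "x \<in> L" "y \<in> L" for x y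
  proof -
    obtain a s b u where x: "x = q a s" "a \<in> carrier C" "s \<in> S"
      and y: "y = q b u" "b \<in> carrier C" "u \<in> S" using \<open>x \<in> L\<close> \<open>y \<in> L\<close> by (auto simp: L_def)
    have ne: "(a, s) \<in> h x" "(b, u) \<in> h y" using x y by (simp_all add: hI)
    have val: "loc_frac C S (fst p \<otimes> fst r) (snd p \<otimes> snd r) = h (x \<otimes>\<^bsub>B\<^esub> y)"
      if "p \<in> h x" "r \<in> h y" for p r
    proof -
      have p: "fst p \<in> carrier C" "snd p \<in> S" "q (fst p) (snd p) = x"
        and r: "fst r \<in> carrier C" "snd r \<in> S" "q (fst r) (snd r) = y"
        using that hI[of "fst p" "snd p" x] hI[of "fst r" "snd r" y] by simp_all
      then show ?thesis using S(3) mult[OF p(1) r(1) p(2) r(2)] by (simp add: loc_frac)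
    qed
    \<comment> \<open>The product is a union over representatives. All members of the family
      coincide by \<open>val\<close>, and the fibres are nonempty by \<open>ne\<close>, so the union
      is that common set.\<close>
    have "h x \<otimes>\<^bsub>?Loc\<^esub> h y = (\<Union>p\<in>h x. \<Union>r\<in>h y. loc_frac C S (fst p \<otimes> fst r) (snd p \<otimes> snd r))"
      by (simp add: localization_def case_prod_beta)
    also have "\<dots> = h (x \<otimes>\<^bsub>B\<^esub> y)" using val ne by auto
    finally show ?thesis .
  qed
  have h_add: "h x \<oplus>\<^bsub>?Loc\<^esub> h y = h (x \<oplus>\<^bsub>B\<^esub> y)" if "x \<in> L" "y \<in> L" for x y
  proof -
    obtain a s b u where x: "x = q a s" "a \<in> carrier C" "s \<in> S"
      and y: "y = q b u" "b \<in> carrier C" "u \<in> S" using \<open>x \<in> L\<close> \<open>y \<in> L\<close> by (auto simp: L_def)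
    have ne: "(a, s) \<in> h x" "(b, u) \<in> h y" using x y by (simp_all add: hI)
    have val: "loc_frac C S (snd r \<otimes> fst p \<oplus> snd p \<otimes> fst r) (snd p \<otimes> snd r) = h (x \<oplus>\<^bsub>B\<^esub> y)"
      if "p \<in> h x" "r \<in> h y" for p r
    proof -
      have p: "fst p \<in> carrier C" "snd p \<in> S" "q (fst p) (snd p) = x"
        and r: "fst r \<in> carrier C" "snd r \<in> S" "q (fst r) (snd r) = y"
        using that hI[of "fst p" "snd p" x] hI[of "fst r" "snd r" y] by simp_all
      then show ?thesis using S(3) SC add[OF p(1) r(1) p(2) r(2)] by (simp add: loc_frac)
    qed
    have "h x \<oplus>\<^bsub>?Loc\<^esub> h y = (\<Union>p\<in>h x. \<Union>r\<in>h y.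
        loc_frac C S (snd r \<otimes> fst p \<oplus> snd p \<otimes> fst r) (snd p \<otimes> snd r))"
      by (simp add: localization_def case_prod_beta)
    also have "\<dots> = h (x \<oplus>\<^bsub>B\<^esub> y)" using val ne by auto
    finally show ?thesis .
  qed
  have car: "carrier ?Loc = {loc_frac C S a s | a s. a \<in> carrier C \<and> s \<in> S}"
    by (auto simp: localization_def quotient_def loc_frac_def)
  have h_one: "h \<one>\<^bsub>B\<^esub> = \<one>\<^bsub>?Loc\<^esub>"
    using loc_frac[OF C.one_closed S(2)] one_B by (simp add: localization_def)
  have h_zero: "h \<zero>\<^bsub>B\<^esub> = \<zero>\<^bsub>?Loc\<^esub>"
    using loc_frac[OF C.zero_closed S(2)] by (simp add: localization_def q_def)
  have h_iso: "h \<in> ring_iso ?L ?Loc"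
  proof (rule ring_iso_memI)
    have h_L: "h ` L = carrier ?Loc"
      unfolding car L_def using loc_frac by (auto simp: image_iff) metis+
    then show "h x \<in> carrier ?Loc" if "x \<in> carrier ?L" for x using that by auto
    have "inj_on h L"
    proof (rule inj_onI)
      fix x y assume "x \<in> L" "h x = h y"
      then obtain a s where as: "(a, s) \<in> h x" "x = q a s" by (auto simp: L_def hI)
      then have "(a, s) \<in> h y" using \<open>h x = h y\<close> by blast
      then show "x = y" using as(2) by (simp add: hI)
    qed
    then show "bij_betw h (carrier ?L) (carrier ?Loc)" using h_L by (simp add: bij_betw_def)
  qed (use h_mult h_add h_one in auto)
  define G where "G = inv_into L h"
  have G: "G \<in> ring_iso ?Loc ?L"
    using ring_iso_set_sym[OF cring.axioms(1)[OF cring_L] h_iso] by (simp add: G_def)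
  \<comment> \<open>The transport result overrides \<open>zero\<close> by the image of zero; by
    \<open>h_zero\<close> this changes nothing.\<close>
  have "cring (?Loc\<lparr>zero := h \<zero>\<^bsub>?L\<^esub>\<rparr>)"
    by (rule cring.ring_iso_imp_img_cring[OF cring_L h_iso])
  then have "cring ?Loc" using h_zero by simp
  moreover have "G \<in> ring_hom ?Loc B"
    using G subringE(1)[OF L] by (auto simp: ring_iso_def ring_hom_def)
  moreover have "inj_on G (carrier ?Loc)"
    using G by (auto simp: ring_iso_def bij_betw_def)
  moreover have "G (loc_frac C S a s) = j a \<otimes>\<^bsub>B\<^esub> inv\<^bsub>B\<^esub> (j s)" if "a \<in> carrier C" "s \<in> S" for a s
  proof -
    have "inj_on h L" using h_iso by (simp add: ring_iso_def bij_betw_def)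
    then show ?thesis
      using that LI[OF that] by (simp add: loc_frac G_def q_def[symmetric])
  qed
  moreover have "loc_frac C S a s \<otimes>\<^bsub>?Loc\<^esub> loc_frac C S b u = loc_frac C S (a \<otimes> b) (s \<otimes> u)"
    if "a \<in> carrier C" "b \<in> carrier C" "s \<in> S" "u \<in> S" for a b s u
    using that S(3) h_mult[OF LI LI] by (simp add: loc_frac mult)
  ultimately show thesis using that car by blast
qed

section \<open>The completion of a discrete valuation ring\<close>

lemma (in cring) ideal_prod_cgenideal:
  assumes "a \<in> carrier R" "b \<in> carrier R"
  shows "ideal_prod R (PIdl a) (PIdl b) = PIdl (a \<otimes> b)"
proof -
  have c: "a \<otimes> b \<in> carrier R" using assms by simp
  have "Idl (PIdl (a \<otimes> b)) = PIdl (a \<otimes> b)"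
    using genideal_minimal[OF cgenideal_ideal[OF c] order_refl]
      genideal_self[OF additive_subgroup.a_subset[OF ideal.axioms(1)[OF cgenideal_ideal[OF c]]]]
    by (rule subset_antisym)
  then show ?thesis
    using assms by (simp add: ideal_prod_eq_genideal cgenideal_prod cgenideal_ideal)
qed

lemma (in cring) ideal_pow_cgenideal:
  assumes "a \<in> carrier R"
  shows "ideal_pow R (PIdl a) k = PIdl (a [^] k)"
proof (induction k)
  case 0
  show ?case
    using ideal.one_imp_carrier[OF cgenideal_ideal[OF one_closed] cgenideal_self[OF one_closed]]
    by simp
next
  case (Suc k)
  then show ?case using assms by (simp add: ideal_prod_cgenideal)
qed

lemma (in cring) mem_cgenideal_iff:
  "x \<in> PIdl a \<longleftrightarrow> (\<exists>y\<in>carrier R. x = y \<otimes> a)"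
  by (auto simp: cgenideal_def)

lemma (in ideal) I_minus_closed: "x \<in> I \<Longrightarrow> y \<in> I \<Longrightarrow> x \<ominus> y \<in> I"
  by (simp add: a_minus_def a_closed a_inv_closed)

lemma (in ring) minus_minus_cancel:
  assumes "x \<in> carrier R" "y \<in> carrier R"
  shows "x \<ominus> (x \<ominus> y) = y"
  using assms by (simp add: a_minus_def minus_add r_neg2)

locale dvr_uniformizer = discrete_valuation_ring A for A :: "('a, 'b) ring_scheme" (structure) +
  fixes t
  assumes t_closed [simp]: "t \<in> carrier A"
    and t_maximal: "maximalideal (PIdl t) A"
begin

text \<open>If t were zero, the zero ideal would be maximal, and the nonzero prime ideal containing
  it would have to be the whole ring.\<close>

lemma t_nonzero: "t \<noteq> \<zero>"
proof
  assume "t = \<zero>"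
  then have 0: "PIdl t = {\<zero>}" by (auto simp: cgenideal_def intro!: exI[of _ "\<zero>"])
  obtain P where P: "primeideal P A" "P \<noteq> {\<zero>}" using ex1_nonzero_prime by blast
  interpret P: primeideal P A by fact
  interpret M: maximalideal "PIdl t" A by (rule t_maximal)
  have "PIdl t \<subseteq> P" using 0 by simp
  then show False
    using M.I_maximal[OF P.is_ideal _ P.a_subset] P(2) 0 P.I_notcarr by auto
qed

lemma one_notin: "\<one> \<notin> PIdl t"
proof -
  interpret M: maximalideal "PIdl t" A by (rule t_maximal)
  show ?thesis using M.one_imp_carrier M.I_notcarr by auto
qed

text \<open>A nonzero nonunit has an irreducible factor p. The ideal of p is a nonzero prime, hence
  equal to that of t by uniqueness, and it contains x.\<close>

lemma Units_notin:
  assumes x: "x \<in> carrier A" "x \<notin> PIdl t"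
  shows "x \<in> Units A"
proof (rule ccontr)
  assume "x \<notin> Units A"
  interpret M: maximalideal "PIdl t" A by (rule t_maximal)
  have "\<zero> \<in> PIdl t" using M.zero_closed .
  then have "x \<in> carrier A - {\<zero>}" using x by auto
  then obtain p where p: "p \<in> carrier A" "ring_irreducible p" "p divides x"
    by (rule exists_irreducible_divisor[OF _ \<open>x \<notin> Units A\<close>]) (rule that)
  have "p \<noteq> \<zero>" using p(2) by (simp add: ring_irreducible_def)
  then have "PIdl p \<noteq> {\<zero>}" using cgenideal_self[OF p(1)] by blast
  moreover have "primeideal (PIdl p) A"
    by (intro maximalideal_prime irreducible_imp_maximalideal p)
  moreover have "primeideal (PIdl t) A" by (rule maximalideal_prime[OF t_maximal])
  moreover have "PIdl t \<noteq> {\<zero>}" using cgenideal_self[OF t_closed] t_nonzero by blast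
  ultimately have "PIdl p = PIdl t" using ex1_nonzero_prime by blast
  moreover have "x \<in> PIdl p"
    using p(1,3) m_comm[OF p(1)] unfolding factor_def mem_cgenideal_iff by auto
  ultimately show False using x by simp
qed

lemma t_pow_nonzero: "t [^] (k::nat) \<noteq> \<zero>"
  by (induction k) (auto simp: t_nonzero integral_iff)

lemma t_pow_cancel:
  assumes "x \<in> carrier A" "t [^] k \<otimes> x \<in> PIdl (t [^] (k + m :: nat))"
  shows "x \<in> PIdl (t [^] m)"
proof -
  obtain y where y: "y \<in> carrier A" "t [^] k \<otimes> x = y \<otimes> t [^] (k + m)"
    using assms(2) by (auto simp: mem_cgenideal_iff)
  then have "t [^] k \<otimes> x = t [^] k \<otimes> (y \<otimes> t [^] m)"
    by (simp add: nat_pow_mult[symmetric] m_ac)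
  then have "x = y \<otimes> t [^] m"
    using m_lcancel[OF t_pow_nonzero] assms(1) y(1) by simp
  then show ?thesis using y(1) by (auto simp: mem_cgenideal_iff)
qed

lemma PIdl_t_pow_antimono:
  assumes "m \<le> k" shows "PIdl (t [^] k) \<subseteq> PIdl (t [^] (m::nat))"
proof
  fix x assume "x \<in> PIdl (t [^] k)"
  then obtain y where "y \<in> carrier A" "x = y \<otimes> t [^] (m + (k - m))"
    using assms by (auto simp: mem_cgenideal_iff)
  then have "y \<otimes> t [^] (k - m) \<in> carrier A" "x = (y \<otimes> t [^] (k - m)) \<otimes> t [^] m"
    by (simp_all add: nat_pow_mult[symmetric] m_ac)
  then show "x \<in> PIdl (t [^] m)" by (auto simp: mem_cgenideal_iff)
qed

section \<open>The completion of \<open>A\<close> and its t-adic filtration\<close>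

abbreviation H where "H \<equiv> completion_at A t"
abbreviation \<iota> where "\<iota> \<equiv> to_completion_at A t"
abbreviation \<tau> where "\<tau> \<equiv> \<iota> t"

lemma pow_ideal: "ideal (PIdl (t [^] (k::nat))) A"
  by (simp add: cgenideal_ideal)

lemma t_ideal: "ideal (PIdl t) A"
  by (simp add: cgenideal_ideal)

lemma ideal_pow_t: "ideal_pow A (PIdl t) k = PIdl (t [^] k)"
  by (simp add: ideal_pow_cgenideal)

sublocale H: cring H by (rule completion_cring[OF t_ideal])

sublocale \<iota>: ring_hom_cring A H \<iota>
  by unfold_locales (rule to_completion_hom[OF t_ideal])

lemmas H_elemE = completion_elemE[OF t_ideal, unfolded ideal_pow_t]
lemmas H_elem_closed = completion_elem_closed[OF t_ideal, unfolded ideal_pow_t]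
lemmas H_mult = completion_mult[OF t_ideal, unfolded ideal_pow_t]
lemmas H_minus = completion_minus[OF t_ideal, unfolded ideal_pow_t]
lemmas H_zero = completion_zero[OF t_ideal, unfolded ideal_pow_t]
lemmas H_one = completion_one[of "PIdl t", unfolded ideal_pow_t]

lemma \<iota>_eq: "\<iota> x = (\<lambda>k. PIdl (t [^] k) +> x)"
  by (simp add: to_completion_def ideal_pow_t)

definition V where "V k = PIdl\<^bsub>H\<^esub> (\<tau> [^]\<^bsub>H\<^esub> (k::nat))"

lemma mem_V_iff: "x \<in> V k \<longleftrightarrow> (\<exists>y\<in>carrier H. x = y \<otimes>\<^bsub>H\<^esub> \<tau> [^]\<^bsub>H\<^esub> k)"
  by (auto simp: V_def cgenideal_def)

lemma V_ideal: "ideal (V k) H"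
  by (simp add: V_def H.cgenideal_ideal)

sublocale V: ideal "V k" H for k by (rule V_ideal)

lemma coset_eq_iff:
  assumes "x \<in> carrier A" "y \<in> carrier A"
  shows "PIdl (t [^] k) +> x = PIdl (t [^] k) +> y \<longleftrightarrow> x \<ominus> y \<in> PIdl (t [^] (k::nat))"
  using quotient_eq_iff_same_a_r_cos[OF pow_ideal assms] by blast

lemma coset_eq_zero_iff:
  assumes "x \<in> carrier A"
  shows "PIdl (t [^] k) +> x = \<zero>\<^bsub>H\<^esub> k \<longleftrightarrow> x \<in> PIdl (t [^] (k::nat))"
  using coset_eq_iff[OF assms zero_closed, of k] assms by (simp add: H_zero a_minus_def)

lemma cauchy_diff:
  assumes "\<And>k. \<alpha> k \<in> carrier A" "\<And>k. \<alpha> (Suc k) \<ominus> \<alpha> k \<in> PIdl (t [^] k)"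
  shows "\<alpha> (k + i) \<ominus> \<alpha> k \<in> PIdl (t [^] k)"
proof (induction i)
  case 0
  show ?case using assms(1) additive_subgroup.zero_closed[OF ideal.axioms(1)[OF pow_ideal]]
    by (simp add: a_minus_def r_neg)
next
  case (Suc i)
  interpret K: ideal "PIdl (t [^] k)" A by (rule pow_ideal)
  have "\<alpha> (Suc (k + i)) \<ominus> \<alpha> (k + i) \<in> PIdl (t [^] k)"
    using assms(2)[of "k + i"] PIdl_t_pow_antimono[of k "k + i"] by auto
  from K.a_closed[OF this Suc.IH] show ?case
    using assms(1) by (simp add: minus_add_minus)
qed

text \<open>The kernel of the projection to level k is generated by the k-th power of
  \<open>\<tau>\<close>. If level k vanishes, all later representatives are divisible by t^k, and
  the quotients represent the cofactor. Thus congruences in \<open>H\<close> can be read either as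
  divisibility or as equality of cosets.\<close>

lemma V_iff: "x \<in> V k \<longleftrightarrow> x \<in> carrier H \<and> x k = \<zero>\<^bsub>H\<^esub> k"
proof
  assume "x \<in> V k"
  then obtain y where y: "y \<in> carrier H" "x = y \<otimes>\<^bsub>H\<^esub> \<iota> (t [^] k)"
    by (auto simp: mem_V_iff)
  from y(1) obtain \<alpha> where \<alpha>: "\<And>k. \<alpha> k \<in> carrier A" and "y = (\<lambda>k. PIdl (t [^] k) +> \<alpha> k)"
    by (rule H_elemE) (rule that)
  then have "x = (\<lambda>i. PIdl (t [^] i) +> (\<alpha> i \<otimes> t [^] k))"
    using y(2) by (simp add: \<iota>_eq H_mult del: \<iota>.hom_pow)
  then have "x k = \<zero>\<^bsub>H\<^esub> k"
    using \<alpha> by (simp add: coset_eq_zero_iff) (auto simp: mem_cgenideal_iff)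
  then show "x \<in> carrier H \<and> x k = \<zero>\<^bsub>H\<^esub> k" using y by simp
next
  assume x: "x \<in> carrier H \<and> x k = \<zero>\<^bsub>H\<^esub> k"
  then obtain \<alpha> where \<alpha>: "\<And>k. \<alpha> k \<in> carrier A"
    "\<And>k. \<alpha> (Suc k) \<ominus> \<alpha> k \<in> PIdl (t [^] k)" and x_eq: "x = (\<lambda>k. PIdl (t [^] k) +> \<alpha> k)"
    using H_elemE[of x] by metis
  interpret K: ideal "PIdl (t [^] k)" A by (rule pow_ideal)
  have \<alpha>k: "\<alpha> k \<in> PIdl (t [^] k)" using x \<alpha>(1) by (simp add: x_eq coset_eq_zero_iff)
  have "\<alpha> (k + i) \<in> PIdl (t [^] k)" for i
  proof -
    have "(\<alpha> (k + i) \<ominus> \<alpha> k) \<oplus> \<alpha> k \<in> PIdl (t [^] k)"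
      by (rule K.a_closed[OF cauchy_diff[OF \<alpha>] \<alpha>k])
    then show ?thesis using \<alpha>(1) by (simp add: a_minus_def a_assoc l_neg)
  qed
  then have "\<forall>i. \<exists>b. b \<in> carrier A \<and> \<alpha> (k + i) = t [^] k \<otimes> b"
    unfolding mem_cgenideal_iff using m_comm[OF _ nat_pow_closed[OF t_closed]] by metis
  then obtain \<beta> where \<beta>: "\<And>i. \<beta> i \<in> carrier A" "\<And>i. \<alpha> (k + i) = t [^] k \<otimes> \<beta> i"
    by metis
  \<comment> \<open>Dividing by t^k costs k orders of precision; the index shift by k in the
    definition of \<open>\<beta>\<close> compensates exactly.\<close>
  have "\<beta> (Suc i) \<ominus> \<beta> i \<in> PIdl (t [^] i)" for i
  proof (rule t_pow_cancel[of _ k])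
    have "t [^] k \<otimes> (\<beta> (Suc i) \<ominus> \<beta> i) = \<alpha> (Suc (k + i)) \<ominus> \<alpha> (k + i)"
      using \<beta>(1) \<beta>(2)[of "Suc i"] \<beta>(2)[of i] by (simp add: a_minus_def r_distr r_minus)
    then show "t [^] k \<otimes> (\<beta> (Suc i) \<ominus> \<beta> i) \<in> PIdl (t [^] (k + i))" using \<alpha>(2) by simp
  qed (use \<beta> in simp)
  with \<beta>(1) have y: "(\<lambda>i. PIdl (t [^] i) +> \<beta> i) \<in> carrier H" by (intro H_elem_closed)
  have "(\<lambda>i. PIdl (t [^] i) +> \<beta> i) \<otimes>\<^bsub>H\<^esub> \<iota> (t [^] k) = (\<lambda>i. PIdl (t [^] i) +> (\<alpha> (k + i)))"
    using \<beta> by (simp add: \<iota>_eq H_mult m_comm del: \<iota>.hom_pow)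
  also have "\<dots> = x"
  proof
    fix i
    have "\<alpha> (i + k) \<ominus> \<alpha> i \<in> PIdl (t [^] i)" by (rule cauchy_diff[OF \<alpha>])
    then show "PIdl (t [^] i) +> \<alpha> (k + i) = x i"
      using \<alpha>(1) by (simp add: x_eq coset_eq_iff add.commute)
  qed
  finally show "x \<in> V k" using y by (auto simp: mem_V_iff)
qed

text \<open>This turns convergence in the inverse limit topology into congruences modulo
  \<open>V k\<close>, after which representatives are rarely needed.\<close>

lemma eq_at_iff:
  assumes "x \<in> carrier H" "y \<in> carrier H"
  shows "x k = y k \<longleftrightarrow> x \<ominus>\<^bsub>H\<^esub> y \<in> V k"
proof -
  obtain \<alpha> where \<alpha>: "\<And>k. \<alpha> k \<in> carrier A" "x = (\<lambda>k. PIdl (t [^] k) +> \<alpha> k)"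
    using H_elemE[OF assms(1)] by metis
  obtain \<beta> where \<beta>: "\<And>k. \<beta> k \<in> carrier A" "y = (\<lambda>k. PIdl (t [^] k) +> \<beta> k)"
    using H_elemE[OF assms(2)] by metis
  have "x \<ominus>\<^bsub>H\<^esub> y = (\<lambda>k. PIdl (t [^] k) +> (\<alpha> k \<ominus> \<beta> k))"
    using assms \<alpha>(1) \<beta>(1) unfolding \<alpha>(2) \<beta>(2) by (rule H_minus)
  moreover from this have "(\<lambda>k. PIdl (t [^] k) +> (\<alpha> k \<ominus> \<beta> k)) \<in> carrier H"
    using H.minus_closed[OF assms] by simp
  ultimately show ?thesis
    using \<alpha> \<beta> by (simp add: V_iff coset_eq_iff coset_eq_zero_iff)
qed

lemma H_ext_V:
  assumes "x \<in> carrier H" "y \<in> carrier H" "\<And>k. x \<ominus>\<^bsub>H\<^esub> y \<in> V k"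
  shows "x = y"
  using assms eq_at_iff by blast

lemma V_0: "V 0 = carrier H"
  using ideal.one_imp_carrier[OF V_ideal[of 0]] H.cgenideal_self[OF H.one_closed]
  by (simp add: V_def)

lemma V_Suc_subset: "V (Suc k) \<subseteq> V k"
proof
  fix x assume "x \<in> V (Suc k)"
  then obtain y where y: "y \<in> carrier H" "x = y \<otimes>\<^bsub>H\<^esub> \<tau> [^]\<^bsub>H\<^esub> Suc k"
    by (auto simp: mem_V_iff simp del: H.nat_pow_Suc)
  then have "x = (y \<otimes>\<^bsub>H\<^esub> \<tau>) \<otimes>\<^bsub>H\<^esub> \<tau> [^]\<^bsub>H\<^esub> k" "y \<otimes>\<^bsub>H\<^esub> \<tau> \<in> carrier H"
    by (simp_all add: H.m_ac)
  then show "x \<in> V k" unfolding mem_V_iff by blast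
qed

lemma V_antimono: "m \<le> k \<Longrightarrow> V k \<subseteq> V m"
  using lift_Suc_antimono_le[of V] V_Suc_subset by blast

lemma \<iota>_V_iff:
  assumes "x \<in> carrier A" shows "\<iota> x \<in> V k \<longleftrightarrow> x \<in> PIdl (t [^] k)"
  using assms coset_eq_zero_iff[OF assms, of k] by (simp add: V_iff) (simp add: \<iota>_eq)

lemma V_mult: "x \<in> V i \<Longrightarrow> v \<in> V k \<Longrightarrow> x \<otimes>\<^bsub>H\<^esub> v \<in> V (i + k)"
proof -
  assume "x \<in> V i" "v \<in> V k"
  then obtain x' v' where "x' \<in> carrier H" "x = x' \<otimes>\<^bsub>H\<^esub> \<tau> [^]\<^bsub>H\<^esub> i"
    "v' \<in> carrier H" "v = v' \<otimes>\<^bsub>H\<^esub> \<tau> [^]\<^bsub>H\<^esub> k" by (auto simp: mem_V_iff)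
  then have "x' \<otimes>\<^bsub>H\<^esub> v' \<in> carrier H" "x \<otimes>\<^bsub>H\<^esub> v = (x' \<otimes>\<^bsub>H\<^esub> v') \<otimes>\<^bsub>H\<^esub> \<tau> [^]\<^bsub>H\<^esub> (i + k)"
    by (simp_all add: H.nat_pow_mult[symmetric] H.m_ac)
  then show ?thesis unfolding mem_V_iff by blast
qed

lemma \<tau>_V_1: "\<tau> \<in> V 1"
  using H.one_closed by (auto simp: mem_V_iff intro!: bexI[of _ "\<one>\<^bsub>H\<^esub>"])

lemma H_approx:
  assumes "x \<in> carrier H"
  obtains a where "a \<in> carrier A" "x \<ominus>\<^bsub>H\<^esub> \<iota> a \<in> V k"
proof -
  obtain \<alpha> where \<alpha>: "\<And>k. \<alpha> k \<in> carrier A" "x = (\<lambda>k. PIdl (t [^] k) +> \<alpha> k)"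
    using H_elemE[OF assms(1)] by metis
  then have "x k = \<iota> (\<alpha> k) k" by (simp add: \<iota>_eq)
  then have "x \<ominus>\<^bsub>H\<^esub> \<iota> (\<alpha> k) \<in> V k"
    using eq_at_iff[OF assms \<iota>.hom_closed[OF \<alpha>(1)], of k k] by simp
  then show ?thesis by (rule that[OF \<alpha>(1)])
qed

text \<open>The limit is the diagonal \<open>x k k\<close>: consecutive terms agree at level k, so
  the diagonal cosets are nested.\<close>

lemma H_complete:
  assumes x: "\<And>k. x k \<in> carrier H" and cauchy: "\<And>k. x (Suc k) \<ominus>\<^bsub>H\<^esub> x k \<in> V k"
  obtains y where "y \<in> carrier H" "\<And>k. x k \<ominus>\<^bsub>H\<^esub> y \<in> V k"
proof -
  let ?y = "\<lambda>k. x k k"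
  have "?y \<in> carrier H"
  proof -
    have "x (Suc k) (Suc k) \<subseteq> x k k" for k
    proof -
      have "x (Suc k) (Suc k) \<subseteq> x (Suc k) k" using x by (simp add: adic_completion_def)
      also have "\<dots> = x k k" using cauchy x by (simp add: eq_at_iff)
      finally show ?thesis .
    qed
    moreover have "x k k \<in> carrier (A Quot ideal_pow A (PIdl t) k)" for k
      using x[of k] by (simp add: adic_completion_def)
    ultimately show ?thesis by (simp add: adic_completion_def)
  qed
  moreover from this have "x k \<ominus>\<^bsub>H\<^esub> ?y \<in> V k" for k
    using eq_at_iff[OF x, of ?y k k] by simp
  ultimately show ?thesis by (rule that)
qed

text \<open>Cancelling t loses one order, so the argument starts from the representative at level k
  + 1, which agrees modulo t^k with the one at level k.\<close>

lemma \<tau>_cancel: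
  assumes "x \<in> carrier H" "\<tau> \<otimes>\<^bsub>H\<^esub> x \<in> V (Suc k)"
  shows "x \<in> V k"
proof -
  obtain \<alpha> where \<alpha>: "\<And>k. \<alpha> k \<in> carrier A" "\<And>k. \<alpha> (Suc k) \<ominus> \<alpha> k \<in> PIdl (t [^] k)"
    "x = (\<lambda>k. PIdl (t [^] k) +> \<alpha> k)"
    using H_elemE[OF assms(1)] by metis
  have "\<tau> \<otimes>\<^bsub>H\<^esub> x = (\<lambda>k. PIdl (t [^] k) +> (t \<otimes> \<alpha> k))"
    using \<alpha> by (simp add: \<iota>_eq H_mult)
  then have "t \<otimes> \<alpha> (Suc k) \<in> PIdl (t [^] Suc k)"
    using assms(2) \<alpha>(1) coset_eq_zero_iff[of "t \<otimes> \<alpha> (Suc k)" "Suc k"] by (simp add: V_iff)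
  then have "t [^] (1::nat) \<otimes> \<alpha> (Suc k) \<in> PIdl (t [^] (1 + k))" by simp
  then have Suc: "\<alpha> (Suc k) \<in> PIdl (t [^] k)" by (rule t_pow_cancel[rotated]) (rule \<alpha>(1))
  interpret K: ideal "PIdl (t [^] k)" A by (rule pow_ideal)
  have "\<alpha> k = \<alpha> (Suc k) \<ominus> (\<alpha> (Suc k) \<ominus> \<alpha> k)"
    using \<alpha>(1) by (simp add: minus_minus_cancel)
  also have "\<dots> \<in> PIdl (t [^] k)"
    by (rule K.I_minus_closed[OF Suc \<alpha>(2)])
  finally show ?thesis using assms(1) \<alpha> by (simp add: V_iff coset_eq_zero_iff)
qed

lemma \<tau>_eq_zero:
  assumes "x \<in> carrier H" "\<tau> \<otimes>\<^bsub>H\<^esub> x = \<zero>\<^bsub>H\<^esub>"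
  shows "x = \<zero>\<^bsub>H\<^esub>"
proof (rule H_ext_V)
  show "x \<ominus>\<^bsub>H\<^esub> \<zero>\<^bsub>H\<^esub> \<in> V k" for k
    using \<tau>_cancel[OF assms(1), of k] V.zero_closed assms by (simp add: a_minus_def)
qed (use assms in auto)

lemma \<tau>_pow_eq_zero:
  assumes "x \<in> carrier H" "\<tau> [^]\<^bsub>H\<^esub> (k::nat) \<otimes>\<^bsub>H\<^esub> x = \<zero>\<^bsub>H\<^esub>"
  shows "x = \<zero>\<^bsub>H\<^esub>"
  using assms
proof (induction k)
  case (Suc k)
  have "\<tau> \<otimes>\<^bsub>H\<^esub> (\<tau> [^]\<^bsub>H\<^esub> k \<otimes>\<^bsub>H\<^esub> x) = \<zero>\<^bsub>H\<^esub>"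
    using Suc.prems by (simp add: H.m_ac del: \<iota>.hom_pow)
  then show ?case using Suc.IH Suc.prems \<tau>_eq_zero[of "\<tau> [^]\<^bsub>H\<^esub> k \<otimes>\<^bsub>H\<^esub> x"] by simp
qed simp

lemma H_one_notin: "\<one>\<^bsub>H\<^esub> \<notin> V 1"
  using \<iota>_V_iff[OF one_closed, of 1] one_notin by simp

lemma H_Units:
  assumes x: "x \<in> carrier H" "x \<notin> V 1"
  shows "x \<in> Units H"
proof -
  obtain \<alpha> where \<alpha>: "\<And>k. \<alpha> k \<in> carrier A" "\<And>k. \<alpha> (Suc k) \<ominus> \<alpha> k \<in> PIdl (t [^] k)"
    and x_eq: "x = (\<lambda>k. PIdl (t [^] k) +> \<alpha> k)"
    using H_elemE[OF x(1)] by metis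
  interpret M: ideal "PIdl t" A by (rule t_ideal)
  have "x 1 \<noteq> \<zero>\<^bsub>H\<^esub> 1" using x V_iff by blast
  then have "\<alpha> 1 \<notin> PIdl t" using \<alpha>(1) coset_eq_zero_iff[of "\<alpha> 1" 1] by (simp add: x_eq)
  have U: "\<alpha> (Suc k) \<in> Units A" for k
  proof (rule Units_notin)
    show "\<alpha> (Suc k) \<notin> PIdl t"
    proof
      assume *: "\<alpha> (Suc k) \<in> PIdl t"
      have "\<alpha> (1 + k) \<ominus> \<alpha> 1 \<in> PIdl t" using cauchy_diff[OF \<alpha>, of 1 k] by simp
      with * have "\<alpha> (Suc k) \<ominus> (\<alpha> (Suc k) \<ominus> \<alpha> 1) \<in> PIdl t"
        by (simp add: M.I_minus_closed)
      then show False
        using \<open>\<alpha> 1 \<notin> PIdl t\<close> \<alpha>(1) by (simp add: minus_minus_cancel)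
    qed
  qed (rule \<alpha>(1))
  \<comment> \<open>The shift by one is needed because level 0 is the zero ring and
    \<open>\<alpha> 0\<close> may be a nonunit; from index 1 on all representatives are nonzero
    modulo t, hence units.\<close>
  let ?\<beta> = "\<lambda>k. inv (\<alpha> (Suc k))"
  have inv_closed: "?\<beta> k \<in> carrier A" for k using U by simp
  have "?\<beta> (Suc k) \<ominus> ?\<beta> k \<in> PIdl (t [^] k)" for k
  proof -
    interpret K: ideal "PIdl (t [^] k)" A by (rule pow_ideal)
    let ?u = "\<alpha> (Suc k)" and ?v = "\<alpha> (Suc (Suc k))"
    have c: "?u \<in> carrier A" "?v \<in> carrier A" "inv ?u \<in> carrier A" "inv ?v \<in> carrier A"
      using \<alpha>(1) inv_closed by auto
    have "inv ?v \<ominus> inv ?u = (?u \<otimes> inv ?u) \<otimes> inv ?v \<ominus> (?v \<otimes> inv ?v) \<otimes> inv ?u"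
      using U c by simp
    also have "\<dots> = \<ominus> (?v \<ominus> ?u) \<otimes> (inv ?u \<otimes> inv ?v)"
      using c by (simp add: a_minus_def minus_add l_distr r_distr l_minus r_minus m_ac a_ac)
    also have "\<dots> \<in> PIdl (t [^] k)"
      using \<alpha>(2)[of "Suc k"] PIdl_t_pow_antimono[of k "Suc k"] c
      by (intro K.I_r_closed K.a_inv_closed) auto
    finally show ?thesis .
  qed
  with inv_closed have y: "(\<lambda>k. PIdl (t [^] k) +> ?\<beta> k) \<in> carrier H" by (intro H_elem_closed)
  have "x \<otimes>\<^bsub>H\<^esub> (\<lambda>k. PIdl (t [^] k) +> ?\<beta> k) = (\<lambda>k. PIdl (t [^] k) +> (\<alpha> k \<otimes> ?\<beta> k))"
    using \<alpha>(1) inv_closed by (simp add: x_eq H_mult)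
  also have "\<dots> = \<one>\<^bsub>H\<^esub>"
  proof
    fix k :: nat
    interpret K: ideal "PIdl (t [^] k)" A by (rule pow_ideal)
    have c: "\<alpha> k \<in> carrier A" "\<alpha> (Suc k) \<in> carrier A" "?\<beta> k \<in> carrier A"
      using \<alpha>(1) inv_closed by auto
    have "\<alpha> k \<otimes> ?\<beta> k \<ominus> \<one> = \<alpha> k \<otimes> ?\<beta> k \<ominus> \<alpha> (Suc k) \<otimes> ?\<beta> k"
      using U by simp
    also have "\<dots> = \<ominus> (\<alpha> (Suc k) \<ominus> \<alpha> k) \<otimes> ?\<beta> k"
      using c by (simp add: a_minus_def minus_add l_distr l_minus a_ac)
    also have "\<dots> \<in> PIdl (t [^] k)"
      using \<alpha>(2) c by (intro K.I_r_closed K.a_inv_closed)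
    finally show "PIdl (t [^] k) +> (\<alpha> k \<otimes> ?\<beta> k) = \<one>\<^bsub>H\<^esub> k"
      using c by (simp add: H_one coset_eq_iff)
  qed
  finally show ?thesis
    using x(1) y H.m_comm[OF x(1) y] unfolding Units_def by auto
qed

end

section \<open>Series and the elements $z_r$\<close>

context dvr_uniformizer
begin

lemma partial_sum_Suc:
  assumes "\<And>i. f i \<in> carrier H"
  shows "finsum H f {..<Suc n} = finsum H f {..<n} \<oplus>\<^bsub>H\<^esub> f n"
proof -
  have "f \<in> {..<n} \<rightarrow> carrier H" using assms by auto
  then show ?thesis
    using assms by (simp add: lessThan_Suc H.a_comm)
qed

lemma partial_sum_closed:
  assumes "\<And>i. f i \<in> carrier H"
  shows "finsum H f {..<n::nat} \<in> carrier H"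
  using assms by (intro H.finsum_closed) auto

lemma adic_sums_iff:
  assumes "\<And>i. f i \<in> carrier H"
  shows "adic_sums A (PIdl t) f s \<longleftrightarrow>
    s \<in> carrier H \<and> (\<forall>k. \<exists>N. \<forall>n\<ge>N. finsum H f {..<n} \<ominus>\<^bsub>H\<^esub> s \<in> V k)"
  unfolding adic_sums_def using eq_at_iff[OF partial_sum_closed[of f, OF assms]] by blast

lemma adic_sums_exists:
  assumes f: "\<And>i. f i \<in> V i"
  shows "\<exists>s. adic_sums A (PIdl t) f s"
proof -
  have car: "f i \<in> carrier H" for i using V.Icarr[OF f] .
  let ?S = "\<lambda>n. finsum H f {..<n}"
  have S: "?S n \<in> carrier H" for n by (rule partial_sum_closed[OF car])
  have step: "?S (Suc k) \<ominus>\<^bsub>H\<^esub> ?S k = f k" for k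
    using S car by (simp add: partial_sum_Suc[of f, OF car] a_minus_def H.a_assoc H.a_comm[of "f k"] H.r_neg2)
  have "?S (Suc k) \<ominus>\<^bsub>H\<^esub> ?S k \<in> V k" for k unfolding step by (rule f)
  with S obtain s where s: "s \<in> carrier H" "\<And>k. ?S k \<ominus>\<^bsub>H\<^esub> s \<in> V k"
    by (rule H_complete[of ?S]) (rule that)
  have "?S n \<ominus>\<^bsub>H\<^esub> s \<in> V k" if "k \<le> n" for n k
    using s(2) V_antimono[OF that] by blast
  then show ?thesis using s(1) adic_sums_iff[of f, OF car] by blast
qed

lemma adic_suminf_eq:
  assumes "adic_sums A (PIdl t) f s"
  shows "adic_suminf A (PIdl t) f = s"
  unfolding adic_suminf_def
proof (rule the_equality[where P = "adic_sums A (PIdl t) f", OF assms])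
  fix s' assume s': "adic_sums A (PIdl t) f s'"
  show "s' = s"
  proof
    fix k
    obtain M where "\<And>n. n \<ge> M \<Longrightarrow> finsum H f {..<n} k = s k"
      using assms unfolding adic_sums_def by blast
    moreover obtain N where "\<And>n. n \<ge> N \<Longrightarrow> finsum H f {..<n} k = s' k"
      using s' unfolding adic_sums_def by blast
    ultimately show "s' k = s k" by (metis max.cobounded1 max.cobounded2)
  qed
qed

text \<open>Splitting off the first term and extracting a common factor from the rest is the source
  of the recursion \<open>Z_rec\<close> between consecutive tails.\<close>

lemma adic_sums_step:
  assumes g: "\<And>i. g i \<in> carrier H" and c: "c \<in> carrier H" and e: "f 0 \<in> carrier H"
    and f: "\<And>i. f (Suc i) = c \<otimes>\<^bsub>H\<^esub> g i" and s: "adic_sums A (PIdl t) g s"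
  shows "adic_sums A (PIdl t) f (f 0 \<oplus>\<^bsub>H\<^esub> c \<otimes>\<^bsub>H\<^esub> s)"
proof -
  have fcar: "f i \<in> carrier H" for i using e f g c by (cases i) auto
  have scar: "s \<in> carrier H" using s by (simp add: adic_sums_def)
  have sum: "finsum H f {..<Suc n} = f 0 \<oplus>\<^bsub>H\<^esub> c \<otimes>\<^bsub>H\<^esub> finsum H g {..<n}" for n
  proof (induction n)
    case 0
    show ?case using partial_sum_Suc[of f 0, OF fcar] e c by simp
  next
    case (Suc n)
    then show ?case
      using partial_sum_Suc[of f "Suc n", OF fcar] partial_sum_Suc[of g n, OF g]
        partial_sum_closed[of g n, OF g] e c g
      by (simp add: f H.r_distr H.a_assoc)
  qed
  have "\<exists>N. \<forall>n\<ge>N. finsum H f {..<n} \<ominus>\<^bsub>H\<^esub> (f 0 \<oplus>\<^bsub>H\<^esub> c \<otimes>\<^bsub>H\<^esub> s) \<in> V k" for k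
  proof -
    obtain N where N: "\<And>n. n \<ge> N \<Longrightarrow> finsum H g {..<n} \<ominus>\<^bsub>H\<^esub> s \<in> V k"
      using s adic_sums_iff[of g, OF g] by blast
    have "finsum H f {..<n} \<ominus>\<^bsub>H\<^esub> (f 0 \<oplus>\<^bsub>H\<^esub> c \<otimes>\<^bsub>H\<^esub> s) \<in> V k" if n: "n \<ge> Suc N" for n
    proof -
      obtain m where m: "n = Suc m" "m \<ge> N" using n by (cases n) auto
      let ?S = "finsum H g {..<m}"
      have S: "?S \<in> carrier H" by (rule partial_sum_closed[OF g])
      have "f 0 \<oplus>\<^bsub>H\<^esub> c \<otimes>\<^bsub>H\<^esub> ?S \<ominus>\<^bsub>H\<^esub> (f 0 \<oplus>\<^bsub>H\<^esub> c \<otimes>\<^bsub>H\<^esub> s)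
          = (f 0 \<ominus>\<^bsub>H\<^esub> f 0) \<oplus>\<^bsub>H\<^esub> (c \<otimes>\<^bsub>H\<^esub> ?S \<ominus>\<^bsub>H\<^esub> c \<otimes>\<^bsub>H\<^esub> s)"
        using S c e scar by (intro H.add_diff_add) auto
      also have "\<dots> = c \<otimes>\<^bsub>H\<^esub> (?S \<ominus>\<^bsub>H\<^esub> s)"
        using S c e scar by (simp add: a_minus_def H.r_neg H.r_distr H.r_minus)
      finally show ?thesis
        using V.I_l_closed[OF N[OF m(2)] c] by (simp add: m(1) sum del: H.finsum_infinite)
    qed
    then show ?thesis by blast
  qed
  then show ?thesis using adic_sums_iff[of f, OF fcar] e c scar by simp
qed

end

locale akizuki = dvr_uniformizer A t for A :: "('a, 'b) ring_scheme" (structure) and t +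
  fixes a :: "nat \<Rightarrow> 'a" and n :: "nat \<Rightarrow> nat"
  assumes a_closed [simp]: "a i \<in> carrier A"
    and n_0: "n 0 = 0"
    and n_Suc: "n (Suc r) \<ge> 2 * n r + 2"
begin

lemma n_add_le: "n r + i \<le> n (r + i)"
proof (induction i)
  case (Suc i)
  then show ?case using n_Suc[of "r + i"] by simp
qed simp

abbreviation Z where "Z r \<equiv> akizuki_z A t a n r"

definition m where "m r = n (Suc r) - n r"

lemma n_Suc_eq: "n (Suc r) = n r + m r" using n_Suc[of r] by (simp add: m_def)
text \<open>The growth hypothesis in the form needed later: \<open>m r - n r - 1\<close> is a
  genuine difference and at least 1.\<close>

lemma m_ge: "m r \<ge> n r + 2" using n_Suc[of r] by (simp add: m_def)

lemma Z_sums: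
  "adic_sums A (PIdl t) (\<lambda>i. \<iota> (a (r + i) \<otimes> t [^] (n (r + i) - n r))) (Z r)"
proof -
  have "\<iota> (a (r + i) \<otimes> t [^] (n (r + i) - n r)) \<in> V i" for i
  proof (subst \<iota>_V_iff)
    have "a (r + i) \<otimes> t [^] (n (r + i) - n r) \<in> PIdl (t [^] (n (r + i) - n r))"
      by (auto simp: mem_cgenideal_iff)
    moreover have "i \<le> n (r + i) - n r" using n_add_le[of r i] by simp
    ultimately show "a (r + i) \<otimes> t [^] (n (r + i) - n r) \<in> PIdl (t [^] i)"
      using PIdl_t_pow_antimono by blast
  qed simp
  from adic_sums_exists[of "\<lambda>i. \<iota> (a (r + i) \<otimes> t [^] (n (r + i) - n r))", OF this]
  obtain s where "adic_sums A (PIdl t) (\<lambda>i. \<iota> (a (r + i) \<otimes> t [^] (n (r + i) - n r))) s" ..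
  then show ?thesis
    unfolding akizuki_z_def using adic_suminf_eq by simp
qed

lemma Z_closed [simp]: "Z r \<in> carrier H"
  using Z_sums[of r] by (simp add: adic_sums_def)

lemma Z_rec: "Z r = \<iota> (a r) \<oplus>\<^bsub>H\<^esub> \<tau> [^]\<^bsub>H\<^esub> m r \<otimes>\<^bsub>H\<^esub> Z (Suc r)"
proof -
  let ?f = "\<lambda>r i. \<iota> (a (r + i) \<otimes> t [^] (n (r + i) - n r))"
  have "adic_sums A (PIdl t) (?f r) (?f r 0 \<oplus>\<^bsub>H\<^esub> \<tau> [^]\<^bsub>H\<^esub> m r \<otimes>\<^bsub>H\<^esub> Z (Suc r))"
  proof (rule adic_sums_step[where g = "?f (Suc r)"])
    fix i
    \<comment> \<open>Every term after the first contains the factor t^(m r), and what remains is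
      the corresponding term of the next tail.\<close>
    have "n (Suc (r + i)) - n r = m r + (n (Suc (r + i)) - n (Suc r))"
      using n_add_le[of "Suc r" i] n_Suc_eq[of r] by simp
    then have "t [^] (n (Suc (r + i)) - n r) = t [^] m r \<otimes> t [^] (n (Suc (r + i)) - n (Suc r))"
      by (simp add: nat_pow_mult)
    then show "?f r (Suc i) = \<tau> [^]\<^bsub>H\<^esub> m r \<otimes>\<^bsub>H\<^esub> ?f (Suc r) i"
      by (simp add: H.m_lcomm)
  qed (use Z_sums[of "Suc r"] in simp_all)
  from adic_suminf_eq[OF this] adic_suminf_eq[OF Z_sums[of r]] show ?thesis by simp
qed

lemma Z_0:
  assumes "adic_sums A (PIdl t) (\<lambda>i. \<iota> (a i \<otimes> t [^] n i)) z"
  shows "Z 0 = z"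
  using adic_suminf_eq[OF assms] by (simp add: akizuki_z_def n_0)

end

section \<open>The ring $C$ inside the dual numbers\<close>

lemma (in ring_hom_ring) image_generate_ring:
  assumes U: "U \<subseteq> carrier R"
  shows "h ` generate_ring R U = generate_ring S (h ` U)"
proof
  note car = R.generate_ring_in_carrier[OF U]
  show "h ` generate_ring R U \<subseteq> generate_ring S (h ` U)"
  proof
    fix y assume "y \<in> h ` generate_ring R U"
    then obtain x where x: "x \<in> generate_ring R U" and y: "y = h x" by blast
    show "y \<in> generate_ring S (h ` U)" unfolding y using x
      by (induction rule: generate_ring.induct)
        (use car in \<open>auto intro: generate_ring.intros\<close>)
  qed
  have "subring (h ` generate_ring R U) S"
    by (rule img_is_subring[OF R.generate_ring_is_subring[OF U]])
  moreover have "h ` U \<subseteq> h ` generate_ring R U" by (auto intro: generate_ring.incl)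
  moreover have "h ` U \<subseteq> carrier S" using U by auto
  ultimately show "generate_ring S (h ` U) \<subseteq> h ` generate_ring R U"
    using S.generate_ring_min_subring1 by blast
qed

lemma (in ring) add_minus_cancel_left:
  assumes "x \<in> carrier R" "y \<in> carrier R"
  shows "(x \<oplus> y) \<ominus> x = y" "x \<oplus> (y \<ominus> x) = y"
proof -
  show "(x \<oplus> y) \<ominus> x = y" using assms by (simp add: a_minus_def a_assoc a_lcomm[of x y] r_neg)
  show "x \<oplus> (y \<ominus> x) = y" using assms by (simp add: a_minus_def a_lcomm[of x y] r_neg)
qed

lemma (in cring) collect_multiples:
  assumes "x \<in> carrier R" "y \<in> carrier R" "c \<in> carrier R" "p \<in> carrier R" "q \<in> carrier R"
    "r \<in> carrier R"
  shows "(x \<oplus> y \<oplus> c \<otimes> r) \<oplus> (c \<otimes> p \<oplus> c \<otimes> q) = x \<oplus> y \<oplus> c \<otimes> (p \<oplus> q \<oplus> r)"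
  using assms by (simp add: r_distr a_ac)

locale akizuki_construction = akizuki A t a n
  for A :: "('a, 'b) ring_scheme" (structure) and t a n +
  assumes transcendental_Z:
    "ring.transcendental (completion_at A t) (to_completion_at A t ` carrier A) (akizuki_z A t a n 0)"
begin

abbreviation B where "B \<equiv> dual_numbers H"
abbreviation two where "two \<equiv> \<one>\<^bsub>H\<^esub> \<oplus>\<^bsub>H\<^esub> \<one>\<^bsub>H\<^esub>"
abbreviation w where "w \<equiv> akizuki_w A t a n"
abbreviation d where "d i \<equiv> Z i \<ominus>\<^bsub>H\<^esub> \<iota> (a i)"

sublocale B: cring B by (rule H.dual_numbers_cring)

lemmas B_simps = dual_numbers_simps[where R = H]

lemma d_eq: "d i = \<tau> [^]\<^bsub>H\<^esub> m i \<otimes>\<^bsub>H\<^esub> Z (Suc i)"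
  unfolding Z_rec[of i] by (rule H.add_minus_cancel_left) simp_all

lemma Z_eq: "Z i = \<iota> (a i) \<oplus>\<^bsub>H\<^esub> d i"
  using H.add_minus_cancel_left(2)[of "\<iota> (a i)" "Z i"] by simp

lemma d_closed [simp]: "d i \<in> carrier H" by simp

lemma w_eq: "w = \<tau> \<otimes>\<^bsub>H\<^esub> d 0"
  by (simp add: akizuki_w_def)

lemma w_closed [simp]: "w \<in> carrier H" by (simp add: w_eq)

text \<open>\<open>\<kappa>\<close> and \<open>y\<close> are lifts to pairs (value, derivative by
  w): elements of \<open>A\<close> are constants, and w has derivative one.\<close>

definition \<kappa> where "\<kappa> x = (\<iota> x, \<zero>\<^bsub>H\<^esub>)"
definition y where "y = (w, \<one>\<^bsub>H\<^esub>)"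

text \<open>Differentiating $(z_i - a_i)^2 = (w - s_i)^2 / t^{2 n_i + 2}$ with respect to $w$ gives
  $2 (w - s_i) / t^{2 n_i + 2} = 2 (z_i - a_i) / t^{n_i + 1}$, and $z_i - a_i = t^{m_i} z_{i+1}$.\<close>
definition \<gamma> where
  "\<gamma> i = (d i \<otimes>\<^bsub>H\<^esub> d i, two \<otimes>\<^bsub>H\<^esub> (\<tau> [^]\<^bsub>H\<^esub> (m i - n i - 1) \<otimes>\<^bsub>H\<^esub> Z (Suc i)))"

lemma \<kappa>_hom: "ring_hom_cring A B \<kappa>"
  by (intro ring_hom_cring.intro ring_hom_cring_axioms.intro is_cring B.is_cring ring_hom_memI)
    (simp_all add: \<kappa>_def B_simps)

sublocale \<kappa>: ring_hom_cring A B \<kappa> by (rule \<kappa>_hom)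

abbreviation T where "T \<equiv> \<kappa> t"

lemma T_pow: "T [^]\<^bsub>B\<^esub> k = (\<tau> [^]\<^bsub>H\<^esub> k, \<zero>\<^bsub>H\<^esub>)" for k :: nat
  by (simp add: \<kappa>_def H.dual_numbers_pow_const)

lemma y_closed [simp]: "y \<in> carrier B" by (simp add: y_def B_simps)
lemma \<gamma>_closed [simp]: "\<gamma> i \<in> carrier B" by (simp add: \<gamma>_def B_simps)

definition gens where "gens = \<kappa> ` carrier A \<union> {y} \<union> range \<gamma>"
definition E where "E = generate_ring B gens"

lemma gens_subset: "gens \<subseteq> carrier B" by (auto simp: gens_def)

lemma E_subring: "subring E B"
  unfolding E_def by (rule B.generate_ring_is_subring[OF gens_subset])

lemma E_carrier: "e \<in> E \<Longrightarrow> e \<in> carrier B"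
  using subringE(1)[OF E_subring] by blast

lemma E_gens:
  "x \<in> carrier A \<Longrightarrow> \<kappa> x \<in> E" "y \<in> E" "\<gamma> i \<in> E"
  unfolding E_def by (auto intro: generate_ring.incl simp: gens_def)

lemma E_ops:
  "e \<in> E \<Longrightarrow> f \<in> E \<Longrightarrow> e \<otimes>\<^bsub>B\<^esub> f \<in> E" "e \<in> E \<Longrightarrow> f \<in> E \<Longrightarrow> e \<oplus>\<^bsub>B\<^esub> f \<in> E"
  "e \<in> E \<Longrightarrow> \<ominus>\<^bsub>B\<^esub> e \<in> E" "\<zero>\<^bsub>B\<^esub> \<in> E" "\<one>\<^bsub>B\<^esub> \<in> E"
  using subringE[OF E_subring] by auto

lemma E_minus: "e \<in> E \<Longrightarrow> f \<in> E \<Longrightarrow> e \<ominus>\<^bsub>B\<^esub> f \<in> E"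
  using E_ops by (simp add: a_minus_def)

lemma T_pow_E: "T [^]\<^bsub>B\<^esub> (k::nat) \<in> E"
  using E_gens(1)[of "t [^] k"] by simp

sublocale fst: ring_hom_cring B H fst
  by unfold_locales (rule H.dual_numbers_fst_hom)

text \<open>\<open>fst\<close> is a ring homomorphism that sends the lifted generators to the
  generators of C, so it maps the generated ring onto C.\<close>

lemma fst_E: "fst ` E = carrier (akizuki_ring A t a n)"
proof -
  have "(d i) [^]\<^bsub>H\<^esub> (2::nat) = fst (\<gamma> i)" for i
    by (simp add: \<gamma>_def numeral_2_eq_2)
  then have "fst ` gens = \<iota> ` carrier A \<union> {w} \<union> range (\<lambda>i. (d i) [^]\<^bsub>H\<^esub> (2::nat))"
    by (auto simp: gens_def \<kappa>_def y_def image_Un image_image)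
  then show ?thesis
    using fst.ring.image_generate_ring[OF gens_subset] by (simp add: E_def akizuki_ring_def)
qed

text \<open>Here p is the partial sum a_0 + a_1 t^(n_1) + ... + a_i t^(n_i): multiplication by
  t^(n_i) moves the tail of z_i back to its place in z.\<close>

lemma d_shift: "\<exists>p\<in>carrier A. \<tau> [^]\<^bsub>H\<^esub> n i \<otimes>\<^bsub>H\<^esub> d i = Z 0 \<ominus>\<^bsub>H\<^esub> \<iota> p"
proof (induction i)
  case 0
  show ?case by (rule bexI[of _ "a 0"]) (simp_all add: n_0)
next
  case (Suc i)
  then obtain p where p: "p \<in> carrier A" "\<tau> [^]\<^bsub>H\<^esub> n i \<otimes>\<^bsub>H\<^esub> d i = Z 0 \<ominus>\<^bsub>H\<^esub> \<iota> p" by blast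
  let ?q = "t [^] n (Suc i) \<otimes> a (Suc i)"
  have "\<tau> [^]\<^bsub>H\<^esub> n (Suc i) \<otimes>\<^bsub>H\<^esub> d (Suc i)
      = \<tau> [^]\<^bsub>H\<^esub> n i \<otimes>\<^bsub>H\<^esub> (\<tau> [^]\<^bsub>H\<^esub> m i \<otimes>\<^bsub>H\<^esub> Z (Suc i)) \<ominus>\<^bsub>H\<^esub> \<iota> ?q"
    by (simp add: n_Suc_eq H.nat_pow_mult[symmetric] a_minus_def H.r_distr H.r_minus H.m_assoc)
  also have "\<dots> = Z 0 \<ominus>\<^bsub>H\<^esub> \<iota> (p \<oplus> ?q)"
    unfolding d_eq[symmetric] p(2) using p(1) by (simp add: a_minus_def H.minus_add H.a_assoc)
  finally show ?case using p(1) by (intro bexI[of _ "p \<oplus> ?q"]) auto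
qed

text \<open>\<open>u i\<close> is $y - s_i$.\<close>
definition u where "u i = (\<tau> [^]\<^bsub>H\<^esub> (n i + 1) \<otimes>\<^bsub>H\<^esub> d i, \<one>\<^bsub>H\<^esub>)"

text \<open>With p from \<open>d_shift\<close>, the constant is s_i = t (p - a_0), which lies in
  \<open>A\<close>; subtracting it changes the value but not the derivative 1.\<close>

lemma u_E: "u i \<in> E"
proof -
  obtain p where p: "p \<in> carrier A" "\<tau> [^]\<^bsub>H\<^esub> n i \<otimes>\<^bsub>H\<^esub> d i = Z 0 \<ominus>\<^bsub>H\<^esub> \<iota> p"
    using d_shift by blast
  have "\<tau> [^]\<^bsub>H\<^esub> (n i + 1) \<otimes>\<^bsub>H\<^esub> d i = \<tau> \<otimes>\<^bsub>H\<^esub> (\<tau> [^]\<^bsub>H\<^esub> n i \<otimes>\<^bsub>H\<^esub> d i)"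
    by (simp add: H.m_ac)
  also have "\<dots> = w \<oplus>\<^bsub>H\<^esub> \<iota> (t \<otimes> (a 0 \<ominus> p))"
    unfolding p(2) w_eq using p(1)
    by (simp add: a_minus_def H.r_distr H.r_minus H.a_assoc H.r_neg1)
  finally have "u i = y \<oplus>\<^bsub>B\<^esub> \<kappa> (t \<otimes> (a 0 \<ominus> p))"
    by (simp add: u_def y_def \<kappa>_def B_simps)
  then show ?thesis using p(1) E_gens E_ops E_minus by simp
qed

text \<open>Square z_i - a_i = t^(m_i) (a_(i+1) + (z_(i+1) - a_(i+1))). The cross term 2 a_(i+1)
  t^(2 m_i) (z_(i+1) - a_(i+1)) must be expressed by elements of the ring, and z_(i+1) - a_(i+1) is
  not among its generators. However 2 m_i = (m_i - n_i - 1) + (n_(i+1) + 1), and t^(n_(i+1) + 1)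
  (z_(i+1) - a_(i+1)) is the value of \<open>u (Suc i)\<close>.\<close>

lemma \<gamma>_expand:
  "\<gamma> i = T [^]\<^bsub>B\<^esub> (2 * m i) \<otimes>\<^bsub>B\<^esub> (\<kappa> (a (Suc i) \<otimes> a (Suc i)) \<oplus>\<^bsub>B\<^esub> \<gamma> (Suc i))
    \<oplus>\<^bsub>B\<^esub> T [^]\<^bsub>B\<^esub> (m i - n i - 1) \<otimes>\<^bsub>B\<^esub> (\<kappa> (a (Suc i) \<oplus> a (Suc i)) \<otimes>\<^bsub>B\<^esub> u (Suc i))"
proof -
  let ?p = "m i - n i - 1" and ?p' = "m (Suc i) - n (Suc i) - 1"
  define P where "P = \<tau> [^]\<^bsub>H\<^esub> ?p"
  define M where "M = \<tau> [^]\<^bsub>H\<^esub> m i"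
  define N where "N = \<tau> [^]\<^bsub>H\<^esub> (n (Suc i) + 1)"
  define P' where "P' = \<tau> [^]\<^bsub>H\<^esub> ?p'"
  define \<alpha> where "\<alpha> = \<iota> (a (Suc i))"
  define \<delta> where "\<delta> = d (Suc i)"
  define \<zeta> where "\<zeta> = Z (Suc (Suc i))"
  have car [simp]: "P \<in> carrier H" "M \<in> carrier H" "N \<in> carrier H" "P' \<in> carrier H"
    "\<alpha> \<in> carrier H" "\<delta> \<in> carrier H" "\<zeta> \<in> carrier H"
    by (simp_all add: P_def M_def N_def P'_def \<alpha>_def \<delta>_def \<zeta>_def)
  have Z: "Z (Suc i) = \<alpha> \<oplus>\<^bsub>H\<^esub> \<delta>" unfolding \<alpha>_def \<delta>_def by (rule Z_eq)
  have MM: "\<tau> [^]\<^bsub>H\<^esub> (2 * m i) = M \<otimes>\<^bsub>H\<^esub> M"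
    by (simp add: M_def H.nat_pow_mult mult_2)
  have "m i + m i = ?p + (n (Suc i) + 1)" using m_ge[of i] n_Suc_eq[of i] by simp
  then have PN: "M \<otimes>\<^bsub>H\<^esub> M = P \<otimes>\<^bsub>H\<^esub> N"
    unfolding M_def P_def N_def by (simp only: H.nat_pow_mult \<iota>.hom_closed t_closed)
  \<comment> \<open>This exponent identity makes \<open>N\<close> times the derivative of
    \<open>\<gamma> (Suc i)\<close> equal to twice \<open>\<delta>\<close>, which matches the second
    coordinates.\<close>
  have "n (Suc i) + 1 + ?p' = m (Suc i)" using m_ge[of "Suc i"] by simp
  then have N\<zeta>: "N \<otimes>\<^bsub>H\<^esub> (P' \<otimes>\<^bsub>H\<^esub> \<zeta>) = \<delta>"
    unfolding \<delta>_def d_eq N_def P'_def \<zeta>_def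
    by (simp only: H.m_assoc[symmetric] H.nat_pow_mult H.nat_pow_closed \<iota>.hom_closed t_closed Z_closed)
  have \<gamma>i: "\<gamma> i = (M \<otimes>\<^bsub>H\<^esub> (\<alpha> \<oplus>\<^bsub>H\<^esub> \<delta>) \<otimes>\<^bsub>H\<^esub> (M \<otimes>\<^bsub>H\<^esub> (\<alpha> \<oplus>\<^bsub>H\<^esub> \<delta>)), two \<otimes>\<^bsub>H\<^esub> (P \<otimes>\<^bsub>H\<^esub> (\<alpha> \<oplus>\<^bsub>H\<^esub> \<delta>)))"
    unfolding \<gamma>_def d_eq Z by (simp add: M_def P_def)
  have \<gamma>Si: "\<gamma> (Suc i) = (\<delta> \<otimes>\<^bsub>H\<^esub> \<delta>, two \<otimes>\<^bsub>H\<^esub> (P' \<otimes>\<^bsub>H\<^esub> \<zeta>))"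
    by (simp add: \<gamma>_def \<delta>_def P'_def \<zeta>_def)
  \<comment> \<open>First coordinates; the cross term absorbs \<open>N\<close> from the
    factorisation \<open>PN\<close>.\<close>
  have "M \<otimes>\<^bsub>H\<^esub> (\<alpha> \<oplus>\<^bsub>H\<^esub> \<delta>) \<otimes>\<^bsub>H\<^esub> (M \<otimes>\<^bsub>H\<^esub> (\<alpha> \<oplus>\<^bsub>H\<^esub> \<delta>))
      = (M \<otimes>\<^bsub>H\<^esub> M) \<otimes>\<^bsub>H\<^esub> (\<alpha> \<otimes>\<^bsub>H\<^esub> \<alpha> \<oplus>\<^bsub>H\<^esub> \<delta> \<otimes>\<^bsub>H\<^esub> \<delta>) \<oplus>\<^bsub>H\<^esub> (M \<otimes>\<^bsub>H\<^esub> M) \<otimes>\<^bsub>H\<^esub> ((\<alpha> \<oplus>\<^bsub>H\<^esub> \<alpha>) \<otimes>\<^bsub>H\<^esub> \<delta>)"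
    by (simp add: H.l_distr H.r_distr H.m_ac H.a_ac)
  also have "(M \<otimes>\<^bsub>H\<^esub> M) \<otimes>\<^bsub>H\<^esub> ((\<alpha> \<oplus>\<^bsub>H\<^esub> \<alpha>) \<otimes>\<^bsub>H\<^esub> \<delta>) = P \<otimes>\<^bsub>H\<^esub> ((\<alpha> \<oplus>\<^bsub>H\<^esub> \<alpha>) \<otimes>\<^bsub>H\<^esub> (N \<otimes>\<^bsub>H\<^esub> \<delta>))"
    unfolding PN by (simp add: H.m_ac)
  finally have 1: "M \<otimes>\<^bsub>H\<^esub> (\<alpha> \<oplus>\<^bsub>H\<^esub> \<delta>) \<otimes>\<^bsub>H\<^esub> (M \<otimes>\<^bsub>H\<^esub> (\<alpha> \<oplus>\<^bsub>H\<^esub> \<delta>))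
      = (M \<otimes>\<^bsub>H\<^esub> M) \<otimes>\<^bsub>H\<^esub> (\<alpha> \<otimes>\<^bsub>H\<^esub> \<alpha> \<oplus>\<^bsub>H\<^esub> \<delta> \<otimes>\<^bsub>H\<^esub> \<delta>) \<oplus>\<^bsub>H\<^esub> P \<otimes>\<^bsub>H\<^esub> ((\<alpha> \<oplus>\<^bsub>H\<^esub> \<alpha>) \<otimes>\<^bsub>H\<^esub> (N \<otimes>\<^bsub>H\<^esub> \<delta>))" .
  \<comment> \<open>Second coordinates: the derivative of \<open>\<gamma> (Suc i)\<close>
    contributes the part with \<open>\<delta>\<close>, the derivative 1 of \<open>u (Suc i)\<close>
    the part with \<open>\<alpha>\<close>.\<close>
  have "(M \<otimes>\<^bsub>H\<^esub> M) \<otimes>\<^bsub>H\<^esub> (two \<otimes>\<^bsub>H\<^esub> (P' \<otimes>\<^bsub>H\<^esub> \<zeta>)) = two \<otimes>\<^bsub>H\<^esub> (P \<otimes>\<^bsub>H\<^esub> (N \<otimes>\<^bsub>H\<^esub> (P' \<otimes>\<^bsub>H\<^esub> \<zeta>)))"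
    unfolding PN by (simp add: H.m_ac)
  then have "(M \<otimes>\<^bsub>H\<^esub> M) \<otimes>\<^bsub>H\<^esub> (two \<otimes>\<^bsub>H\<^esub> (P' \<otimes>\<^bsub>H\<^esub> \<zeta>)) \<oplus>\<^bsub>H\<^esub> P \<otimes>\<^bsub>H\<^esub> (\<alpha> \<oplus>\<^bsub>H\<^esub> \<alpha>)
      = two \<otimes>\<^bsub>H\<^esub> (P \<otimes>\<^bsub>H\<^esub> \<delta>) \<oplus>\<^bsub>H\<^esub> P \<otimes>\<^bsub>H\<^esub> (\<alpha> \<oplus>\<^bsub>H\<^esub> \<alpha>)"
    unfolding N\<zeta> by simp
  also have "\<dots> = two \<otimes>\<^bsub>H\<^esub> (P \<otimes>\<^bsub>H\<^esub> (\<alpha> \<oplus>\<^bsub>H\<^esub> \<delta>))"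
    by (simp add: H.l_distr H.r_distr H.a_ac)
  finally have 2: "(M \<otimes>\<^bsub>H\<^esub> M) \<otimes>\<^bsub>H\<^esub> (two \<otimes>\<^bsub>H\<^esub> (P' \<otimes>\<^bsub>H\<^esub> \<zeta>)) \<oplus>\<^bsub>H\<^esub> P \<otimes>\<^bsub>H\<^esub> (\<alpha> \<oplus>\<^bsub>H\<^esub> \<alpha>)
      = two \<otimes>\<^bsub>H\<^esub> (P \<otimes>\<^bsub>H\<^esub> (\<alpha> \<oplus>\<^bsub>H\<^esub> \<delta>))" .
  show ?thesis
    unfolding T_pow MM P_def[symmetric] \<gamma>i \<gamma>Si u_def N_def[symmetric] \<delta>_def[symmetric]
    unfolding \<kappa>_def
    using 1 2 by (simp add: B_simps \<alpha>_def[symmetric])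
qed

text \<open>Both powers of \<open>T\<close> in \<open>\<gamma>_expand\<close> have positive
  exponent. For the second one this uses the full strength of \<open>m_ge\<close>.\<close>

lemma \<gamma>_in_TE: "\<exists>e\<in>E. \<gamma> i = T \<otimes>\<^bsub>B\<^esub> e"
proof -
  let ?x = "\<kappa> (a (Suc i) \<otimes> a (Suc i)) \<oplus>\<^bsub>B\<^esub> \<gamma> (Suc i)"
  let ?v = "\<kappa> (a (Suc i) \<oplus> a (Suc i)) \<otimes>\<^bsub>B\<^esub> u (Suc i)"
  have x: "?x \<in> E" by (intro E_ops E_gens) simp
  have v: "?v \<in> E" by (intro E_ops E_gens u_E) simp
  have car: "?x \<in> carrier B" "?v \<in> carrier B" using x v E_carrier by blast+
  obtain j where j: "2 * m i = Suc j" using m_ge[of i] by (cases "2 * m i") auto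
  obtain k where k: "m i - n i - 1 = Suc k" using m_ge[of i] by (cases "m i - n i - 1") auto
  have "\<gamma> i = T \<otimes>\<^bsub>B\<^esub> (T [^]\<^bsub>B\<^esub> j \<otimes>\<^bsub>B\<^esub> ?x \<oplus>\<^bsub>B\<^esub> T [^]\<^bsub>B\<^esub> k \<otimes>\<^bsub>B\<^esub> ?v)"
    unfolding \<gamma>_expand[of i] j k B.nat_pow_Suc using car
    by (simp only: B.r_distr B.m_assoc B.m_lcomm B.m_closed B.nat_pow_closed \<kappa>.hom_closed t_closed B.m_comm[of _ T])
  moreover have "T [^]\<^bsub>B\<^esub> j \<otimes>\<^bsub>B\<^esub> ?x \<oplus>\<^bsub>B\<^esub> T [^]\<^bsub>B\<^esub> k \<otimes>\<^bsub>B\<^esub> ?v \<in> E"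
    by (rule E_ops(2)[OF E_ops(1)[OF T_pow_E x] E_ops(1)[OF T_pow_E v]])
  ultimately show ?thesis by blast
qed

text \<open>On values this is w^2 = t^2 (z_0 - a_0)^2. On derivatives, 2 w = 2 t (z_0 - a_0) matches
  because \<open>n 0 = 0\<close>, so that z_0 - a_0 is t times the power of t in
  \<open>\<gamma> 0\<close> times z_1.\<close>

lemma y_square: "y \<otimes>\<^bsub>B\<^esub> y = T \<otimes>\<^bsub>B\<^esub> (T \<otimes>\<^bsub>B\<^esub> \<gamma> 0)"
proof -
  have "m 0 = Suc (m 0 - n 0 - 1)" using m_ge[of 0] n_0 by simp
  then have "\<tau> [^]\<^bsub>H\<^esub> m 0 = \<tau> [^]\<^bsub>H\<^esub> (m 0 - n 0 - 1) \<otimes>\<^bsub>H\<^esub> \<tau>" by (metis H.nat_pow_Suc)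
  then have d0: "d 0 = \<tau> \<otimes>\<^bsub>H\<^esub> (\<tau> [^]\<^bsub>H\<^esub> (m 0 - n 0 - 1) \<otimes>\<^bsub>H\<^esub> Z (Suc 0))"
    unfolding d_eq by (simp add: H.m_ac)
  define x where "x = \<tau> [^]\<^bsub>H\<^esub> (m 0 - n 0 - 1) \<otimes>\<^bsub>H\<^esub> Z (Suc 0)"
  have [simp]: "x \<in> carrier H" by (simp add: x_def)
  show ?thesis
    unfolding y_def w_eq \<gamma>_def \<kappa>_def d0 x_def[symmetric]
    by (simp add: B_simps H.m_ac H.l_distr H.r_distr)
qed

text \<open>Modulo \<open>T\<close> the elements \<open>\<gamma> i\<close> vanish and so does the
  square of \<open>y\<close>; hence only 1 and \<open>y\<close> survive as generators over
  \<open>A\<close>.\<close>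

lemma E_decomp:
  assumes "e \<in> E"
  shows "\<exists>\<alpha>\<in>carrier A. \<exists>\<beta>\<in>carrier A. \<exists>e'\<in>E. e = \<kappa> \<alpha> \<oplus>\<^bsub>B\<^esub> \<kappa> \<beta> \<otimes>\<^bsub>B\<^esub> y \<oplus>\<^bsub>B\<^esub> T \<otimes>\<^bsub>B\<^esub> e'"
  using assms[unfolded E_def]
proof (induction rule: generate_ring.induct)
  case one
  have "\<one>\<^bsub>B\<^esub> = \<kappa> \<one> \<oplus>\<^bsub>B\<^esub> \<kappa> \<zero> \<otimes>\<^bsub>B\<^esub> y \<oplus>\<^bsub>B\<^esub> T \<otimes>\<^bsub>B\<^esub> \<zero>\<^bsub>B\<^esub>" by simp
  then show ?case using E_ops(4) by blast
next
  case (incl h)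
  then consider x where "x \<in> carrier A" "h = \<kappa> x" | "h = y" | i where "h = \<gamma> i"
    by (auto simp: gens_def)
  then show ?case
  proof cases
    case 1
    then have "h = \<kappa> x \<oplus>\<^bsub>B\<^esub> \<kappa> \<zero> \<otimes>\<^bsub>B\<^esub> y \<oplus>\<^bsub>B\<^esub> T \<otimes>\<^bsub>B\<^esub> \<zero>\<^bsub>B\<^esub>" by simp
    then show ?thesis using 1 E_ops(4) by blast
  next
    case 2
    then have "h = \<kappa> \<zero> \<oplus>\<^bsub>B\<^esub> \<kappa> \<one> \<otimes>\<^bsub>B\<^esub> y \<oplus>\<^bsub>B\<^esub> T \<otimes>\<^bsub>B\<^esub> \<zero>\<^bsub>B\<^esub>" by simp
    then show ?thesis using E_ops(4) by blast
  next
    case 3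
    from \<gamma>_in_TE obtain e where e: "e \<in> E" "\<gamma> i = T \<otimes>\<^bsub>B\<^esub> e" by blast
    then have "h = \<kappa> \<zero> \<oplus>\<^bsub>B\<^esub> \<kappa> \<zero> \<otimes>\<^bsub>B\<^esub> y \<oplus>\<^bsub>B\<^esub> T \<otimes>\<^bsub>B\<^esub> e" using 3 E_carrier by simp
    then show ?thesis using e(1) by blast
  qed
next
  case (a_inv h)
  then obtain \<alpha> \<beta> e where *: "\<alpha> \<in> carrier A" "\<beta> \<in> carrier A" "e \<in> E"
    "h = \<kappa> \<alpha> \<oplus>\<^bsub>B\<^esub> \<kappa> \<beta> \<otimes>\<^bsub>B\<^esub> y \<oplus>\<^bsub>B\<^esub> T \<otimes>\<^bsub>B\<^esub> e" by blast
  then have "\<ominus>\<^bsub>B\<^esub> h = \<kappa> (\<ominus> \<alpha>) \<oplus>\<^bsub>B\<^esub> \<kappa> (\<ominus> \<beta>) \<otimes>\<^bsub>B\<^esub> y \<oplus>\<^bsub>B\<^esub> T \<otimes>\<^bsub>B\<^esub> (\<ominus>\<^bsub>B\<^esub> e)"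
    using E_carrier by (simp add: B.minus_add B.l_minus B.r_minus)
  then show ?case using * E_ops(3) a_inv_closed by blast
next
  case (eng_add h1 h2)
  then obtain \<alpha>1 \<beta>1 e1 \<alpha>2 \<beta>2 e2 where
    *: "\<alpha>1 \<in> carrier A" "\<beta>1 \<in> carrier A" "e1 \<in> E" "\<alpha>2 \<in> carrier A" "\<beta>2 \<in> carrier A" "e2 \<in> E"
    and h: "h1 = \<kappa> \<alpha>1 \<oplus>\<^bsub>B\<^esub> \<kappa> \<beta>1 \<otimes>\<^bsub>B\<^esub> y \<oplus>\<^bsub>B\<^esub> T \<otimes>\<^bsub>B\<^esub> e1"
      "h2 = \<kappa> \<alpha>2 \<oplus>\<^bsub>B\<^esub> \<kappa> \<beta>2 \<otimes>\<^bsub>B\<^esub> y \<oplus>\<^bsub>B\<^esub> T \<otimes>\<^bsub>B\<^esub> e2" by blast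
  have "h1 \<oplus>\<^bsub>B\<^esub> h2 = \<kappa> (\<alpha>1 \<oplus> \<alpha>2) \<oplus>\<^bsub>B\<^esub> \<kappa> (\<beta>1 \<oplus> \<beta>2) \<otimes>\<^bsub>B\<^esub> y \<oplus>\<^bsub>B\<^esub> T \<otimes>\<^bsub>B\<^esub> (e1 \<oplus>\<^bsub>B\<^esub> e2)"
    using * E_carrier by (simp add: h B.l_distr B.r_distr B.a_ac)
  then show ?case using * E_ops(2) a_closed by blast
next
  case (eng_mult h1 h2)
  then obtain \<alpha>1 \<beta>1 e1 \<alpha>2 \<beta>2 e2 where
    *: "\<alpha>1 \<in> carrier A" "\<beta>1 \<in> carrier A" "e1 \<in> E" "\<alpha>2 \<in> carrier A" "\<beta>2 \<in> carrier A" "e2 \<in> E"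
    and h: "h1 = \<kappa> \<alpha>1 \<oplus>\<^bsub>B\<^esub> \<kappa> \<beta>1 \<otimes>\<^bsub>B\<^esub> y \<oplus>\<^bsub>B\<^esub> T \<otimes>\<^bsub>B\<^esub> e1"
      "h2 = \<kappa> \<alpha>2 \<oplus>\<^bsub>B\<^esub> \<kappa> \<beta>2 \<otimes>\<^bsub>B\<^esub> y \<oplus>\<^bsub>B\<^esub> T \<otimes>\<^bsub>B\<^esub> e2" by blast
  let ?l1 = "\<kappa> \<alpha>1 \<oplus>\<^bsub>B\<^esub> \<kappa> \<beta>1 \<otimes>\<^bsub>B\<^esub> y"
  have h2E: "h2 \<in> E" using eng_mult.hyps(2) by (simp add: E_def)
  have l1E: "?l1 \<in> E" using * by (intro E_ops E_gens)
  \<comment> \<open>With linear parts l1 and l2 one has h1 h2 = l1 l2 + T (e1 h2 + l1 e2). The last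
    summand of \<open>?e\<close> comes from the term of l1 l2 containing the square of
    \<open>y\<close>, rewritten by \<open>y_square\<close>.\<close>
  let ?e = "e1 \<otimes>\<^bsub>B\<^esub> h2 \<oplus>\<^bsub>B\<^esub> ?l1 \<otimes>\<^bsub>B\<^esub> e2 \<oplus>\<^bsub>B\<^esub> \<kappa> (\<beta>1 \<otimes> \<beta>2) \<otimes>\<^bsub>B\<^esub> (T \<otimes>\<^bsub>B\<^esub> \<gamma> 0)"
  have e: "?e \<in> E" using * h2E l1E by (intro E_ops E_gens) auto
  have car: "h2 \<in> carrier B" "?l1 \<in> carrier B" "e1 \<in> carrier B" "e2 \<in> carrier B"
    using h2E l1E * E_carrier by blast+
  have "?l1 \<otimes>\<^bsub>B\<^esub> (\<kappa> \<alpha>2 \<oplus>\<^bsub>B\<^esub> \<kappa> \<beta>2 \<otimes>\<^bsub>B\<^esub> y)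
      = \<kappa> (\<alpha>1 \<otimes> \<alpha>2) \<oplus>\<^bsub>B\<^esub> \<kappa> (\<alpha>1 \<otimes> \<beta>2 \<oplus> \<beta>1 \<otimes> \<alpha>2) \<otimes>\<^bsub>B\<^esub> y \<oplus>\<^bsub>B\<^esub> \<kappa> (\<beta>1 \<otimes> \<beta>2) \<otimes>\<^bsub>B\<^esub> (y \<otimes>\<^bsub>B\<^esub> y)"
    using * by (simp add: B.l_distr B.r_distr B.m_ac B.a_ac)
  also have "\<kappa> (\<beta>1 \<otimes> \<beta>2) \<otimes>\<^bsub>B\<^esub> (y \<otimes>\<^bsub>B\<^esub> y) = T \<otimes>\<^bsub>B\<^esub> (\<kappa> (\<beta>1 \<otimes> \<beta>2) \<otimes>\<^bsub>B\<^esub> (T \<otimes>\<^bsub>B\<^esub> \<gamma> 0))"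
    using * by (simp add: y_square B.m_ac)
  finally have ll: "?l1 \<otimes>\<^bsub>B\<^esub> (\<kappa> \<alpha>2 \<oplus>\<^bsub>B\<^esub> \<kappa> \<beta>2 \<otimes>\<^bsub>B\<^esub> y)
      = \<kappa> (\<alpha>1 \<otimes> \<alpha>2) \<oplus>\<^bsub>B\<^esub> \<kappa> (\<alpha>1 \<otimes> \<beta>2 \<oplus> \<beta>1 \<otimes> \<alpha>2) \<otimes>\<^bsub>B\<^esub> y
        \<oplus>\<^bsub>B\<^esub> T \<otimes>\<^bsub>B\<^esub> (\<kappa> (\<beta>1 \<otimes> \<beta>2) \<otimes>\<^bsub>B\<^esub> (T \<otimes>\<^bsub>B\<^esub> \<gamma> 0))" .
  define l1 where "l1 = ?l1"
  define l2 where "l2 = \<kappa> \<alpha>2 \<oplus>\<^bsub>B\<^esub> \<kappa> \<beta>2 \<otimes>\<^bsub>B\<^esub> y"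
  have lcar: "l1 \<in> carrier B" "l2 \<in> carrier B" using * by (simp_all add: l1_def l2_def)
  have "h1 \<otimes>\<^bsub>B\<^esub> h2 = l1 \<otimes>\<^bsub>B\<^esub> l2 \<oplus>\<^bsub>B\<^esub> (T \<otimes>\<^bsub>B\<^esub> (e1 \<otimes>\<^bsub>B\<^esub> h2) \<oplus>\<^bsub>B\<^esub> T \<otimes>\<^bsub>B\<^esub> (l1 \<otimes>\<^bsub>B\<^esub> e2))"
  proof -
    have "(l1 \<oplus>\<^bsub>B\<^esub> T \<otimes>\<^bsub>B\<^esub> e1) \<otimes>\<^bsub>B\<^esub> h2 = l1 \<otimes>\<^bsub>B\<^esub> h2 \<oplus>\<^bsub>B\<^esub> T \<otimes>\<^bsub>B\<^esub> (e1 \<otimes>\<^bsub>B\<^esub> h2)"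
      using lcar car by (simp add: B.l_distr B.m_assoc)
    moreover have "l1 \<otimes>\<^bsub>B\<^esub> (l2 \<oplus>\<^bsub>B\<^esub> T \<otimes>\<^bsub>B\<^esub> e2) = l1 \<otimes>\<^bsub>B\<^esub> l2 \<oplus>\<^bsub>B\<^esub> T \<otimes>\<^bsub>B\<^esub> (l1 \<otimes>\<^bsub>B\<^esub> e2)"
      using lcar car by (simp add: B.r_distr B.m_lcomm)
    moreover have "h1 = l1 \<oplus>\<^bsub>B\<^esub> T \<otimes>\<^bsub>B\<^esub> e1" "h2 = l2 \<oplus>\<^bsub>B\<^esub> T \<otimes>\<^bsub>B\<^esub> e2"
      by (simp_all add: h l1_def l2_def)
    ultimately show ?thesis using lcar car by (simp add: B.a_ac)
  qed
  then have eq: "h1 \<otimes>\<^bsub>B\<^esub> h2 = \<kappa> (\<alpha>1 \<otimes> \<alpha>2) \<oplus>\<^bsub>B\<^esub> \<kappa> (\<alpha>1 \<otimes> \<beta>2 \<oplus> \<beta>1 \<otimes> \<alpha>2) \<otimes>\<^bsub>B\<^esub> y \<oplus>\<^bsub>B\<^esub> T \<otimes>\<^bsub>B\<^esub> ?e"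
    unfolding ll[folded l1_def l2_def] l1_def[symmetric]
    by (subst (asm) B.collect_multiples)
      (use lcar car * in \<open>auto simp del: \<kappa>.hom_mult \<kappa>.hom_add\<close>)
  show ?case
    by (rule bexI[of _ "\<alpha>1 \<otimes> \<alpha>2"], rule bexI[of _ "\<alpha>1 \<otimes> \<beta>2 \<oplus> \<beta>1 \<otimes> \<alpha>2"], rule bexI[of _ ?e])
      (rule eq e | simp add: *)+
qed

end

section \<open>The completion of $C_M$\<close>

context akizuki_construction
begin

section \<open>Single-valuedness of the derivative\<close>

definition rescale where "rescale e = (fst e, \<tau> \<otimes>\<^bsub>H\<^esub> snd e)"

abbreviation polys where "polys \<equiv> B.simple_extension (\<kappa> ` carrier A) (Z 0, \<one>\<^bsub>H\<^esub>)"

lemma \<kappa>_subring: "subring (\<kappa> ` carrier A) B"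
  by (rule \<kappa>.ring.img_is_subring[OF carrier_is_subring])

lemma Z_one_closed: "(Z 0, \<one>\<^bsub>H\<^esub>) \<in> carrier B" by (simp add: B_simps)

lemma polys_subring: "subring polys B"
  by (rule B.simple_extension_subring[OF \<kappa>_subring Z_one_closed])

lemma polys_ops:
  "e \<in> polys \<Longrightarrow> f \<in> polys \<Longrightarrow> e \<otimes>\<^bsub>B\<^esub> f \<in> polys"
  "e \<in> polys \<Longrightarrow> f \<in> polys \<Longrightarrow> e \<oplus>\<^bsub>B\<^esub> f \<in> polys"
  "e \<in> polys \<Longrightarrow> \<ominus>\<^bsub>B\<^esub> e \<in> polys" "e \<in> polys \<Longrightarrow> e \<in> carrier B"
  using subringE[OF polys_subring] by auto

lemma polys_gens:
  "x \<in> carrier A \<Longrightarrow> \<kappa> x \<in> polys" "(Z 0, \<one>\<^bsub>H\<^esub>) \<in> polys"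
  using B.simple_extension_incl[OF subringE(1)[OF \<kappa>_subring] Z_one_closed]
    B.simple_extension_mem[OF \<kappa>_subring Z_one_closed] by auto

lemma T_pow_polys: "T [^]\<^bsub>B\<^esub> (k::nat) \<in> polys"
  using polys_gens(1)[of "t [^] k"] by simp

text \<open>An element of \<open>polys\<close> has the form $(p(z), p'(z))$; transcendence of $z$ gives $p = 0$.\<close>
lemma polys_fst_zero:
  assumes e: "e \<in> polys" and 0: "fst e = \<zero>\<^bsub>H\<^esub>"
  shows "e = \<zero>\<^bsub>B\<^esub>"
proof -
  obtain p where p: "p \<in> carrier ((\<kappa> ` carrier A)[X]\<^bsub>B\<^esub>)" "e = B.eval p (Z 0, \<one>\<^bsub>H\<^esub>)"
    using e B.simple_extension_as_eval_img[OF subringE(1)[OF \<kappa>_subring] Z_one_closed] by auto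
  have eval: "H.eval (map fst p) (Z 0) = \<zero>\<^bsub>H\<^esub>"
    using fst.ring.eval_hom[OF \<kappa>_subring Z_one_closed p(1)] 0 p(2) by simp
  have poly: "map fst p \<in> carrier ((\<iota> ` carrier A)[X]\<^bsub>H\<^esub>)"
  proof -
    have poly: "p = [] \<or> set p \<subseteq> \<kappa> ` carrier A \<and> hd p \<noteq> \<zero>\<^bsub>B\<^esub>"
      using p(1) unfolding univ_poly_carrier[symmetric] polynomial_def .
    show ?thesis
    proof (cases "p = []")
      case False
      then have "set p \<subseteq> \<kappa> ` carrier A" "hd p \<noteq> \<zero>\<^bsub>B\<^esub>" using poly by auto
      moreover from this False have "hd p \<in> \<kappa> ` carrier A" using hd_in_set by blast
      \<comment> \<open>Transcendence speaks about polynomials with nonzero leading coefficient.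
        Passing to first coordinates keeps it nonzero, since the second coordinate of a constant is
        zero anyway.\<close>
      ultimately have "set (map fst p) \<subseteq> \<iota> ` carrier A" "hd (map fst p) \<noteq> \<zero>\<^bsub>H\<^esub>"
        using False by (auto simp: hd_map \<kappa>_def B_simps)
      then show ?thesis unfolding univ_poly_carrier[symmetric] polynomial_def by blast
    qed (simp add: univ_poly_carrier[symmetric] polynomial_def)
  qed
  have "map fst p = []"
    by (rule H.eval_transcendental[unfolded over_def, OF transcendental_Z poly eval])
  then show ?thesis using p(2) by simp
qed

lemma rescale_closed: "e \<in> carrier B \<Longrightarrow> rescale e \<in> carrier B"
  by (auto simp: rescale_def B_simps)

lemma rescale_hom:
  assumes "e \<in> carrier B" "f \<in> carrier B"
  shows "rescale (e \<otimes>\<^bsub>B\<^esub> f) = rescale e \<otimes>\<^bsub>B\<^esub> rescale f" "rescale (e \<oplus>\<^bsub>B\<^esub> f) = rescale e \<oplus>\<^bsub>B\<^esub> rescale f"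
    "rescale (\<ominus>\<^bsub>B\<^esub> e) = \<ominus>\<^bsub>B\<^esub> (rescale e)"
  using assms
  by (auto simp: rescale_def B_simps H.r_distr H.m_ac H.dual_numbers_a_inv H.r_minus)

text \<open>Clearing denominators gives t^(2 n_i) (z_i - a_i)^2 = (z - p)^2 with p in
  \<open>A\<close>, whose derivative by z is 2 (z - p). The pair is thus the square of (z - p,
  1).\<close>

lemma rescale_\<gamma>: "T [^]\<^bsub>B\<^esub> (2 * n i) \<otimes>\<^bsub>B\<^esub> rescale (\<gamma> i) \<in> polys"
proof -
  obtain p where p: "p \<in> carrier A" "\<tau> [^]\<^bsub>H\<^esub> n i \<otimes>\<^bsub>H\<^esub> d i = Z 0 \<ominus>\<^bsub>H\<^esub> \<iota> p"
    using d_shift by blast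
  define N where "N = \<tau> [^]\<^bsub>H\<^esub> n i"
  define P where "P = \<tau> [^]\<^bsub>H\<^esub> (m i - n i - 1)"
  define \<zeta> where "\<zeta> = Z (Suc i)"
  have car [simp]: "N \<in> carrier H" "P \<in> carrier H" "\<zeta> \<in> carrier H"
    by (simp_all add: N_def P_def \<zeta>_def)
  have NN: "\<tau> [^]\<^bsub>H\<^esub> (2 * n i) = N \<otimes>\<^bsub>H\<^esub> N"
    by (simp add: N_def H.nat_pow_mult mult_2)
  \<comment> \<open>The summand 1 is the factor \<open>\<tau>\<close> that \<open>rescale\<close>
    puts into the second coordinate.\<close>
  have "n i + (m i - n i - 1) + 1 = m i" using m_ge[of i] by simp
  then have "\<tau> [^]\<^bsub>H\<^esub> m i = N \<otimes>\<^bsub>H\<^esub> P \<otimes>\<^bsub>H\<^esub> \<tau>"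
    unfolding N_def P_def
    by (metis H.nat_pow_Suc H.nat_pow_mult Suc_eq_plus1 \<iota>.hom_closed t_closed)
  then have d: "d i = N \<otimes>\<^bsub>H\<^esub> P \<otimes>\<^bsub>H\<^esub> \<tau> \<otimes>\<^bsub>H\<^esub> \<zeta>" by (simp only: d_eq \<zeta>_def)
  let ?x = "N \<otimes>\<^bsub>H\<^esub> d i"
  have "T [^]\<^bsub>B\<^esub> (2 * n i) \<otimes>\<^bsub>B\<^esub> rescale (\<gamma> i) = (?x \<otimes>\<^bsub>H\<^esub> ?x, two \<otimes>\<^bsub>H\<^esub> ?x)"
    unfolding T_pow NN rescale_def \<gamma>_def P_def[symmetric] \<zeta>_def[symmetric] d
    by (simp add: B_simps H.m_ac H.l_distr H.r_distr)
  also have "\<dots> = (?x, \<one>\<^bsub>H\<^esub>) \<otimes>\<^bsub>B\<^esub> (?x, \<one>\<^bsub>H\<^esub>)"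
    by (simp add: B_simps H.l_distr)
  also have "(?x, \<one>\<^bsub>H\<^esub>) = (Z 0, \<one>\<^bsub>H\<^esub>) \<oplus>\<^bsub>B\<^esub> \<ominus>\<^bsub>B\<^esub> \<kappa> p"
    unfolding N_def p(2) using p(1) by (simp add: \<kappa>_def B_simps H.dual_numbers_a_inv a_minus_def)
  also have "\<dots> \<otimes>\<^bsub>B\<^esub> \<dots> \<in> polys" by (intro polys_ops polys_gens p)
  finally show ?thesis .
qed

text \<open>\<open>rescale\<close> passes from derivatives with respect to \<open>w = t(z - a\<^sub>0)\<close> to those with respect
  to \<open>z\<close>.\<close>
lemma E_scaled_polys:
  assumes "e \<in> E" shows "\<exists>N::nat. T [^]\<^bsub>B\<^esub> N \<otimes>\<^bsub>B\<^esub> rescale e \<in> polys"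
  using assms[unfolded E_def]
proof (induction rule: generate_ring.induct)
  case one
  have "T [^]\<^bsub>B\<^esub> (0::nat) \<otimes>\<^bsub>B\<^esub> rescale \<one>\<^bsub>B\<^esub> = \<kappa> \<one>"
    by (simp add: rescale_def B_simps \<kappa>_def)
  then show ?case using polys_gens(1)[OF one_closed] by metis
next
  case (incl h)
  then consider x where "x \<in> carrier A" "h = \<kappa> x" | "h = y" | i where "h = \<gamma> i"
    by (auto simp: gens_def)
  then show ?case
  proof cases
    case 1
    then have "T [^]\<^bsub>B\<^esub> (0::nat) \<otimes>\<^bsub>B\<^esub> rescale h = \<kappa> x"
      by (simp add: rescale_def B_simps \<kappa>_def)
    then show ?thesis using polys_gens(1)[OF 1(1)] by metis
  next
    case 2
    have "T [^]\<^bsub>B\<^esub> (0::nat) \<otimes>\<^bsub>B\<^esub> rescale h = T \<otimes>\<^bsub>B\<^esub> ((Z 0, \<one>\<^bsub>H\<^esub>) \<oplus>\<^bsub>B\<^esub> \<ominus>\<^bsub>B\<^esub> \<kappa> (a 0))"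
      unfolding 2 by (simp add: rescale_def B_simps \<kappa>_def y_def w_eq H.dual_numbers_a_inv a_minus_def)
    also have "\<dots> \<in> polys" by (intro polys_ops polys_gens) auto
    finally show ?thesis by blast
  next
    case 3
    then show ?thesis using rescale_\<gamma> by blast
  qed
next
  case (a_inv h)
  then obtain N :: nat where N: "T [^]\<^bsub>B\<^esub> N \<otimes>\<^bsub>B\<^esub> rescale h \<in> polys" by blast
  have h: "h \<in> carrier B" using a_inv.hyps E_carrier by (simp add: E_def)
  have "T [^]\<^bsub>B\<^esub> N \<otimes>\<^bsub>B\<^esub> rescale (\<ominus>\<^bsub>B\<^esub> h) = \<ominus>\<^bsub>B\<^esub> (T [^]\<^bsub>B\<^esub> N \<otimes>\<^bsub>B\<^esub> rescale h)"
    using h rescale_closed by (simp add: rescale_hom B.r_minus)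
  then show ?case using polys_ops(3)[OF N] by metis
next
  case (eng_add h1 h2)
  then obtain N M :: nat where N: "T [^]\<^bsub>B\<^esub> N \<otimes>\<^bsub>B\<^esub> rescale h1 \<in> polys"
    and M: "T [^]\<^bsub>B\<^esub> M \<otimes>\<^bsub>B\<^esub> rescale h2 \<in> polys" by blast
  have h: "h1 \<in> carrier B" "h2 \<in> carrier B" using eng_add.hyps E_carrier by (simp_all add: E_def)
  have "T [^]\<^bsub>B\<^esub> (M + N) \<otimes>\<^bsub>B\<^esub> rescale (h1 \<oplus>\<^bsub>B\<^esub> h2)
      = T [^]\<^bsub>B\<^esub> M \<otimes>\<^bsub>B\<^esub> (T [^]\<^bsub>B\<^esub> N \<otimes>\<^bsub>B\<^esub> rescale h1) \<oplus>\<^bsub>B\<^esub> T [^]\<^bsub>B\<^esub> N \<otimes>\<^bsub>B\<^esub> (T [^]\<^bsub>B\<^esub> M \<otimes>\<^bsub>B\<^esub> rescale h2)"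
    using h rescale_closed by (simp add: rescale_hom B.nat_pow_mult[symmetric] B.r_distr B.m_ac)
  also have "\<dots> \<in> polys"
    by (rule polys_ops(2)[OF polys_ops(1)[OF T_pow_polys N] polys_ops(1)[OF T_pow_polys M]])
  finally show ?case by blast
next
  case (eng_mult h1 h2)
  then obtain N M :: nat where N: "T [^]\<^bsub>B\<^esub> N \<otimes>\<^bsub>B\<^esub> rescale h1 \<in> polys"
    and M: "T [^]\<^bsub>B\<^esub> M \<otimes>\<^bsub>B\<^esub> rescale h2 \<in> polys" by blast
  have h: "h1 \<in> carrier B" "h2 \<in> carrier B" using eng_mult.hyps E_carrier by (simp_all add: E_def)
  have "T [^]\<^bsub>B\<^esub> (N + M) \<otimes>\<^bsub>B\<^esub> rescale (h1 \<otimes>\<^bsub>B\<^esub> h2)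
      = (T [^]\<^bsub>B\<^esub> N \<otimes>\<^bsub>B\<^esub> rescale h1) \<otimes>\<^bsub>B\<^esub> (T [^]\<^bsub>B\<^esub> M \<otimes>\<^bsub>B\<^esub> rescale h2)"
    using h rescale_closed by (simp add: rescale_hom B.nat_pow_mult[symmetric] B.m_ac)
  also have "\<dots> \<in> polys" by (rule polys_ops(1)[OF N M])
  finally show ?case by blast
qed

text \<open>A difference with value zero is a pair (0, g). Some power of \<open>T\<close> carries
  its rescaling into \<open>polys\<close>, where a pair with first coordinate zero is zero; and
  \<open>\<tau>\<close> is not a zero divisor in \<open>H\<close>, so g = 0.\<close>

lemma fst_inj: "inj_on fst E"
proof (rule inj_onI)
  fix e f assume e: "e \<in> E" and f: "f \<in> E" and eq: "fst e = fst f"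
  obtain g1 g2 where g: "e \<ominus>\<^bsub>B\<^esub> f = (g1, g2)" by fastforce
  have gE: "(g1, g2) \<in> E" using E_minus[OF e f] g by simp
  have car: "g1 \<in> carrier H" "g2 \<in> carrier H" using E_carrier[OF gE] by (auto simp: B_simps)
  have "fst (e \<ominus>\<^bsub>B\<^esub> f) = \<zero>\<^bsub>H\<^esub>"
    using E_carrier[OF e] E_carrier[OF f] eq by (simp add: a_minus_def H.r_neg)
  then have g1: "g1 = \<zero>\<^bsub>H\<^esub>" by (simp add: g)
  obtain N :: nat where N: "T [^]\<^bsub>B\<^esub> N \<otimes>\<^bsub>B\<^esub> rescale (g1, g2) \<in> polys"
    using E_scaled_polys[OF gE] by blast
  have eq: "T [^]\<^bsub>B\<^esub> N \<otimes>\<^bsub>B\<^esub> rescale (g1, g2) = (\<zero>\<^bsub>H\<^esub>, \<tau> [^]\<^bsub>H\<^esub> N \<otimes>\<^bsub>H\<^esub> (\<tau> \<otimes>\<^bsub>H\<^esub> g2))"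
    unfolding T_pow using car by (simp add: rescale_def g1 B_simps)
  have "(\<zero>\<^bsub>H\<^esub>, \<tau> [^]\<^bsub>H\<^esub> N \<otimes>\<^bsub>H\<^esub> (\<tau> \<otimes>\<^bsub>H\<^esub> g2)) = \<zero>\<^bsub>B\<^esub>"
    using polys_fst_zero[OF N] by (simp add: eq)
  then have "\<tau> [^]\<^bsub>H\<^esub> N \<otimes>\<^bsub>H\<^esub> (\<tau> \<otimes>\<^bsub>H\<^esub> g2) = \<zero>\<^bsub>H\<^esub>" by (simp add: B_simps)
  then have "g2 = \<zero>\<^bsub>H\<^esub>"
    using \<tau>_pow_eq_zero[of "\<tau> \<otimes>\<^bsub>H\<^esub> g2" N] \<tau>_eq_zero[OF car(2)] car by simp
  then have "e \<ominus>\<^bsub>B\<^esub> f = \<zero>\<^bsub>B\<^esub>" by (simp add: g g1 B_simps)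
  then show "e = f" using E_carrier[OF e] E_carrier[OF f] by simp
qed

section \<open>The filtration of the dual numbers: density, completeness, separation\<close>

text \<open>The powers of the maximal ideal \<open>(t, \<epsilon>)\<close> of \<open>B\<close>; for \<open>k = 0\<close> the truncated subtraction
  gives the unit ideal.\<close>
definition J where "J k = V k \<times> V (k - 1)"

lemma J_ideal: "ideal (J k) B"
proof (rule idealI[OF B.ring_axioms])
  show "subgroup (J k) (add_monoid B)"
  proof (rule B.add.subgroupI)
    show "J k \<subseteq> carrier B" using V.Icarr by (auto simp: J_def B_simps)
    show "J k \<noteq> {}"
      using V.zero_closed[of k] V.zero_closed[of "k - 1"] unfolding J_def by blast
    fix x assume "x \<in> J k"
    then show "\<ominus>\<^bsub>B\<^esub> x \<in> J k"
      using V.Icarr V.a_inv_closed by (auto simp: J_def H.dual_numbers_a_inv)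
    fix x' assume "x' \<in> J k"
    with \<open>x \<in> J k\<close> show "x \<oplus>\<^bsub>B\<^esub> x' \<in> J k"
      using V.a_closed by (auto simp: J_def B_simps)
  qed
  fix b x assume b: "x \<in> J k" "b \<in> carrier B"
  then obtain f g p q where *: "x = (f, g)" "b = (p, q)" "f \<in> V k" "g \<in> V (k - 1)"
    "p \<in> carrier H" "q \<in> carrier H" by (auto simp: J_def B_simps)
  \<comment> \<open>The second coordinate of the product contains q f, where q is arbitrary.\<close>
  moreover have "f \<in> V (k - 1)" using *(3) V_antimono[of "k - 1" k] by auto
  ultimately show 1: "b \<otimes>\<^bsub>B\<^esub> x \<in> J k"
    using V.a_closed V.I_l_closed by (simp add: J_def B_simps)
  have "x \<in> carrier B" using * V.Icarr by (simp add: B_simps)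
  then show "x \<otimes>\<^bsub>B\<^esub> b \<in> J k" using 1 B.m_comm b(2) by simp
qed

sublocale J: ideal "J k" B for k by (rule J_ideal)

lemma J_Suc_subset: "J (Suc k) \<subseteq> J k"
  using V_Suc_subset[of k] V_antimono[of "k - 1" k] by (auto simp: J_def)

lemma J_1_iff: "x \<in> J 1 \<longleftrightarrow> x \<in> carrier B \<and> fst x \<in> V 1"
  using V.Icarr by (cases x) (auto simp: J_def V_0 B_simps)

lemma J_mult: "x \<in> J k \<Longrightarrow> v \<in> J 1 \<Longrightarrow> x \<otimes>\<^bsub>B\<^esub> v \<in> J (Suc k)"
proof -
  assume "x \<in> J k" "v \<in> J 1"
  then obtain f g p q where *: "x = (f, g)" "v = (p, q)" "f \<in> V k" "g \<in> V (k - 1)"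
    "p \<in> V 1" "q \<in> carrier H" by (auto simp: J_def V_0)
  \<comment> \<open>Only an inclusion is available uniformly: for k = 0 the truncated exponent makes
    \<open>k - 1 + 1\<close> equal to 1.\<close>
  have "g \<otimes>\<^bsub>H\<^esub> p \<in> V k"
  proof -
    have "V (k - 1 + 1) \<subseteq> V k" by (rule V_antimono) simp
    then show ?thesis using V_mult[OF *(4,5)] by blast
  qed
  then show ?thesis
    using * V_mult[OF *(3,5)] V.I_r_closed[OF *(3,6)] V.a_closed by (simp add: J_def B_simps)
qed

text \<open>Linear elements \<alpha> + \<beta> y suffice. As \<open>y\<close> has derivative 1,
  \<beta> is chosen to approximate the second coordinate, and \<alpha> then approximates the first
  one corrected by \<beta> w.\<close>

lemma E_dense:
  assumes "b \<in> carrier B"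
  shows "\<exists>e\<in>E. e \<ominus>\<^bsub>B\<^esub> b \<in> J k"
proof -
  obtain f g where b: "b = (f, g)" "f \<in> carrier H" "g \<in> carrier H"
    using assms by (auto simp: B_simps)
  obtain \<beta> where \<beta>: "\<beta> \<in> carrier A" "g \<ominus>\<^bsub>H\<^esub> \<iota> \<beta> \<in> V k" by (rule H_approx[OF b(3)])
  have "f \<ominus>\<^bsub>H\<^esub> \<iota> \<beta> \<otimes>\<^bsub>H\<^esub> w \<in> carrier H" using b \<beta> by simp
  then obtain \<alpha> where \<alpha>: "\<alpha> \<in> carrier A" "f \<ominus>\<^bsub>H\<^esub> \<iota> \<beta> \<otimes>\<^bsub>H\<^esub> w \<ominus>\<^bsub>H\<^esub> \<iota> \<alpha> \<in> V k"
    by (rule H_approx)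
  let ?e = "\<kappa> \<alpha> \<oplus>\<^bsub>B\<^esub> \<kappa> \<beta> \<otimes>\<^bsub>B\<^esub> y"
  have e: "?e = (\<iota> \<alpha> \<oplus>\<^bsub>H\<^esub> \<iota> \<beta> \<otimes>\<^bsub>H\<^esub> w, \<iota> \<beta>)"
    using \<alpha>(1) \<beta>(1) by (simp add: \<kappa>_def y_def B_simps)
  have "b \<ominus>\<^bsub>B\<^esub> ?e = (f \<ominus>\<^bsub>H\<^esub> \<iota> \<beta> \<otimes>\<^bsub>H\<^esub> w \<ominus>\<^bsub>H\<^esub> \<iota> \<alpha>, g \<ominus>\<^bsub>H\<^esub> \<iota> \<beta>)"
    unfolding e b(1) using b \<alpha>(1) \<beta>(1)
    by (simp add: H.dual_numbers_minus) (simp add: a_minus_def H.minus_add H.a_ac)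
  then have "b \<ominus>\<^bsub>B\<^esub> ?e \<in> J k"
    using \<alpha>(2) \<beta>(2) V_antimono[of "k - 1" k] by (auto simp: J_def)
  then have "\<ominus>\<^bsub>B\<^esub> (b \<ominus>\<^bsub>B\<^esub> ?e) \<in> J k" by (rule J.a_inv_closed)
  moreover have "\<ominus>\<^bsub>B\<^esub> (b \<ominus>\<^bsub>B\<^esub> ?e) = ?e \<ominus>\<^bsub>B\<^esub> b"
  proof -
    have "\<ominus>\<^bsub>B\<^esub> (b \<ominus>\<^bsub>B\<^esub> x) = x \<ominus>\<^bsub>B\<^esub> b" if "x \<in> carrier B" for x
      using that assms by (simp add: a_minus_def B.minus_add B.a_comm)
    then show ?thesis using \<alpha>(1) \<beta>(1) by simp
  qed
  moreover have "?e \<in> E" using \<alpha>(1) \<beta>(1) by (intro E_ops E_gens)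
  ultimately show ?thesis by metis
qed

lemma J_complete:
  assumes x: "\<And>k. x k \<in> carrier B" and cauchy: "\<And>k. x (Suc k) \<ominus>\<^bsub>B\<^esub> x k \<in> J k"
  shows "\<exists>b\<in>carrier B. \<forall>k. x k \<ominus>\<^bsub>B\<^esub> b \<in> J k"
proof -
  define f where "f k = fst (x k)" for k
  \<comment> \<open>The second coordinates converge one order more slowly, so their sequence is
    shifted by one before completeness of \<open>H\<close> is applied.\<close>
  define g where "g k = snd (x (Suc k))" for k
  have car: "f k \<in> carrier H" "g k \<in> carrier H" for k
    using x[of k] x[of "Suc k"] by (auto simp: f_def g_def B_simps)
  have diff: "fst (x (Suc k)) \<ominus>\<^bsub>H\<^esub> fst (x k) \<in> V k \<and> snd (x (Suc k)) \<ominus>\<^bsub>H\<^esub> snd (x k) \<in> V (k - 1)" for k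
    using cauchy[of k] x[of k] x[of "Suc k"]
    by (cases "x k"; cases "x (Suc k)") (simp add: B_simps H.dual_numbers_minus J_def)
  have "f (Suc k) \<ominus>\<^bsub>H\<^esub> f k \<in> V k" for k using diff[of k] by (simp add: f_def)
  with car(1) obtain p where p: "p \<in> carrier H" "\<And>k. f k \<ominus>\<^bsub>H\<^esub> p \<in> V k"
    by (rule H_complete[of f]) (rule that)
  have "g (Suc k) \<ominus>\<^bsub>H\<^esub> g k \<in> V k" for k using diff[of "Suc k"] by (simp add: g_def)
  with car(2) obtain q where q: "q \<in> carrier H" "\<And>k. g k \<ominus>\<^bsub>H\<^esub> q \<in> V k"
    by (rule H_complete[of g]) (rule that)
  have "x k \<ominus>\<^bsub>B\<^esub> (p, q) \<in> J k" for k
  proof -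
    have s: "snd (x k) \<in> carrier H" using x[of k] by (auto simp: B_simps)
    have "snd (x k) \<ominus>\<^bsub>H\<^esub> q \<in> V (k - 1)"
      using q(2)[of "k - 1"] s q(1) by (cases k) (simp_all add: g_def V_0)
    moreover have "x k \<ominus>\<^bsub>B\<^esub> (p, q) = (f k \<ominus>\<^bsub>H\<^esub> p, snd (x k) \<ominus>\<^bsub>H\<^esub> q)"
      using x[of k] p(1) q(1) by (cases "x k") (simp add: B_simps H.dual_numbers_minus f_def)
    ultimately show ?thesis using p(2) by (simp add: J_def)
  qed
  then show ?thesis using p(1) q(1) by (intro bexI[of _ "(p, q)"]) (auto simp: B_simps)
qed

lemma J_separated:
  assumes "b \<in> carrier B" "\<And>k. b \<in> J k"
  shows "b = \<zero>\<^bsub>B\<^esub>"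
proof -
  obtain f g where b: "b = (f, g)" "f \<in> carrier H" "g \<in> carrier H"
    using assms(1) by (auto simp: B_simps)
  have "f \<in> V k" "g \<in> V k" for k
    using assms(2)[of k] assms(2)[of "Suc k"] by (auto simp: b J_def)
  then have "f = \<zero>\<^bsub>H\<^esub>" "g = \<zero>\<^bsub>H\<^esub>"
    using H_ext_V[of f "\<zero>\<^bsub>H\<^esub>"] H_ext_V[of g "\<zero>\<^bsub>H\<^esub>"] b by (simp_all add: a_minus_def)
  then show ?thesis by (simp add: b B_simps)
qed

section \<open>Divisibility by t inside \<open>E\<close>\<close>

lemma B_elem: "b \<in> carrier B \<Longrightarrow> \<exists>f g. b = (f, g) \<and> f \<in> carrier H \<and> g \<in> carrier H"
  by (auto simp: B_simps)

lemma \<kappa>_divisible: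
  assumes "\<alpha> \<in> carrier A" "\<iota> \<alpha> \<in> V 1"
  obtains \<alpha>' where "\<alpha>' \<in> carrier A" "\<kappa> \<alpha> = T \<otimes>\<^bsub>B\<^esub> \<kappa> \<alpha>'"
proof -
  have "\<alpha> \<in> PIdl t" using \<iota>_V_iff[OF assms(1), of 1] assms by simp
  then obtain \<alpha>' where "\<alpha>' \<in> carrier A" "\<alpha> = \<alpha>' \<otimes> t" by (auto simp: mem_cgenideal_iff)
  then show ?thesis using that[of \<alpha>'] by (simp add: B.m_comm)
qed

lemma decomp_components:
  assumes "\<alpha> \<in> carrier A" "\<beta> \<in> carrier A" "e' \<in> E"
  shows "fst (\<kappa> \<alpha> \<oplus>\<^bsub>B\<^esub> \<kappa> \<beta> \<otimes>\<^bsub>B\<^esub> y \<oplus>\<^bsub>B\<^esub> T \<otimes>\<^bsub>B\<^esub> e') = \<iota> \<alpha> \<oplus>\<^bsub>H\<^esub> (\<iota> \<beta> \<otimes>\<^bsub>H\<^esub> w \<oplus>\<^bsub>H\<^esub> \<tau> \<otimes>\<^bsub>H\<^esub> fst e')"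
    "snd (\<kappa> \<alpha> \<oplus>\<^bsub>B\<^esub> \<kappa> \<beta> \<otimes>\<^bsub>B\<^esub> y \<oplus>\<^bsub>B\<^esub> T \<otimes>\<^bsub>B\<^esub> e') = \<iota> \<beta> \<oplus>\<^bsub>H\<^esub> \<tau> \<otimes>\<^bsub>H\<^esub> snd e'"
  using assms E_carrier[OF assms(3)]
  by (cases e'; simp add: \<kappa>_def y_def B_simps H.a_assoc)+

lemma V_1_left:
  assumes "x \<oplus>\<^bsub>H\<^esub> v \<in> V 1" "v \<in> V 1" "x \<in> carrier H"
  shows "x \<in> V 1"
proof -
  have "(x \<oplus>\<^bsub>H\<^esub> v) \<ominus>\<^bsub>H\<^esub> v \<in> V 1" by (rule V.I_minus_closed[OF assms(1,2)])
  moreover have "(x \<oplus>\<^bsub>H\<^esub> v) \<ominus>\<^bsub>H\<^esub> v = x"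
    using assms(3) V.Icarr[OF assms(2)] by (simp add: a_minus_def H.a_assoc H.r_neg)
  ultimately show ?thesis by simp
qed

lemma w_V_1: "w \<in> V 1"
  unfolding w_eq by (rule V.I_r_closed[OF \<tau>_V_1 d_closed])

text \<open>Both w and \<open>\<tau>\<close> vanish modulo t, so the value of e is congruent to
  \<alpha>.\<close>

lemma E_V_1:
  assumes e: "e = \<kappa> \<alpha> \<oplus>\<^bsub>B\<^esub> \<kappa> \<beta> \<otimes>\<^bsub>B\<^esub> y \<oplus>\<^bsub>B\<^esub> T \<otimes>\<^bsub>B\<^esub> e'" "fst e \<in> V 1"
    and car: "\<alpha> \<in> carrier A" "\<beta> \<in> carrier A" "e' \<in> E"
  shows "\<iota> \<alpha> \<in> V 1"
proof (rule V_1_left)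
  show "\<iota> \<alpha> \<oplus>\<^bsub>H\<^esub> (\<iota> \<beta> \<otimes>\<^bsub>H\<^esub> w \<oplus>\<^bsub>H\<^esub> \<tau> \<otimes>\<^bsub>H\<^esub> fst e') \<in> V 1"
    using e(2) unfolding e(1) decomp_components(1)[OF car] .
  show "\<iota> \<beta> \<otimes>\<^bsub>H\<^esub> w \<oplus>\<^bsub>H\<^esub> \<tau> \<otimes>\<^bsub>H\<^esub> fst e' \<in> V 1"
    using car E_carrier[OF car(3)] V.I_l_closed[OF w_V_1] V.I_r_closed[OF \<tau>_V_1]
    by (intro V.a_closed) auto
qed (use car in simp)

text \<open>If both coordinates of \<alpha> + \<beta> y + T e' vanish modulo t, then t divides
  \<alpha> (first coordinate) and \<beta> (second), so \<open>T\<close> splits off within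
  \<open>E\<close>; cancelling \<open>\<tau>\<close> lowers the order by one. Order at least 2 is
  essential: \<open>y\<close> lies in \<open>J 1\<close>, but its second coordinate 1 is not a
  multiple of \<open>\<tau>\<close>.\<close>

lemma E_divide:
  assumes e: "e \<in> E" "e \<in> J (Suc (Suc k))"
  shows "\<exists>e'\<in>E. e = T \<otimes>\<^bsub>B\<^esub> e' \<and> e' \<in> J (Suc k)"
proof -
  obtain \<alpha> \<beta> e' where car: "\<alpha> \<in> carrier A" "\<beta> \<in> carrier A" "e' \<in> E"
    and eq: "e = \<kappa> \<alpha> \<oplus>\<^bsub>B\<^esub> \<kappa> \<beta> \<otimes>\<^bsub>B\<^esub> y \<oplus>\<^bsub>B\<^esub> T \<otimes>\<^bsub>B\<^esub> e'"
    using E_decomp[OF e(1)] by blast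
  have e'B: "e' \<in> carrier B" by (rule E_carrier[OF car(3)])
  have "fst e \<in> V (Suc (Suc k))" "snd e \<in> V (Suc k)"
    using e(2) by (auto simp: J_def)
  then have V1: "fst e \<in> V 1" "snd e \<in> V 1"
    using V_antimono[of 1 "Suc (Suc k)"] V_antimono[of 1 "Suc k"] by auto
  have "\<iota> \<alpha> \<in> V 1" by (rule E_V_1[OF eq V1(1) car])
  then obtain \<alpha>' where \<alpha>': "\<alpha>' \<in> carrier A" "\<kappa> \<alpha> = T \<otimes>\<^bsub>B\<^esub> \<kappa> \<alpha>'"
    by (rule \<kappa>_divisible[OF car(1)]) (rule that)
  have "\<iota> \<beta> \<in> V 1"
  proof (rule V_1_left)
    show "\<iota> \<beta> \<oplus>\<^bsub>H\<^esub> \<tau> \<otimes>\<^bsub>H\<^esub> snd e' \<in> V 1" 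
      using V1(2) unfolding eq decomp_components(2)[OF car] .
    show "\<tau> \<otimes>\<^bsub>H\<^esub> snd e' \<in> V 1" using V.I_r_closed[OF \<tau>_V_1] e'B by (auto simp: B_simps)
  qed (use car in simp)
  then obtain \<beta>' where \<beta>': "\<beta>' \<in> carrier A" "\<kappa> \<beta> = T \<otimes>\<^bsub>B\<^esub> \<kappa> \<beta>'"
    by (rule \<kappa>_divisible[OF car(2)]) (rule that)
  let ?e = "\<kappa> \<alpha>' \<oplus>\<^bsub>B\<^esub> \<kappa> \<beta>' \<otimes>\<^bsub>B\<^esub> y \<oplus>\<^bsub>B\<^esub> e'"
  have E: "?e \<in> E" using \<alpha>'(1) \<beta>'(1) car(3) by (intro E_ops E_gens)
  have "e = T \<otimes>\<^bsub>B\<^esub> ?e"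
    unfolding eq \<alpha>'(2) \<beta>'(2) using \<alpha>'(1) \<beta>'(1) e'B by (simp add: B.r_distr B.m_assoc)
  moreover have "?e \<in> J (Suc k)"
  proof -
    obtain f g where fg: "?e = (f, g)" "f \<in> carrier H" "g \<in> carrier H"
      using B_elem[OF E_carrier[OF E]] by blast
    have "e = (\<tau> \<otimes>\<^bsub>H\<^esub> f, \<tau> \<otimes>\<^bsub>H\<^esub> g)"
      unfolding \<open>e = T \<otimes>\<^bsub>B\<^esub> ?e\<close> fg(1) using fg(2,3) by (simp add: \<kappa>_def B_simps)
    then have *: "\<tau> \<otimes>\<^bsub>H\<^esub> f \<in> V (Suc (Suc k))" "\<tau> \<otimes>\<^bsub>H\<^esub> g \<in> V (Suc k)"
      using e(2) by (auto simp: J_def)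
    show ?thesis
      unfolding fg(1) using \<tau>_cancel[OF fg(2) *(1)] \<tau>_cancel[OF fg(3) *(2)] by (simp add: J_def)
  qed
  ultimately show ?thesis using E by blast
qed

section \<open>The ring C, the ideal M and the localization\<close>

abbreviation C where "C \<equiv> akizuki_ring A t a n"
abbreviation M where "M \<equiv> akizuki_ideal A t a n"

lemma C_eq: "C = H\<lparr>carrier := fst ` E\<rparr>"
  using fst_E by (simp add: akizuki_ring_def)

lemma C_subring: "subring (fst ` E) H"
  by (rule fst.ring.img_is_subring[OF E_subring])

lemma C_cring: "cring C"
  unfolding C_eq using H.subcringI'[OF C_subring] H.subcring_iff[OF subringE(1)[OF C_subring]] by simp

lemma C_carrier: "c \<in> carrier C \<Longrightarrow> c \<in> carrier H"
  using subringE(1)[OF C_subring] by (auto simp: C_eq)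

text \<open>An element of C is \<alpha> + \<beta> w + t c' by \<open>E_decomp\<close>; if it
  vanishes modulo t, then t divides \<alpha>, and t and w generate it. Membership in M is thus
  decided in \<open>H\<close>, and elements of C outside M are units of \<open>H\<close>.\<close>

lemma M_eq: "M = {c \<in> carrier C. c \<in> V 1}"
proof -
  interpret C: cring C by (rule C_cring)
  have gens: "\<tau> \<in> carrier C" "w \<in> carrier C"
    using E_gens(1)[OF t_closed] E_gens(2) by (force simp: C_eq \<kappa>_def y_def)+
  have id: "ideal {c \<in> carrier C. c \<in> V 1} C"
  proof -
    have "id \<in> ring_hom C H"
      using C_carrier by (intro ring_hom_memI) (simp_all add: C_eq)
    then interpret id: ring_hom_cring C H id by unfold_locales
    show ?thesis using id.ring.ideal_vimage[OF V_ideal[of 1]] by simp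
  qed
  show ?thesis
  proof
    show "M \<subseteq> {c \<in> carrier C. c \<in> V 1}"
      unfolding akizuki_ideal_def
      by (rule C.genideal_minimal[OF id]) (use gens \<tau>_V_1 w_V_1 in auto)
    interpret M: ideal M C
      unfolding akizuki_ideal_def by (rule C.genideal_ideal) (use gens in auto)
    have M_gens: "\<tau> \<in> M" "w \<in> M"
      unfolding akizuki_ideal_def using C.genideal_self[of "{\<tau>, w}"] gens by auto
    show "{c \<in> carrier C. c \<in> V 1} \<subseteq> M"
    proof
      fix c assume "c \<in> {c \<in> carrier C. c \<in> V 1}"
      then obtain e where e: "e \<in> E" "c = fst e" "fst e \<in> V 1" by (auto simp: C_eq)
      obtain \<alpha> \<beta> e' where car: "\<alpha> \<in> carrier A" "\<beta> \<in> carrier A" "e' \<in> E"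
        and eq: "e = \<kappa> \<alpha> \<oplus>\<^bsub>B\<^esub> \<kappa> \<beta> \<otimes>\<^bsub>B\<^esub> y \<oplus>\<^bsub>B\<^esub> T \<otimes>\<^bsub>B\<^esub> e'"
        using E_decomp[OF e(1)] by blast
      have "\<iota> \<alpha> \<in> V 1" by (rule E_V_1[OF eq e(3) car])
      then obtain \<alpha>' where \<alpha>': "\<alpha>' \<in> carrier A" "\<kappa> \<alpha> = T \<otimes>\<^bsub>B\<^esub> \<kappa> \<alpha>'"
        by (rule \<kappa>_divisible[OF car(1)]) (rule that)
      have inC: "\<iota> x \<in> carrier C" if "x \<in> carrier A" for x
        using E_gens(1)[OF that] by (force simp: C_eq \<kappa>_def)
      have e'C: "fst e' \<in> carrier C" using car(3) by (simp add: C_eq)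
      have "\<iota> \<alpha> = \<tau> \<otimes>\<^bsub>H\<^esub> \<iota> \<alpha>'" using \<alpha>' by (simp add: \<kappa>_def B_simps)
      then have "c = \<tau> \<otimes>\<^bsub>C\<^esub> \<iota> \<alpha>' \<oplus>\<^bsub>C\<^esub> (\<iota> \<beta> \<otimes>\<^bsub>C\<^esub> w \<oplus>\<^bsub>C\<^esub> \<tau> \<otimes>\<^bsub>C\<^esub> fst e')"
        unfolding e(2) eq decomp_components(1)[OF car] by (simp add: C_eq)
      also have "\<dots> \<in> M"
        by (intro M.a_closed M.I_r_closed[OF M_gens(1)] M.I_l_closed[OF M_gens(2)] inC \<alpha>' car e'C)
      finally show "c \<in> M" .
    qed
  qed
qed

text \<open>The criterion \<open>adic_completion_iso\<close> applies to the map \<open>G\<close>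
  from the localization to \<open>B\<close>. Its hypotheses on \<open>B\<close> are already
  available, and density follows from that of \<open>E\<close>; the main work is \<open>pow\<close>,
  the comparison of the powers of the maximal ideal with the filtration \<open>J\<close>.\<close>

theorem completion_iso_dual_numbers:
  "adic_completion (akizuki_local_ring A t a n) (akizuki_max_ideal A t a n) \<simeq> B"
proof -
  interpret C: cring C by (rule C_cring)
  define S where "S = carrier C - M"
  have S_iff: "s \<in> S \<longleftrightarrow> s \<in> carrier C \<and> s \<notin> V 1" for s by (auto simp: S_def M_eq)
  \<comment> \<open>This is the map sending an element of C to the pair of its value and its
    derivative.\<close>
  define j where "j = inv_into E fst"
  have jE: "j c \<in> E" "fst (j c) = c" if "c \<in> carrier C" for c
    using that by (simp_all add: j_def C_eq inv_into_into f_inv_into_f)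
  have j_fst: "j (fst e) = e" if "e \<in> E" for e
    using that fst_inj by (simp add: j_def)
  have "fst \<in> ring_iso (B\<lparr>carrier := E\<rparr>) C"
    using fst_inj E_carrier fst.homh
    by (auto simp: ring_iso_def bij_betw_def C_eq ring_hom_def)
  from ring_iso_set_sym[OF B.subring_is_ring[OF E_subring] this]
  have j_iso: "j \<in> ring_iso C (B\<lparr>carrier := E\<rparr>)" by (simp add: j_def)
  have j_closed: "j c \<in> carrier B" if "c \<in> carrier C" for c
    using E_carrier[OF jE(1)[OF that]] .
  have j_hom: "j \<in> ring_hom C B"
    using j_closed ring_iso_memE[OF j_iso] by (intro ring_hom_memI) simp_all
  have j_inj: "inj_on j (carrier C)"
    using j_iso by (simp add: ring_iso_def bij_betw_def)
  interpret j: ring_hom_cring C B j by unfold_locales (rule j_hom)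
  have S_units: "s \<in> Units H" if "s \<in> S" for s
    using that H_Units C_carrier by (simp add: S_iff)
  have S_mult: "s \<otimes>\<^bsub>C\<^esub> u \<in> S" if "s \<in> S" "u \<in> S" for s u
  proof -
    have U: "s \<otimes>\<^bsub>H\<^esub> u \<in> Units H" using that S_units by simp
    have "s \<otimes>\<^bsub>H\<^esub> u \<notin> V 1"
    proof
      assume "s \<otimes>\<^bsub>H\<^esub> u \<in> V 1"
      from V.I_l_closed[OF this, of "inv\<^bsub>H\<^esub> (s \<otimes>\<^bsub>H\<^esub> u)"] U have "\<one>\<^bsub>H\<^esub> \<in> V 1" by simp
      then show False using H_one_notin by simp
    qed
    moreover have "s \<otimes>\<^bsub>C\<^esub> u \<in> carrier C" using that by (simp add: S_iff)
    ultimately show ?thesis by (simp add: S_iff) (simp add: C_eq)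
  qed
  have S_one: "\<one>\<^bsub>C\<^esub> \<in> S" using H_one_notin by (simp add: S_iff) (simp add: C_eq)
  have SC: "S \<subseteq> carrier C" by (auto simp: S_def)
  have j_units: "j s \<in> Units B" if "s \<in> S" for s
  proof -
    have s: "s \<in> carrier C" using that SC by blast
    have "j s = (s, snd (j s))" using jE(2)[OF s] by (metis prod.collapse)
    moreover have "snd (j s) \<in> carrier H" using E_carrier[OF jE(1)[OF s]] by (auto simp: B_simps)
    ultimately show ?thesis using H.dual_numbers_Units[OF S_units[OF that]] by metis
  qed
  let ?R = "localization C S"
  let ?I = "akizuki_max_ideal A t a n"
  have R_eq: "akizuki_local_ring A t a n = ?R" by (simp add: akizuki_local_ring_def S_def)
  obtain G where R: "cring ?R" and G: "G \<in> ring_hom ?R B" and "inj_on G (carrier ?R)"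
    and R_car: "carrier ?R = {loc_frac C S c s | c s. c \<in> carrier C \<and> s \<in> S}"
    and G_frac: "\<And>c s. c \<in> carrier C \<Longrightarrow> s \<in> S \<Longrightarrow> G (loc_frac C S c s) = j c \<otimes>\<^bsub>B\<^esub> inv\<^bsub>B\<^esub> (j s)"
    and frac_mult: "\<And>b c s u. b \<in> carrier C \<Longrightarrow> c \<in> carrier C \<Longrightarrow> s \<in> S \<Longrightarrow> u \<in> S \<Longrightarrow>
      loc_frac C S b s \<otimes>\<^bsub>?R\<^esub> loc_frac C S c u = loc_frac C S (b \<otimes>\<^bsub>C\<^esub> c) (s \<otimes>\<^bsub>C\<^esub> u)"
    by (rule localization_embedding[OF C_cring B.is_cring j_hom j_inj SC S_one S_mult j_units])
      (assumption+, rule that)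
  interpret R: cring ?R by (rule R)
  interpret G: ring_hom_cring ?R B G by unfold_locales (rule G)
  have frac_in: "loc_frac C S c s \<in> carrier ?R" if "c \<in> carrier C" "s \<in> S" for c s
    using that R_car by blast
  have G_one: "G (loc_frac C S c \<one>\<^bsub>C\<^esub>) = j c" if "c \<in> carrier C" for c
    using that by (simp add: G_frac S_one)
  \<comment> \<open>Multiplying by the unit \<open>j s\<close> clears the denominator, so orders of
    fractions are orders of numerators.\<close>
  have j_in_J: "j c \<in> J k" if c: "c \<in> carrier C" and s: "s \<in> S" and "G (loc_frac C S c s) \<in> J k" for c s k
  proof -
    have sC: "s \<in> carrier C" using s SC by blast
    have "j c \<otimes>\<^bsub>B\<^esub> inv\<^bsub>B\<^esub> (j s) \<otimes>\<^bsub>B\<^esub> j s \<in> J k"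
      using that(3) J.I_r_closed[of "j c \<otimes>\<^bsub>B\<^esub> inv\<^bsub>B\<^esub> (j s)" k "j s"] c sC s by (simp add: G_frac)
    then show ?thesis using j_units[OF s] c sC by (simp add: B.m_assoc)
  qed
  have M_J: "c \<in> M \<longleftrightarrow> j c \<in> J 1" if "c \<in> carrier C" for c
    using that jE[OF that] E_carrier J_1_iff[of "j c"] by (simp add: M_eq)
  have M_car: "c \<in> carrier C" if "c \<in> M" for c using that by (simp add: M_eq)
  let ?gen = "(\<lambda>x. loc_frac C S x \<one>\<^bsub>C\<^esub>) ` M"
  have I_def: "?I = Idl\<^bsub>?R\<^esub> ?gen"
    by (simp add: akizuki_max_ideal_def R_eq S_def)
  have gen_car: "?gen \<subseteq> carrier ?R" using frac_in S_one M_car by blast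
  have I: "ideal ?I ?R" unfolding I_def by (rule R.genideal_ideal[OF gen_car])
  interpret I: ideal ?I ?R by (rule I)
  have gen_I: "loc_frac C S c \<one>\<^bsub>C\<^esub> \<in> ?I" if "c \<in> M" for c
    using R.genideal_self[OF gen_car] that unfolding I_def by blast
  have I_eq: "?I = {r \<in> carrier ?R. G r \<in> J 1}"
  proof
    show "?I \<subseteq> {r \<in> carrier ?R. G r \<in> J 1}"
      unfolding I_def
    proof (rule R.genideal_minimal)
      show "ideal {r \<in> carrier ?R. G r \<in> J 1} ?R" by (rule G.ring.ideal_vimage[OF J_ideal])
      show "?gen \<subseteq> {r \<in> carrier ?R. G r \<in> J 1}"
      proof -
        have "G (loc_frac C S c \<one>\<^bsub>C\<^esub>) \<in> J 1" if "c \<in> M" for c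
          using that M_J[OF M_car[OF that]] G_one[OF M_car[OF that]] by simp
        then show ?thesis using gen_car by blast
      qed
    qed
    show "{r \<in> carrier ?R. G r \<in> J 1} \<subseteq> ?I"
    proof
      fix r assume "r \<in> {r \<in> carrier ?R. G r \<in> J 1}"
      then obtain c s where r: "r = loc_frac C S c s" "c \<in> carrier C" "s \<in> S" "G r \<in> J 1"
        using R_car by auto
      have "c \<in> M" using j_in_J[OF r(2,3)] r(1,4) M_J[OF r(2)] by simp
      have sC: "s \<in> carrier C" using r(3) SC by blast
      have "r = loc_frac C S c \<one>\<^bsub>C\<^esub> \<otimes>\<^bsub>?R\<^esub> loc_frac C S \<one>\<^bsub>C\<^esub> s"
        using frac_mult[OF r(2) C.one_closed S_one r(3)] r(1,2) sC by simp
      also have "\<dots> \<in> ?I"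
        by (intro I.I_r_closed gen_I \<open>c \<in> M\<close> frac_in C.one_closed r(3))
      finally show "r \<in> ?I" .
    qed
  qed
  \<comment> \<open>One inclusion follows from \<open>J_mult\<close>; for the other,
    \<open>E_divide\<close> splits off a factor \<open>\<tau>\<close>, an element of the maximal
    ideal, from the numerator.\<close>
  have pow: "ideal_pow ?R ?I k = {r \<in> carrier ?R. G r \<in> J k}" for k
  proof (induction k)
    case 0
    have "J 0 = carrier B" by (simp add: J_def V_0 B_simps)
    then show ?case by auto
  next
    case (Suc k)
    note pow_ideal = R.ideal_pow_ideal[OF I, of k]
    show ?case
    proof
      show "ideal_pow ?R ?I (Suc k) \<subseteq> {r \<in> carrier ?R. G r \<in> J (Suc k)}"
      proof
        fix r assume "r \<in> ideal_pow ?R ?I (Suc k)"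
        then have r: "r \<in> ideal_prod ?R (ideal_pow ?R ?I k) ?I" by simp
        from r have "r \<in> carrier ?R" using R.ideal_prod_in_carrier[OF pow_ideal I] by blast
        moreover from r have "G r \<in> J (Suc k)"
        proof (induction rule: ideal_prod.induct)
          case (prod x y)
          then have "x \<in> carrier ?R" "G x \<in> J k" unfolding Suc.IH by blast+
          moreover have "y \<in> carrier ?R" "G y \<in> J 1" using prod(2) unfolding I_eq by blast+
          ultimately show ?case using J_mult[of "G x" k "G y"] by simp
        next
          case (sum x y)
          then have "x \<in> carrier ?R" "y \<in> carrier ?R"
            using R.ideal_prod_in_carrier[OF pow_ideal I] by blast+
          then show ?case using sum.IH J.a_closed by simp
        qed
        ultimately show "r \<in> {r \<in> carrier ?R. G r \<in> J (Suc k)}" by simp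
      qed
      show "{r \<in> carrier ?R. G r \<in> J (Suc k)} \<subseteq> ideal_pow ?R ?I (Suc k)"
      proof
        fix r assume r: "r \<in> {r \<in> carrier ?R. G r \<in> J (Suc k)}"
        show "r \<in> ideal_pow ?R ?I (Suc k)"
        proof (cases k)
          \<comment> \<open>Here the claim concerns \<open>J 1\<close>, to which
            \<open>E_divide\<close> does not apply; it is \<open>I_eq\<close> itself.\<close>
          case 0
          have rI: "r \<in> ?I" using r 0 unfolding I_eq by simp
          have "\<one>\<^bsub>?R\<^esub> \<otimes>\<^bsub>?R\<^esub> r \<in> ideal_prod ?R (carrier ?R) ?I"
            by (rule ideal_prod.prod[OF R.one_closed rI])
          then show ?thesis using I.Icarr[OF rI] 0 by simp
        next
          case (Suc l)
          obtain c s where cs: "r = loc_frac C S c s" "c \<in> carrier C" "s \<in> S"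
            using r R_car by auto
          have sC: "s \<in> carrier C" using cs(3) SC by blast
          have "j c \<in> J (Suc (Suc l))" using j_in_J[OF cs(2,3)] cs(1) r Suc by simp
          then obtain e where e: "e \<in> E" "j c = T \<otimes>\<^bsub>B\<^esub> e" "e \<in> J (Suc l)"
            using E_divide[OF jE(1)[OF cs(2)]] by metis
          have eC: "fst e \<in> carrier C" "j (fst e) = e" using e(1) j_fst by (auto simp: C_eq)
          have \<tau>: "\<tau> \<in> M" "\<tau> \<in> carrier C"
          proof -
            have "fst T \<in> carrier C" using E_gens(1)[OF t_closed] by (simp add: C_eq)
            then show "\<tau> \<in> carrier C" by (simp add: \<kappa>_def)
            then show "\<tau> \<in> M" using \<tau>_V_1 by (simp add: M_eq)
          qed
          have "c = fst (T \<otimes>\<^bsub>B\<^esub> e)" using jE(2)[OF cs(2)] e(2) by simp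
          \<comment> \<open>The factorisation of pairs is projected to C; it makes r the product of
            (fst e)/s and \<open>\<tau>\<close>/1.\<close>
          then have c: "c = fst e \<otimes>\<^bsub>C\<^esub> \<tau>"
            using E_carrier[OF e(1)] by (simp add: C_eq) (simp add: \<kappa>_def H.m_comm)
          have "G (loc_frac C S (fst e) s) \<in> J (Suc l)"
            using e(3) eC cs(3) j_units J.I_r_closed by (simp add: G_frac)
          then have "loc_frac C S (fst e) s \<in> ideal_pow ?R ?I k"
            unfolding Suc.IH using Suc frac_in[OF eC(1) cs(3)] by simp
          then have "loc_frac C S (fst e) s \<otimes>\<^bsub>?R\<^esub> loc_frac C S \<tau> \<one>\<^bsub>C\<^esub> \<in> ideal_prod ?R (ideal_pow ?R ?I k) ?I"
            by (rule ideal_prod.prod[OF _ gen_I[OF \<tau>(1)]])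
          moreover have "loc_frac C S (fst e) s \<otimes>\<^bsub>?R\<^esub> loc_frac C S \<tau> \<one>\<^bsub>C\<^esub> = r"
            using frac_mult[OF eC(1) \<tau>(2) cs(3) S_one] sC c cs(1) by simp
          ultimately show ?thesis by simp
        qed
      qed
    qed
  qed
  have dense: "\<exists>r\<in>carrier ?R. G r \<ominus>\<^bsub>B\<^esub> b \<in> J k" if b: "b \<in> carrier B" for b k
  proof -
    obtain e where e: "e \<in> E" "e \<ominus>\<^bsub>B\<^esub> b \<in> J k" using E_dense[OF b] by blast
    have "fst e \<in> carrier C" using e(1) by (simp add: C_eq)
    then show ?thesis
      using e j_fst[OF e(1)] G_one frac_in[OF _ S_one] by (intro bexI[of _ "loc_frac C S (fst e) \<one>\<^bsub>C\<^esub>"]) auto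
  qed
  show ?thesis
    unfolding R_eq
    by (rule adic_completion_iso[OF R I B.is_cring G J_ideal J_Suc_subset pow dense J_separated J_complete])
qed

end

theorem corollary7:
  fixes A :: "('a, 'b) ring_scheme"
    and t :: 'a
    and a :: "nat \<Rightarrow> 'a"
    and n :: "nat \<Rightarrow> nat"
    and z :: "nat \<Rightarrow> 'a set"
  assumes "discrete_valuation_ring A"
    and "t \<in> carrier A"
    and "maximalideal (PIdl\<^bsub>A\<^esub> t) A"
    and "\<And>i. a i \<in> carrier A - PIdl\<^bsub>A\<^esub> t"
    and "n 0 = 0"
    and "\<And>r. r \<ge> 1 \<Longrightarrow> n r \<ge> 2 * n (r - 1) + 2"
    and "z \<in> carrier (completion_at A t)"
    and "adic_sums A (PIdl\<^bsub>A\<^esub> t) (\<lambda>i. to_completion_at A t (a i \<otimes>\<^bsub>A\<^esub> t [^]\<^bsub>A\<^esub> n i)) z"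
    and "ring.transcendental (completion_at A t) (to_completion_at A t ` carrier A) z"
  shows "adic_completion (akizuki_local_ring A t a n) (akizuki_max_ideal A t a n) \<simeq>
    UP (completion_at A t) Quot
      (PIdl\<^bsub>UP (completion_at A t)\<^esub>
        ((monom (UP (completion_at A t)) \<one>\<^bsub>completion_at A t\<^esub> 1
          \<oplus>\<^bsub>UP (completion_at A t)\<^esub>
          monom (UP (completion_at A t))
            (to_completion_at A t t \<otimes>\<^bsub>completion_at A t\<^esub>
              (z \<ominus>\<^bsub>completion_at A t\<^esub> to_completion_at A t (a 0))) 0)
         [^]\<^bsub>UP (completion_at A t)\<^esub> (2::nat)))"
proof -
  interpret A: discrete_valuation_ring A by fact
  have ak: "akizuki A t a n"
  proof (intro akizuki.intro dvr_uniformizer.intro akizuki_axioms.intro dvr_uniformizer_axioms.intro)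
    show "2 * n r + 2 \<le> n (Suc r)" for r using assms(6)[of "Suc r"] by simp
  qed (use assms in auto)
  interpret K: akizuki A t a n by (rule ak)
  \<comment> \<open>The given series and the tail with index 0 have the same terms because
    \<open>n 0 = 0\<close>.\<close>
  have Z0: "akizuki_z A t a n 0 = z" by (rule K.Z_0[OF assms(8)])
  interpret K: akizuki_construction A t a n
    by (intro akizuki_construction.intro ak akizuki_construction_axioms.intro) (use assms(9) Z0 in simp)
  let ?U = "UP K.H Quot
      (PIdl\<^bsub>UP K.H\<^esub> ((monom (UP K.H) \<one>\<^bsub>K.H\<^esub> 1 \<oplus>\<^bsub>UP K.H\<^esub>
        monom (UP K.H) (K.\<tau> \<otimes>\<^bsub>K.H\<^esub> (z \<ominus>\<^bsub>K.H\<^esub> K.\<iota> (a 0))) 0) [^]\<^bsub>UP K.H\<^esub> (2::nat)))"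
  \<comment> \<open>Nontriviality of the completion is the side condition under which polynomials
    can be divided by X + t (z - a_0).\<close>
  have "\<one>\<^bsub>K.H\<^esub> \<noteq> \<zero>\<^bsub>K.H\<^esub>" using K.H_one_notin K.V.zero_closed by metis
  then have nontriv: "carrier K.H \<noteq> {\<zero>\<^bsub>K.H\<^esub>}" using K.H.one_closed by blast
  have s: "K.\<tau> \<otimes>\<^bsub>K.H\<^esub> (z \<ominus>\<^bsub>K.H\<^esub> K.\<iota> (a 0)) \<in> carrier K.H" using assms(7) by simp
  have iso: "?U \<simeq> K.B"
    by (rule UP_Quot_square_iso_dual_numbers[OF K.H.is_cring s nontriv])
  interpret U: UP_cring K.H "UP K.H" by (intro UP_cring.intro K.H.is_cring)
  have "ring ?U"
    by (intro ideal.quotient_is_ring U.P.cgenideal_ideal U.P.nat_pow_closed U.P.a_closed U.monom_closed s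
        K.H.one_closed)
  from ring_iso_sym[OF this iso] show ?thesis
    by (rule ring_iso_trans[OF K.completion_iso_dual_numbers])
qed

end
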